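(* Let $d\ge1$ and $d\le n-d$. The multiplicity of $X_{d,n}$ at $P_\sigma$ (the origin) is equal to $$\frac{\left(d(n-d)\right)!}{(n-1)(n-2)^2\cdots(n-d)^d(n-d-1)^d\cdots(d)^d(d-1)^{d-1}\cdots(2)^2(1)},$$ where the denominator is $\prod_{h=1}^{n-1}h^{\min(h,\,d,\,n-h)}$.
   Context: $K$ is an algebraically closed field of arbitrary characteristic. $I_{d,n}=\{(i_1,\dots,i_d)\in\mathbb{Z}^d: 1\le i_1<\dots<i_d\le n\}$ with the componentwise order, a finite distributive lattice (join and meet are componentwise max and min). $X_{d,n}=X(I_{d,n})\subset\mathbb{A}^{\#I_{d,n}}$ is the affine toric variety whose vanishing ideal in $K[X_\alpha,\alpha\in I_{d,n}]$ is generated by the binomials $X_\alpha X_\beta-X_{\alpha\vee\beta}X_{\alpha\wedge\beta}$. Writing $X_{d,n}=X_\sigma$ for its associated (full-dimensional, strongly convex) cone $\sigma$, the distinguished point $P_\sigma$ of the face $\sigma$ is the origin of $\mathbb{A}^{\#I_{d,n}}$, the unique torus-fixed point. The multiplicity $\mathrm{mult}_PX$ of a variety $X$ at a closed point $P$ is the degree of the graded ring $\mathrm{gr}(\mathcal{O}_{X,P},\mathfrak{m}_P)$ (for a graded ring of dimension $r+1$, its degree $e$ is defined by the leading coefficient $e/r!$ of the Hilbert polynomial). *)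

theory Defs
  imports
    "HOL-Library.Poly_Mapping"
    "HOL-Library.Extended_Nat"
    "HOL-Computational_Algebra.Polynomial"
    "HOL-Algebra.Embedded_Algebras"
    "HOL-Algebra.Ideal_Product"
begin

section \<open>Affine varieties\<close>

type_synonym ('v, 'k) mpoly = "('v \<Rightarrow>\<^sub>0 nat) \<Rightarrow>\<^sub>0 'k"

definition poly_ring :: "'v set \<Rightarrow> ('v, 'k::comm_ring_1) mpoly ring" where
  "poly_ring I = \<lparr>carrier = {p. \<forall>m\<in>Poly_Mapping.keys p. Poly_Mapping.keys m \<subseteq> I},
                  mult = (*), one = 1, zero = 0, add = (+)\<rparr>"

definition var :: "'v \<Rightarrow> ('v, 'k::comm_ring_1) mpoly" where
  "var v = Poly_Mapping.single (Poly_Mapping.single v 1) 1"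

definition eval_at :: "('v \<Rightarrow> 'k::comm_ring_1) \<Rightarrow> ('v, 'k) mpoly \<Rightarrow> 'k" where
  "eval_at x p = (\<Sum>m\<in>Poly_Mapping.keys p. Poly_Mapping.lookup p m *
                    (\<Prod>v\<in>Poly_Mapping.keys m. x v ^ Poly_Mapping.lookup m v))"

definition affine_space :: "'v set \<Rightarrow> ('v \<Rightarrow> 'k) set" where
  "affine_space I = I \<rightarrow>\<^sub>E UNIV"

definition origin :: "'v set \<Rightarrow> ('v \<Rightarrow> 'k::zero)" where
  "origin I = (\<lambda>v\<in>I. 0)"

definition zero_locus :: "'v set \<Rightarrow> ('v, 'k::comm_ring_1) mpoly set \<Rightarrow> ('v \<Rightarrow> 'k) set" where
  "zero_locus I F = {x \<in> affine_space I. \<forall>p\<in>F. eval_at x p = 0}"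

definition vanishing_ideal :: "'v set \<Rightarrow> ('v \<Rightarrow> 'k::comm_ring_1) set \<Rightarrow> ('v, 'k) mpoly set" where
  "vanishing_ideal I X = {p \<in> carrier (poly_ring I). \<forall>x\<in>X. eval_at x p = 0}"

definition coordinate_ring :: "'v set \<Rightarrow> ('v \<Rightarrow> 'k::comm_ring_1) set \<Rightarrow> ('v, 'k) mpoly set ring" where
  "coordinate_ring I X = poly_ring I Quot vanishing_ideal I X"

text \<open>The elements of the coordinate ring are cosets; for \<open>P \<in> X\<close> all members of a coset have
  the same value at \<open>P\<close>.\<close>

definition point_ideal ::
    "'v set \<Rightarrow> ('v \<Rightarrow> 'k::comm_ring_1) set \<Rightarrow> ('v \<Rightarrow> 'k) \<Rightarrow> ('v, 'k) mpoly set set" where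
  "point_ideal I X P = {A \<in> carrier (coordinate_ring I X). \<forall>p\<in>A. eval_at P p = 0}"


section \<open>Localization and the local ring at a point\<close>

text \<open>The fraction \<open>a/s\<close>, as the class of all pairs \<open>(b, t)\<close> with \<open>u(ta - sb) = 0\<close> for some
  \<open>u \<in> S\<close>.\<close>

definition fraction :: "('a, 'm) ring_scheme \<Rightarrow> 'a set \<Rightarrow> 'a \<Rightarrow> 'a \<Rightarrow> ('a \<times> 'a) set" where
  "fraction R S a s = {(b, t). b \<in> carrier R \<and> t \<in> S \<and>
     (\<exists>u\<in>S. u \<otimes>\<^bsub>R\<^esub> (t \<otimes>\<^bsub>R\<^esub> a) = u \<otimes>\<^bsub>R\<^esub> (s \<otimes>\<^bsub>R\<^esub> b))}"

definition localization :: "('a, 'm) ring_scheme \<Rightarrow> 'a set \<Rightarrow> ('a \<times> 'a) set ring" where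
  "localization R S =
     \<lparr>carrier = {fraction R S a s | a s. a \<in> carrier R \<and> s \<in> S},
      mult = (\<lambda>A B. \<Union>(a, s)\<in>A. \<Union>(b, t)\<in>B. fraction R S (a \<otimes>\<^bsub>R\<^esub> b) (s \<otimes>\<^bsub>R\<^esub> t)),
      one = fraction R S \<one>\<^bsub>R\<^esub> \<one>\<^bsub>R\<^esub>,
      zero = fraction R S \<zero>\<^bsub>R\<^esub> \<one>\<^bsub>R\<^esub>,
      add = (\<lambda>A B. \<Union>(a, s)\<in>A. \<Union>(b, t)\<in>B.
               fraction R S ((t \<otimes>\<^bsub>R\<^esub> a) \<oplus>\<^bsub>R\<^esub> (s \<otimes>\<^bsub>R\<^esub> b)) (s \<otimes>\<^bsub>R\<^esub> t))\<rparr>"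

definition local_ring_at ::
    "'v set \<Rightarrow> ('v \<Rightarrow> 'k::comm_ring_1) set \<Rightarrow> ('v \<Rightarrow> 'k) \<Rightarrow>
      (('v, 'k) mpoly set \<times> ('v, 'k) mpoly set) set ring" where
  "local_ring_at I X P =
     localization (coordinate_ring I X) (carrier (coordinate_ring I X) - point_ideal I X P)"

text \<open>Only meaningful for a ring with exactly one maximal ideal.\<close>

definition the_maximal_ideal :: "('a, 'm) ring_scheme \<Rightarrow> 'a set" where
  "the_maximal_ideal R = (THE M. maximalideal M R)"


section \<open>Associated graded ring\<close>

primrec ideal_power :: "('a, 'm) ring_scheme \<Rightarrow> 'a set \<Rightarrow> nat \<Rightarrow> 'a set" where
  "ideal_power R M 0 = carrier R"
| "ideal_power R M (Suc k) = ideal_prod R (ideal_power R M k) M"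

text \<open>An element of \<open>gr(R, M) = \<Oplus>\<^sub>k M\<^sup>k/M\<^sup>k\<^sup>+\<^sup>1\<close> is the family \<open>f\<close> of its homogeneous components,
  \<open>f k\<close> being a coset of \<open>M\<^sup>k\<^sup>+\<^sup>1\<close> with representative in \<open>M\<^sup>k\<close>.  The product of the classes of
  \<open>a \<in> M\<^sup>i\<close> and \<open>b \<in> M\<^sup>j\<close> is the class of \<open>ab\<close> modulo \<open>M\<^sup>i\<^sup>+\<^sup>j\<^sup>+\<^sup>1\<close>.\<close>

definition assoc_graded :: "('a, 'm) ring_scheme \<Rightarrow> 'a set \<Rightarrow> (nat \<Rightarrow> 'a set) ring" where
  "assoc_graded R M =
     \<lparr>carrier = {f. (\<forall>k. \<exists>a\<in>ideal_power R M k. f k = ideal_power R M (Suc k) +>\<^bsub>R\<^esub> a) \<and>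
                    finite {k. f k \<noteq> ideal_power R M (Suc k)}},
      mult = (\<lambda>f g k. finsum (R Quot ideal_power R M (Suc k))
                (\<lambda>i. rcoset_mult R (ideal_power R M (Suc k)) (f i) (g (k - i))) {..k}),
      one = (\<lambda>k. if k = 0 then ideal_power R M (Suc 0) +>\<^bsub>R\<^esub> \<one>\<^bsub>R\<^esub> else ideal_power R M (Suc k)),
      zero = (\<lambda>k. ideal_power R M (Suc k)),
      add = (\<lambda>f g k. f k <+>\<^bsub>R\<^esub> g k)\<rparr>"


section \<open>Dimension, Hilbert polynomial and degree of a graded ring\<close>

definition krull_dim :: "('a, 'm) ring_scheme \<Rightarrow> enat" where
  "krull_dim R = Sup {enat m | m.
     \<exists>P :: nat \<Rightarrow> 'a set. (\<forall>i\<le>m. primeideal (P i) R) \<and> (\<forall>i<m. P i \<subset> P (Suc i))}"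

text \<open>From here on, graded rings are rings of families indexed by the degree, as above.  Their
  degree-zero part is assumed to be a field, over which dimensions of the homogeneous parts are
  taken.\<close>

definition homogeneous_part :: "(nat \<Rightarrow> 'a, 'm) ring_scheme \<Rightarrow> nat \<Rightarrow> (nat \<Rightarrow> 'a) set" where
  "homogeneous_part G k = {f \<in> carrier G. \<forall>j. j \<noteq> k \<longrightarrow> f j = \<zero>\<^bsub>G\<^esub> j}"

definition hilbert_function :: "(nat \<Rightarrow> 'a, 'm) ring_scheme \<Rightarrow> nat \<Rightarrow> nat" where
  "hilbert_function G k = ring.dim G (homogeneous_part G 0) (homogeneous_part G k)"

definition is_hilbert_polynomial :: "(nat \<Rightarrow> 'a, 'm) ring_scheme \<Rightarrow> rat poly \<Rightarrow> bool" where
  "is_hilbert_polynomial G H \<longleftrightarrow>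
     (\<exists>N. \<forall>k\<ge>N. poly H (of_nat k) = of_nat (hilbert_function G k))"

text \<open>If \<open>G\<close> has dimension \<open>r + 1\<close>, the leading coefficient of its Hilbert polynomial is
  \<open>e/r!\<close> with \<open>e\<close> the degree; rings of dimension \<open>0\<close> are not covered.\<close>

definition graded_degree :: "(nat \<Rightarrow> 'a, 'm) ring_scheme \<Rightarrow> rat" where
  "graded_degree G = (THE e. \<exists>r H. krull_dim G = enat (r + 1) \<and>
     is_hilbert_polynomial G H \<and> lead_coeff H = e / fact r)"

definition mult_at :: "'v set \<Rightarrow> ('v \<Rightarrow> 'k::comm_ring_1) set \<Rightarrow> ('v \<Rightarrow> 'k) \<Rightarrow> rat" where
  "mult_at I X P =
     (let R = local_ring_at I X P in graded_degree (assoc_graded R (the_maximal_ideal R)))"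


section \<open>The toric variety of \<open>I\<^sub>d\<^sub>,\<^sub>n\<close>\<close>

definition index_set :: "nat \<Rightarrow> nat \<Rightarrow> nat list set" where
  "index_set d n = {\<alpha>. length \<alpha> = d \<and> sorted_wrt (<) \<alpha> \<and> set \<alpha> \<subseteq> {1..n}}"

definition join_ix :: "nat list \<Rightarrow> nat list \<Rightarrow> nat list" where
  "join_ix = map2 max"

definition meet_ix :: "nat list \<Rightarrow> nat list \<Rightarrow> nat list" where
  "meet_ix = map2 min"

definition hibi_binomials :: "nat \<Rightarrow> nat \<Rightarrow> (nat list, 'k::comm_ring_1) mpoly set" where
  "hibi_binomials d n =
     {var \<alpha> * var \<beta> - var (join_ix \<alpha> \<beta>) * var (meet_ix \<alpha> \<beta>) | \<alpha> \<beta>.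
        \<alpha> \<in> index_set d n \<and> \<beta> \<in> index_set d n}"

text \<open>The only algebraic set whose vanishing ideal can be the ideal generated by the binomials is
  the zero locus of that ideal, hence of the binomials.  The coordinate ring above divides by the
  full vanishing ideal of this set; that the binomials generate it is not built in.\<close>

definition hibi_variety :: "nat \<Rightarrow> nat \<Rightarrow> (nat list \<Rightarrow> 'k::comm_ring_1) set" where
  "hibi_variety d n = zero_locus (index_set d n) (hibi_binomials d n)"

end

theory Submission
  imports
    "HOL-Computational_Algebra.Fraction_Field"
    "Jordan_Normal_Form.Determinant"
    Defs
begin

text \<open>
  Sending \<open>X\<^sub>\<alpha>\<close> to the monomial \<open>\<Prod>\<^sub>j y\<^sub>j\<^sub>,\<^sub>\<alpha>\<^sub>j\<close> identifies the coordinate ring with a monoid algebra \<open>K[S]\<close>: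
  the binomials rewrite every monomial to one supported on a multichain, and the images of the
  multichain monomials are distinct, hence linearly independent as functions on the torus.  Since
  \<open>K[S]\<close> is a domain generated in degree one, the local ring at the vertex embeds into its fraction
  field, the powers of the maximal ideal are the fractions with numerator of order at least \<open>k\<close>, and
  the associated graded ring is \<open>K[S]\<close> again.  So its Hilbert function counts multichains.

  The number of multichains below \<open>\<beta>\<close> is a polynomial of degree \<open>rank \<beta>\<close> in the length, and its top
  coefficient \<open>F \<beta>\<close> satisfies \<open>rank \<beta> * F \<beta> = (\<Sum>\<gamma> covered by \<beta>. F \<gamma>)\<close>.  The solution of this
  recurrence is the determinant with entries \<open>1 / (\<beta>\<^sub>i - 1 - j)!\<close>, which for the top element is the
  inverse of the hook product of the \<open>d \<times> (n - d)\<close> rectangle.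

  The dimension is bounded above by the growth of the Hilbert function (each strict inclusion of
  primes lowers the degree of growth) and below by the primes belonging to a maximal chain of faces.
\<close>

section \<open>Determinants with inverse factorial entries\<close>

text \<open>The local ring is given as classes of pairs of cosets, and no computation takes place
  there. The only fact extracted from that encoding is an embedding with image \<open>loc 0\<close>,
  the fractions whose denominator has nonzero constant term, inside the fraction field of an
  integral domain given by type classes. This is why exponents carry a linear order: it makes
  \<open>'m \<Rightarrow>\<^sub>0 'k\<close> a domain.

  The variety is given by its points, so the rewriting by binomials is never carried out inside an
  ideal. It is applied to the values of monomials at points of the variety, including points with
  zero coordinates, and this shows that the vanishing ideal is the kernel of the toric substitution.

  The coefficient F \<beta> is the number of saturated chains from the bottom index to \<beta>,
  divided by the factorial of the rank of \<beta>. The exponent min(h, d, n - h) of the statement is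
  the number of cells of hook length h in the rectangle, and d \<le> n - d is what gives this number
  that form.\<close>

definition inv_fact :: "nat \<Rightarrow> nat \<Rightarrow> rat" where
  "inv_fact a j = (if j < a then 1 / fact (a - 1 - j) else 0)"

text \<open>With m = a - 1 - j and 1/m! read as 0 for negative m, this is 1/(m - 1)! = m * (1/m!).
  At \<open>j = a - 1\<close> the factor m vanishes together with the left side.\<close>

lemma inv_fact_pred:
  assumes "1 \<le> a"
  shows "inv_fact (a - 1) j = (of_nat a - 1 - of_nat j) * inv_fact a j"
proof (cases "j + 1 < a")
  case True
  then obtain c where "a = j + c + 2"
    by (metis Suc_eq_plus1 add.commute add_2_eq_Suc' add_Suc_right less_iff_Suc_add)
  moreover have "1 + of_nat c \<noteq> (0::rat)" by (metis of_nat_Suc of_nat_neq_0)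
  ultimately show ?thesis by (simp add: inv_fact_def field_simps del: of_nat_Suc)
next
  case False
  then consider "a = j + 1" | "a \<le> j" using assms by linarith
  then show ?thesis by cases (auto simp: inv_fact_def)
qed

text \<open>With the partition \<lambda> given by \<open>\<alpha> ! i - (i + 1)\<close>, the entries
  are 1/(\<lambda>_i + i - j)!. This is Aitken's determinant: the number of standard tableaux of
  shape \<lambda> divided by the factorial of their size. Those tableaux correspond to the saturated
  chains from the bottom index to \<alpha>.\<close>

definition chain_det :: "nat list \<Rightarrow> rat" where
  "chain_det \<alpha> = det (mat (length \<alpha>) (length \<alpha>) (\<lambda>(i, j). inv_fact (\<alpha> ! i) j))"

lemma chain_det_leibniz:
  "chain_det \<alpha> = (\<Sum>p | p permutes {0..<length \<alpha>}.
     signof p * (\<Prod>i = 0..<length \<alpha>. inv_fact (\<alpha> ! i) (p i)))"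
proof -
  have "(\<Prod>i = 0..<length \<alpha>. mat (length \<alpha>) (length \<alpha>) (\<lambda>(i, j). inv_fact (\<alpha> ! i) j) $$ (i, p i))
      = (\<Prod>i = 0..<length \<alpha>. inv_fact (\<alpha> ! i) (p i))" if "p permutes {0..<length \<alpha>}" for p
    using permutes_in_image[OF that] by (intro prod.cong) auto
  then show ?thesis
    unfolding chain_det_def by (subst det_def'[of _ "length \<alpha>"]) (auto intro!: sum.cong)
qed

text \<open>By \<open>inv_fact_pred\<close>, lowering entry i multiplies column j of row i by
  \<open>\<alpha> ! i - 1 - j\<close>. A Leibniz term meets row i once, in column
  \<open>p i\<close>, so it picks up a single factor.\<close>

lemma chain_det_update:
  assumes "i < length \<alpha>" "1 \<le> \<alpha> ! i"
  shows "chain_det (\<alpha>[i := \<alpha> ! i - 1]) = (\<Sum>p | p permutes {0..<length \<alpha>}.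
     (of_nat (\<alpha> ! i) - 1 - of_nat (p i)) *
       (signof p * (\<Prod>i = 0..<length \<alpha>. inv_fact (\<alpha> ! i) (p i))))"
proof -
  have "(\<Prod>k = 0..<length \<alpha>. inv_fact (\<alpha>[i := \<alpha> ! i - 1] ! k) (p k))
      = (of_nat (\<alpha> ! i) - 1 - of_nat (p i)) * (\<Prod>i = 0..<length \<alpha>. inv_fact (\<alpha> ! i) (p i))" for p
  proof -
    have "(\<Prod>k = 0..<length \<alpha>. inv_fact (\<alpha>[i := \<alpha> ! i - 1] ! k) (p k))
      = inv_fact (\<alpha> ! i - 1) (p i) * (\<Prod>k \<in> {0..<length \<alpha>} - {i}. inv_fact (\<alpha> ! k) (p k))"
      using assms by (subst prod.remove[of _ i]) (auto intro!: prod.cong)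
    also have "\<dots> = (of_nat (\<alpha> ! i) - 1 - of_nat (p i)) *
        (inv_fact (\<alpha> ! i) (p i) * (\<Prod>k \<in> {0..<length \<alpha>} - {i}. inv_fact (\<alpha> ! k) (p k)))"
      by (simp only: inv_fact_pred[OF assms(2)] mult.assoc)
    also have "inv_fact (\<alpha> ! i) (p i) * (\<Prod>k \<in> {0..<length \<alpha>} - {i}. inv_fact (\<alpha> ! k) (p k))
      = (\<Prod>i = 0..<length \<alpha>. inv_fact (\<alpha> ! i) (p i))"
      using assms by (subst (2) prod.remove[of _ i]) auto
    finally show ?thesis .
  qed
  then show ?thesis
    by (subst chain_det_leibniz) (auto intro!: sum.cong)
qed

text \<open>Added over i, the factors of \<open>chain_det_update\<close> involve p only through the
  sum of all \<open>p i\<close>, which a permutation leaves unchanged. The common factor therefore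
  leaves the Leibniz sum; for a member of \<open>index_set\<close> it is the rank.\<close>

lemma chain_det_recurrence:
  assumes "\<And>i. i < length \<alpha> \<Longrightarrow> 1 \<le> \<alpha> ! i"
  shows "(\<Sum>i<length \<alpha>. chain_det (\<alpha>[i := \<alpha> ! i - 1]))
       = (\<Sum>i<length \<alpha>. of_nat (\<alpha> ! i) - 1 - of_nat i) * chain_det \<alpha>"
proof -
  let ?d = "length \<alpha>"
  let ?t = "\<lambda>p. signof p * (\<Prod>i = 0..<?d. inv_fact (\<alpha> ! i) (p i))"
  have "(\<Sum>i<?d. chain_det (\<alpha>[i := \<alpha> ! i - 1]))
      = (\<Sum>i<?d. \<Sum>p | p permutes {0..<?d}. (of_nat (\<alpha> ! i) - 1 - of_nat (p i)) * ?t p)"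
    using assms by (intro sum.cong refl chain_det_update) auto
  also have "\<dots> = (\<Sum>p | p permutes {0..<?d}. (\<Sum>i<?d. of_nat (\<alpha> ! i) - 1 - of_nat (p i)) * ?t p)"
    by (subst sum.swap) (simp add: sum_distrib_right)
  also have "\<dots> = (\<Sum>p | p permutes {0..<?d}. (\<Sum>i<?d. of_nat (\<alpha> ! i) - 1 - of_nat i) * ?t p)"
  proof (intro sum.cong refl)
    fix p assume "p \<in> {p. p permutes {0..<?d}}"
    then have "(\<Sum>i<?d. of_nat (p i)) = (\<Sum>i<?d. of_nat i :: rat)"
      using sum.permute[of p "{0..<?d}" "\<lambda>i. of_nat i :: rat"] by (simp add: atLeast0LessThan)
    then show "(\<Sum>i<?d. of_nat (\<alpha> ! i) - 1 - of_nat (p i)) * ?t p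
        = (\<Sum>i<?d. of_nat (\<alpha> ! i) - 1 - of_nat i) * ?t p"
      by (simp add: sum_subtractf)
  qed
  finally show ?thesis
    by (simp add: chain_det_leibniz sum_distrib_left)
qed

text \<open>This lemma and the next dispose of boundary terms: lowering an entry leaves the index
  set only by creating an entry 0, which is a zero row, or a repeated entry, which is a repeated
  row.\<close>

lemma chain_det_eq_0_if_zero_entry:
  assumes "i < length \<alpha>" "\<alpha> ! i = 0"
  shows "chain_det \<alpha> = 0"
proof -
  have "(\<Prod>k = 0..<length \<alpha>. inv_fact (\<alpha> ! k) (p k)) = 0" for p
    using assms by (auto intro!: bexI[of _ i] simp: inv_fact_def)
  then show ?thesis unfolding chain_det_leibniz by (simp only: mult_zero_right sum.neutral_const)
qed

lemma chain_det_eq_0_if_equal_entries: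
  assumes "i < length \<alpha>" "j < length \<alpha>" "i \<noteq> j" "\<alpha> ! i = \<alpha> ! j"
  shows "chain_det \<alpha> = 0"
  unfolding chain_det_def
  by (rule det_identical_rows[OF _ assms(3,1,2)]) (use assms in \<open>auto intro!: eq_vecI\<close>)

lemma chain_det_bottom: "chain_det (map Suc [0..<d]) = 1"
  unfolding chain_det_def
  by (subst det_lower_triangular[of d])
     (auto simp: inv_fact_def prod_list_diag_prod intro!: prod.neutral)

text \<open>An LU factorization: 1/(N + i - j)! is j!/(N + i)! times the binomial coefficient of N +
  i over j, and Vandermonde's identity splits that coefficient into a lower triangular factor in (i,
  k) and an upper triangular one in (k, j). The diagonals are 1/(N + i)! and j!.\<close>

lemma chain_det_rectangle:
  "chain_det (map (\<lambda>i. N + i + 1) [0..<d]) = (\<Prod>i<d. fact i / fact (N + i))"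
proof -
  define A :: "rat mat" where "A = mat d d (\<lambda>(i, k). of_nat (i choose k) / fact (N + i))"
  define B :: "rat mat" where
    "B = mat d d (\<lambda>(k, j). if k \<le> j then fact j * of_nat (N choose (j - k)) else 0)"
  have "mat d d (\<lambda>(i, j). inv_fact (map (\<lambda>i. N + i + 1) [0..<d] ! i) j) = A * B"
  proof (rule eq_matI)
    fix i j assume "i < dim_row (A * B)" "j < dim_col (A * B)"
    then have ij: "i < d" "j < d" by (auto simp: A_def B_def)
    have "(A * B) $$ (i, j)
        = (\<Sum>k<d. of_nat (i choose k) / fact (N + i)
             * (if k \<le> j then fact j * of_nat (N choose (j - k)) else 0))"
      using ij by (simp add: A_def B_def scalar_prod_def atLeast0LessThan)
    also have "\<dots> = (\<Sum>k\<le>j. of_nat (i choose k) / fact (N + i) * (fact j * of_nat (N choose (j - k))))"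
      using ij by (intro sum.mono_neutral_cong_right) auto
    also have "\<dots> = fact j / fact (N + i) * of_nat (\<Sum>k\<le>j. (i choose k) * (N choose (j - k)))"
      by (simp add: sum_distrib_left mult_ac)
    also have "\<dots> = fact j / fact (N + i) * of_nat ((N + i) choose j)"
      by (simp only: vandermonde add.commute)
    also have "\<dots> = inv_fact (N + i + 1) j"
      by (cases "j \<le> N + i") (auto simp: inv_fact_def binomial_fact field_simps binomial_eq_0)
    finally show "mat d d (\<lambda>(i, j). inv_fact (map (\<lambda>i. N + i + 1) [0..<d] ! i) j) $$ (i, j)
        = (A * B) $$ (i, j)"
      using ij by simp
  qed (auto simp: A_def B_def)
  moreover have "det A = (\<Prod>i<d. 1 / fact (N + i))"
    by (subst det_lower_triangular[of d])
       (auto simp: A_def prod_list_diag_prod atLeast0LessThan intro!: prod.cong)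
  moreover have "det B = (\<Prod>i<d. fact i)"
    by (subst det_upper_triangular[of _ d])
       (auto simp: B_def prod_list_diag_prod atLeast0LessThan intro!: prod.cong)
  moreover have "det (A * B) = det A * det B"
    by (rule det_mult[of _ d]) (auto simp: A_def B_def)
  ultimately show ?thesis
    unfolding chain_det_def by (simp flip: prod.distrib)
qed

text \<open>The quotient (N + i)!/i! is the product of the hook lengths i + 1, ..., N + i of one row
  of the rectangle. After exchanging the products, h occurs once for every i with h - N \<le> i <
  min d h; for h > N, \<open>d \<le> N\<close> makes this number N + d - h.\<close>

lemma hook_product_rectangle:
  assumes "d \<le> N"
  shows "(\<Prod>h = 1..N + d - 1. of_nat h ^ min h (min d (N + d - h))) = (\<Prod>i<d. fact (N + i) / fact i :: rat)"
proof -
  have quot: "fact (N + i) / fact i = (\<Prod>h\<in>{i + 1..N + i}. of_nat h :: rat)" for i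
  proof -
    have "(\<Prod>h\<in>{1..N + i}. of_nat h :: rat) = (\<Prod>h\<in>{1..i} \<union> {i + 1..N + i}. of_nat h)"
      by (intro prod.cong) auto
    also have "\<dots> = (\<Prod>h\<in>{1..i}. of_nat h) * (\<Prod>h\<in>{i + 1..N + i}. of_nat h)"
      by (rule prod.union_disjoint) auto
    finally show ?thesis by (simp add: fact_prod field_simps)
  qed
  have "(\<Prod>i<d. fact (N + i) / fact i) =
      (\<Prod>i<d. \<Prod>h | h \<in> {1..N + d - 1} \<and> i + 1 \<le> h \<and> h \<le> N + i. of_nat h :: rat)"
    unfolding quot by (intro prod.cong) auto
  also have "\<dots> = (\<Prod>h = 1..N + d - 1. \<Prod>i | i \<in> {..<d} \<and> i + 1 \<le> h \<and> h \<le> N + i. of_nat h :: rat)"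
    by (rule prod.swap_restrict) auto
  also have "\<dots> = (\<Prod>h = 1..N + d - 1. of_nat h ^ min h (min d (N + d - h)))"
  proof (intro prod.cong refl)
    fix h assume "h \<in> {1..N + d - 1}"
    moreover have "{i. i \<in> {..<d} \<and> i + 1 \<le> h \<and> h \<le> N + i} = {h - N..<min d h}" by auto
    ultimately have "card {i. i \<in> {..<d} \<and> i + 1 \<le> h \<and> h \<le> N + i} = min h (min d (N + d - h))"
      using assms by auto
    then show "(\<Prod>i | i \<in> {..<d} \<and> i + 1 \<le> h \<and> h \<le> N + i. of_nat h :: rat)
        = of_nat h ^ min h (min d (N + d - h))" by simp
  qed
  finally show ?thesis by simp
qed

section \<open>Counting multichains\<close>

alias coeff = Polynomial.coeff

section \<open>Polynomials with prescribed differences\<close>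

definition falling_poly :: "nat \<Rightarrow> rat poly" where
  "falling_poly m = (\<Prod>i<m. [:- of_nat i, 1:])"

lemma falling_poly_monic: "lead_coeff (falling_poly m) = 1" "degree (falling_poly m) = m"
proof -
  show "lead_coeff (falling_poly m) = 1"
    unfolding falling_poly_def lead_coeff_prod by simp
  show "degree (falling_poly m) = m"
    unfolding falling_poly_def by (subst degree_prod_eq_sum_degree) auto
qed

text \<open>The discrete counterpart of differentiating a power: the two products share m factors,
  and the remaining factors x + 1 and x - m differ by m + 1.\<close>

lemma falling_poly_difference:
  "poly (falling_poly (Suc m)) (x + 1) - poly (falling_poly (Suc m)) x
    = of_nat (Suc m) * poly (falling_poly m) x"
proof -
  have "poly (falling_poly (Suc m)) (x + 1) = (x + 1) * (\<Prod>i<m. x - of_nat i)"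
    unfolding falling_poly_def prod.lessThan_Suc_shift by (simp add: poly_prod)
  moreover have "poly (falling_poly (Suc m)) x = (\<Prod>i<m. x - of_nat i) * (x - of_nat m)"
    by (simp add: falling_poly_def poly_prod algebra_simps)
  ultimately show ?thesis
    by (simp add: falling_poly_def poly_prod algebra_simps)
qed

text \<open>The top term is matched by a multiple of a falling factorial, whose antidifference is a
  multiple of the next one; the remainder has smaller degree. Degrees are only bounded, because the
  remainder may drop by more than one.\<close>

lemma antidifference_exists:
  fixes p :: "rat poly"
  assumes "degree p \<le> m"
  shows "\<exists>q. (\<forall>x. poly q (x + 1) - poly q x = poly p x) \<and> degree q \<le> Suc m
           \<and> coeff q (Suc m) = coeff p m / of_nat (Suc m)"
  using assms
proof (induction m arbitrary: p)
  case 0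
  then obtain c where p: "p = [:c:]" by (metis degree_eq_zeroE le_zero_eq)
  show ?case by (rule exI[of _ "[:0, c:]"]) (auto simp: p algebra_simps)
next
  case (Suc m)
  define c where "c = coeff p (Suc m)"
  define p' where "p' = p - smult c (falling_poly (Suc m))"
  have "degree p' \<le> m"
  proof (rule degree_le, intro allI impI)
    fix i assume "m < i"
    then consider "i = Suc m" | "i > Suc m" by linarith
    then show "coeff p' i = 0"
    proof cases
      case 1
      then show ?thesis
        using falling_poly_monic[of "Suc m"] by (simp add: p'_def c_def)
    next
      case 2
      then show ?thesis
        using Suc.prems falling_poly_monic(2)[of "Suc m"] by (simp add: p'_def coeff_eq_0)
    qed
  qed
  from Suc.IH[OF this] obtain q' where
    q': "\<And>x. poly q' (x + 1) - poly q' x = poly p' x" "degree q' \<le> Suc m" by blast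
  define q where "q = q' + smult (c / of_nat (Suc (Suc m))) (falling_poly (Suc (Suc m)))"
  have "poly q (x + 1) - poly q x = poly p x" for x
  proof -
    have "poly q (x + 1) - poly q x = poly p' x + c / of_nat (Suc (Suc m)) *
       (poly (falling_poly (Suc (Suc m))) (x + 1) - poly (falling_poly (Suc (Suc m))) x)"
      by (simp add: q_def right_diff_distrib flip: q'(1))
    also have "\<dots> = poly p x"
      unfolding falling_poly_difference by (simp add: p'_def del: of_nat_Suc)
    finally show ?thesis .
  qed
  moreover have "degree q \<le> Suc (Suc m)"
    unfolding q_def using q'(2) falling_poly_monic(2)[of "Suc (Suc m)"]
    by (intro degree_add_le) (auto intro: order_trans[OF degree_smult_le])
  moreover have "coeff q (Suc (Suc m)) = c / of_nat (Suc (Suc m))"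
    using q'(2) falling_poly_monic[of "Suc (Suc m)"]
    by (simp add: q_def coeff_eq_0 del: of_nat_Suc)
  ultimately show ?case unfolding c_def by blast
qed

text \<open>Feeds the dimension bound, where sizes are natural numbers: hence a natural
  \<open>C\<close>, and the base \<open>k + 1\<close> so that the bound does not collapse at k =
  0.\<close>

lemma poly_le_power:
  fixes p :: "rat poly"
  assumes "degree p \<le> r"
  shows "\<exists>C::nat. \<forall>k. poly p (of_nat k) \<le> of_nat (C * (k + 1) ^ r)"
proof -
  obtain C :: nat where C: "(\<Sum>i\<le>degree p. \<bar>coeff p i\<bar>) \<le> of_nat C"
    using real_arch_simple[of "of_rat (\<Sum>i\<le>degree p. \<bar>coeff p i\<bar>)"]
    by (metis of_rat_less_eq of_rat_of_nat_eq)
  have "poly p (of_nat k) \<le> of_nat (C * (k + 1) ^ r)" for k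
  proof -
    have "poly p (of_nat k) \<le> (\<Sum>i\<le>degree p. \<bar>coeff p i\<bar> * of_nat ((k + 1) ^ r))"
      unfolding poly_altdef
    proof (intro sum_mono)
      fix i assume i: "i \<in> {..degree p}"
      have "(k::nat) ^ i \<le> (k + 1) ^ r"
        using i assms by (intro order_trans[OF power_mono[of k "k + 1"] power_increasing]) auto
      then have "of_nat k ^ i \<le> (of_nat ((k + 1) ^ r) :: rat)"
        by (metis of_nat_le_iff of_nat_power)
      then show "coeff p i * of_nat k ^ i \<le> \<bar>coeff p i\<bar> * of_nat ((k + 1) ^ r)"
        by (intro mult_mono) auto
    qed
    also have "\<dots> \<le> of_nat C * of_nat ((k + 1) ^ r)"
      unfolding sum_distrib_right[symmetric] using C by (intro mult_right_mono) auto
    finally show ?thesis by simp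
  qed
  then show ?thesis by blast
qed

section \<open>Order and rank of the index lattice\<close>

abbreviation ix_le :: "nat list \<Rightarrow> nat list \<Rightarrow> bool" where
  "ix_le \<equiv> list_all2 (\<le>)"

lemma ix_le_trans: "ix_le \<alpha> \<beta> \<Longrightarrow> ix_le \<beta> \<gamma> \<Longrightarrow> ix_le \<alpha> \<gamma>"
  by (rule list_all2_trans[of "(\<le>)" "(\<le>)"]) auto

lemma ix_le_refl: "ix_le \<alpha> \<alpha>"
  by (rule list_all2_refl) auto

lemma finite_index_set: "finite (index_set d n)"
  by (rule finite_subset[OF _ finite_lists_length_eq[of "{1..n}" d]]) (auto simp: index_set_def)

lemma index_set_iff:
  "\<alpha> \<in> index_set d n \<longleftrightarrow> length \<alpha> = d \<and> (\<forall>i j. i < j \<longrightarrow> j < d \<longrightarrow> \<alpha> ! i < \<alpha> ! j)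
     \<and> (\<forall>i<d. 1 \<le> \<alpha> ! i \<and> \<alpha> ! i \<le> n)"
  unfolding index_set_def sorted_wrt_iff_nth_less
  by (auto simp: subset_iff in_set_conv_nth Suc_le_eq)

lemma index_set_lower:
  assumes "\<alpha> \<in> index_set d n" "i < d"
  shows "i + 1 \<le> \<alpha> ! i"
  using assms(2)
proof (induction i)
  case 0
  then show ?case using assms(1) by (auto simp: index_set_iff)
next
  case (Suc i)
  then have "\<alpha> ! i < \<alpha> ! Suc i" using assms(1) by (auto simp: index_set_iff)
  then show ?case using Suc by auto
qed

text \<open>The rank function of the lattice, which is the size of the associated partition. On
  \<open>index_set\<close> the subtraction is exact by \<open>index_set_lower\<close>.\<close>

definition ix_rank :: "nat list \<Rightarrow> nat" where
  "ix_rank \<alpha> = (\<Sum>i<length \<alpha>. \<alpha> ! i - (i + 1))"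

lemma ix_rank_mono:
  assumes "\<alpha> \<in> index_set d n" "\<beta> \<in> index_set d n" "ix_le \<alpha> \<beta>" "\<alpha> \<noteq> \<beta>"
  shows "ix_rank \<alpha> < ix_rank \<beta>"
proof -
  have len: "length \<alpha> = d" "length \<beta> = d" using assms by (auto simp: index_set_iff)
  obtain i where i: "i < d" "\<alpha> ! i \<noteq> \<beta> ! i"
    using assms(4) len nth_equalityI by metis
  have le: "\<alpha> ! j \<le> \<beta> ! j" if "j < d" for j
    using assms(3) that len by (auto simp: list_all2_conv_all_nth)
  have "\<alpha> ! i - (i + 1) < \<beta> ! i - (i + 1)"
    using i le[of i] index_set_lower[OF assms(1), of i] by linarith
  then show ?thesis
    unfolding ix_rank_def len using i le by (intro sum_strict_mono_ex1) (auto intro: diff_le_mono)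
qed

text \<open>Listed downwards with \<beta> in front: removing the head leaves a multichain bounded by
  that head, which is the recursion of \<open>card_multichains_Suc\<close>. The bound \<beta> is not
  counted in the length.\<close>

definition multichains :: "nat \<Rightarrow> nat \<Rightarrow> nat \<Rightarrow> nat list \<Rightarrow> nat list list set" where
  "multichains d n k \<beta> = {xs. length xs = k \<and> set xs \<subseteq> index_set d n
      \<and> sorted_wrt (\<lambda>x y. ix_le y x) (\<beta> # xs)}"

lemma finite_multichains: "finite (multichains d n k \<beta>)"
  by (rule finite_subset[OF _ finite_lists_length_eq[OF finite_index_set, of d n k]])
     (auto simp: multichains_def)

lemma card_multichains_Suc:
  "card (multichains d n (Suc k) \<beta>) = (\<Sum>\<gamma> | \<gamma> \<in> index_set d n \<and> ix_le \<gamma> \<beta>. card (multichains d n k \<gamma>))"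
proof -
  have "multichains d n (Suc k) \<beta>
      = (\<Union>\<gamma>\<in>{\<gamma>. \<gamma> \<in> index_set d n \<and> ix_le \<gamma> \<beta>}. (#) \<gamma> ` multichains d n k \<gamma>)"
    by (auto simp: multichains_def length_Suc_conv intro: ix_le_trans)
  also have "card \<dots> = (\<Sum>\<gamma> | \<gamma> \<in> index_set d n \<and> ix_le \<gamma> \<beta>. card ((#) \<gamma> ` multichains d n k \<gamma>))"
    by (intro card_UN_disjoint) (auto simp: finite_multichains finite_index_set)
  finally show ?thesis by (simp add: card_image)
qed

lemma card_multichains_0: "card (multichains d n 0 \<beta>) = 1"
proof -
  have "multichains d n 0 \<beta> = {[]}" by (auto simp: multichains_def)
  then show ?thesis by simp
qed

text \<open>Phrased so that its negation is exactly a zero row or a pair of equal rows of the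
  determinant.\<close>

lemma index_set_pred_iff:
  assumes "\<beta> \<in> index_set d n" "i < d"
  shows "\<beta>[i := \<beta> ! i - 1] \<in> index_set d n \<longleftrightarrow> \<beta> ! i - 1 \<noteq> 0 \<and> (\<forall>j<i. \<beta> ! i - 1 \<noteq> \<beta> ! j)"
proof
  assume A: "\<beta>[i := \<beta> ! i - 1] \<in> index_set d n"
  have len: "length \<beta> = d" using assms(1) by (simp add: index_set_iff)
  have "\<beta> ! i - 1 \<noteq> \<beta> ! j" if "j < i" for j
  proof -
    have "\<beta>[i := \<beta> ! i - 1] ! j < \<beta>[i := \<beta> ! i - 1] ! i"
      using A assms(2) that unfolding index_set_iff by blast
    then show ?thesis using that assms(2) len by simp
  qed
  moreover have "1 \<le> \<beta>[i := \<beta> ! i - 1] ! i"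
    using A assms(2) unfolding index_set_iff by blast
  ultimately show "\<beta> ! i - 1 \<noteq> 0 \<and> (\<forall>j<i. \<beta> ! i - 1 \<noteq> \<beta> ! j)"
    using assms(2) len by simp
next
  assume A: "\<beta> ! i - 1 \<noteq> 0 \<and> (\<forall>j<i. \<beta> ! i - 1 \<noteq> \<beta> ! j)"
  show "\<beta>[i := \<beta> ! i - 1] \<in> index_set d n"
    unfolding index_set_iff
  proof (intro conjI allI impI)
    fix a b assume ab: "a < b" "b < d"
    have lt: "\<beta> ! a < \<beta> ! b" and len: "length \<beta> = d" using assms ab by (auto simp: index_set_iff)
    consider "a = i" | "b = i" | "a \<noteq> i" "b \<noteq> i" by blast
    then show "\<beta>[i := \<beta> ! i - 1] ! a < \<beta>[i := \<beta> ! i - 1] ! b"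
    proof cases
      case 1
      then show ?thesis using lt ab len by simp
    next
      case 2
      then have "\<beta> ! i - 1 \<noteq> \<beta> ! a" using A ab by blast
      then show ?thesis using 2 lt ab len by simp
    next
      case 3
      then show ?thesis using lt by simp
    qed
  next
    fix a assume "a < d"
    then have "1 \<le> \<beta> ! a" "\<beta> ! a \<le> n" using assms by (auto simp: index_set_iff)
    then show "1 \<le> \<beta>[i := \<beta> ! i - 1] ! a" "\<beta>[i := \<beta> ! i - 1] ! a \<le> n"
      using A assms \<open>a < d\<close> by (cases "a = i"; auto simp: index_set_iff)+
  qed (use assms in \<open>auto simp: index_set_iff\<close>)
qed

text \<open>The indices of rank m below \<beta> arise by lowering a single entry of \<beta>. The
  positions where lowering leaves the index set may be added to the sum at no cost, and then
  \<open>chain_det_recurrence\<close> applies.\<close>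

lemma sum_chain_det_covers:
  assumes "\<beta> \<in> index_set d n" "ix_rank \<beta> = Suc m"
  shows "(\<Sum>\<gamma> | \<gamma> \<in> index_set d n \<and> ix_le \<gamma> \<beta> \<and> ix_rank \<gamma> = m. chain_det \<gamma>)
       = of_nat (Suc m) * chain_det \<beta>"
proof -
  have len: "length \<beta> = d" using assms by (auto simp: index_set_iff)
  let ?\<gamma> = "\<lambda>i. \<beta>[i := \<beta> ! i - 1]"
  let ?I = "{i. i < d \<and> ?\<gamma> i \<in> index_set d n}"
  have pos: "1 \<le> \<beta> ! i" if "i < d" for i
    using assms that by (auto simp: index_set_iff)
  have rank: "ix_rank (?\<gamma> i) = m" if "i \<in> ?I" for i
  proof -
    have i: "i < d" "?\<gamma> i \<in> index_set d n" using that by auto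
    have "ix_rank (?\<gamma> i) + 1 = (\<Sum>j<d. (?\<gamma> i ! j - (j + 1)) + (if j = i then 1 else 0))"
      unfolding sum.distrib using i by (simp add: ix_rank_def len)
    also have "\<dots> = ix_rank \<beta>"
      unfolding ix_rank_def len
      using index_set_lower[OF i(2), of i] i len pos[of i]
      by (intro sum.cong refl) auto
    finally show ?thesis using assms by simp
  qed
  have "{\<gamma>. \<gamma> \<in> index_set d n \<and> ix_le \<gamma> \<beta> \<and> ix_rank \<gamma> = m} = ?\<gamma> ` ?I"
  proof (intro equalityI subsetI)
    fix \<gamma> assume "\<gamma> \<in> {\<gamma>. \<gamma> \<in> index_set d n \<and> ix_le \<gamma> \<beta> \<and> ix_rank \<gamma> = m}"
    then have \<gamma>: "\<gamma> \<in> index_set d n" "ix_le \<gamma> \<beta>" "ix_rank \<gamma> = m" by auto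
    have len': "length \<gamma> = d" using \<gamma> by (auto simp: index_set_iff)
    have le: "\<gamma> ! j \<le> \<beta> ! j" if "j < d" for j
      using \<gamma>(2) that len len' by (auto simp: list_all2_conv_all_nth)
    have "\<gamma> \<noteq> \<beta>" using \<gamma> assms by auto
    then obtain i where i: "i < d" "\<gamma> ! i \<noteq> \<beta> ! i"
      using len len' nth_equalityI by metis
    \<comment> \<open>The difference of the ranks is the sum of the coordinate gaps. As it is 1, a
      single coordinate carries the whole gap.\<close>
    have "(\<Sum>j<d. \<beta> ! j - (j + 1)) = (\<Sum>j<d. (\<gamma> ! j - (j + 1)) + (\<beta> ! j - \<gamma> ! j))"
      using le index_set_lower[OF \<gamma>(1)] by (intro sum.cong refl) fastforce
    then have one: "(\<Sum>j<d. \<beta> ! j - \<gamma> ! j) = 1"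
      using \<gamma>(3) assms(2) by (simp add: ix_rank_def len len' sum.distrib)
    have split: "(\<Sum>j<d. \<beta> ! j - \<gamma> ! j) = (\<beta> ! i - \<gamma> ! i) + (\<Sum>j\<in>{..<d} - {i}. \<beta> ! j - \<gamma> ! j)"
      using i by (subst sum.remove[of _ i]) auto
    then have "\<beta> ! i - \<gamma> ! i = 1" and rest: "(\<Sum>j\<in>{..<d} - {i}. \<beta> ! j - \<gamma> ! j) = 0"
      using one i le[of i] by linarith+
    have "\<gamma> = ?\<gamma> i"
    proof (rule nth_equalityI)
      fix j assume j: "j < length \<gamma>"
      show "\<gamma> ! j = ?\<gamma> i ! j"
      proof (cases "j = i")
        case True
        then show ?thesis using \<open>\<beta> ! i - \<gamma> ! i = 1\<close> len i by simp
      next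
        case False
        then have "\<beta> ! j - \<gamma> ! j = 0" using rest j len' by simp
        then show ?thesis using le[of j] j len' False by simp
      qed
    qed (simp add: len len')
    then show "\<gamma> \<in> ?\<gamma> ` ?I" using i \<gamma> by auto
  next
    fix \<gamma> assume "\<gamma> \<in> ?\<gamma> ` ?I"
    then obtain i where "i \<in> ?I" "\<gamma> = ?\<gamma> i" by auto
    moreover have "?\<gamma> i ! j \<le> \<beta> ! j" for j
      by (cases "j = i"; cases "i < length \<beta>") (auto simp: list_update_beyond)
    ultimately show "\<gamma> \<in> {\<gamma>. \<gamma> \<in> index_set d n \<and> ix_le \<gamma> \<beta> \<and> ix_rank \<gamma> = m}"
      using rank by (auto simp: list_all2_conv_all_nth)
  qed
  moreover have "inj_on ?\<gamma> ?I"
  proof (rule inj_onI)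
    fix i j assume *: "i \<in> ?I" "j \<in> ?I" "?\<gamma> i = ?\<gamma> j"
    show "i = j"
    proof (rule ccontr)
      assume "i \<noteq> j"
      have "\<beta> ! i - 1 = ?\<gamma> i ! i" using *(1) len by simp
      also have "\<dots> = ?\<gamma> j ! i" by (simp only: *(3))
      also have "\<dots> = \<beta> ! i" using \<open>i \<noteq> j\<close> by simp
      finally have "\<beta> ! i - 1 = \<beta> ! i" .
      then show False using pos[of i] * by simp
    qed
  qed
  ultimately have "(\<Sum>\<gamma> | \<gamma> \<in> index_set d n \<and> ix_le \<gamma> \<beta> \<and> ix_rank \<gamma> = m. chain_det \<gamma>)
      = (\<Sum>i\<in>?I. chain_det (?\<gamma> i))"
    by (simp add: sum.reindex)
  \<comment> \<open>The positions outside \<open>?I\<close> contribute determinants with a zero row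
    or two equal rows.\<close>
  also have "\<dots> = (\<Sum>i<d. chain_det (?\<gamma> i))"
  proof (intro sum.mono_neutral_left ballI)
    fix i assume "i \<in> {..<d} - ?I"
    then have i: "i < d" "?\<gamma> i \<notin> index_set d n" by auto
    then consider "\<beta> ! i - 1 = 0" | j where "j < i" "\<beta> ! i - 1 = \<beta> ! j"
      using index_set_pred_iff[OF assms(1) i(1)] by auto
    then show "chain_det (?\<gamma> i) = 0"
    proof cases
      case 1
      then show ?thesis
        using i len by (intro chain_det_eq_0_if_zero_entry[of i]) auto
    next
      case 2
      then show ?thesis
        using i len by (intro chain_det_eq_0_if_equal_entries[of i _ j]) auto
    qed
  qed auto
  also have "\<dots> = (\<Sum>i<d. of_nat (\<beta> ! i) - 1 - of_nat i) * chain_det \<beta>"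
    using chain_det_recurrence[of \<beta>] pos len by simp
  also have "(\<Sum>i<d. of_nat (\<beta> ! i) - 1 - of_nat i) = (of_nat (ix_rank \<beta>) :: rat)"
    unfolding ix_rank_def len of_nat_sum
    using index_set_lower[OF assms(1)] by (intro sum.cong refl) (auto simp: of_nat_diff)
  finally show ?thesis using assms by simp
qed

lemma index_set_rank_0:
  assumes "\<beta> \<in> index_set d n" "ix_rank \<beta> = 0"
  shows "\<beta> = map Suc [0..<d]"
proof (rule nth_equalityI)
  show "length \<beta> = length (map Suc [0..<d])" using assms by (auto simp: index_set_iff)
  fix i assume "i < length \<beta>"
  moreover from this have "\<beta> ! i - (i + 1) = 0"
    using assms(2) by (auto simp: ix_rank_def)
  ultimately show "\<beta> ! i = map Suc [0..<d] ! i"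
    using index_set_lower[OF assms(1), of i] assms(1) by (auto simp: index_set_iff)
qed

text \<open>The number of multichains of length \<open>k + 1\<close> exceeds the number of those of length \<open>k\<close> by the
  number of those whose largest member is strictly below \<open>\<beta>\<close>, so the polynomial arises by summation
  and only the elements covered by \<open>\<beta>\<close> contribute to its top coefficient.\<close>

lemma multichain_polynomial:
  assumes "\<beta> \<in> index_set d n"
  shows "\<exists>p. (\<forall>k. poly p (of_nat k) = of_nat (card (multichains d n k \<beta>)))
           \<and> degree p \<le> ix_rank \<beta> \<and> coeff p (ix_rank \<beta>) = chain_det \<beta>"
  using assms
proof (induction "ix_rank \<beta>" arbitrary: \<beta> rule: less_induct)
  case less
  let ?B = "{\<gamma>. \<gamma> \<in> index_set d n \<and> ix_le \<gamma> \<beta> \<and> \<gamma> \<noteq> \<beta>}"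
  have finB: "finite ?B" by (simp add: finite_index_set)
  have below: "ix_rank \<gamma> < ix_rank \<beta>" if "\<gamma> \<in> ?B" for \<gamma>
    using ix_rank_mono[OF _ less.prems] that by auto
  have "\<exists>P. \<forall>\<gamma>\<in>?B. (\<forall>k. poly (P \<gamma>) (of_nat k) = of_nat (card (multichains d n k \<gamma>)))
      \<and> degree (P \<gamma>) \<le> ix_rank \<gamma> \<and> coeff (P \<gamma>) (ix_rank \<gamma>) = chain_det \<gamma>"
    by (rule bchoice) (use less.hyps below in blast)
  then obtain P where P: "\<And>\<gamma> k. \<gamma> \<in> ?B \<Longrightarrow> poly (P \<gamma>) (of_nat k) = of_nat (card (multichains d n k \<gamma>))"
     "\<And>\<gamma>. \<gamma> \<in> ?B \<Longrightarrow> degree (P \<gamma>) \<le> ix_rank \<gamma>" "\<And>\<gamma>. \<gamma> \<in> ?B \<Longrightarrow> coeff (P \<gamma>) (ix_rank \<gamma>) = chain_det \<gamma>"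
    by blast
  define p where "p = (\<Sum>\<gamma>\<in>?B. P \<gamma>)"
  have step: "of_nat (card (multichains d n (Suc k) \<beta>))
      = of_nat (card (multichains d n k \<beta>)) + poly p (of_nat k)" for k
  proof -
    have "{\<gamma>. \<gamma> \<in> index_set d n \<and> ix_le \<gamma> \<beta>} = insert \<beta> ?B"
      using less.prems by (auto intro: ix_le_refl)
    then show ?thesis
      unfolding card_multichains_Suc using finB by (simp add: p_def poly_sum P)
  qed
  \<comment> \<open>An antidifference is fixed only up to a constant. The constant chosen here makes
    the value at 0 equal to 1, the number of empty multichains; in rank 0 it is the whole
    polynomial.\<close>
  have "\<exists>q. (\<forall>x. poly q (x + 1) - poly q x = poly p x) \<and> degree q \<le> ix_rank \<beta>
      \<and> coeff (q + [:1 - poly q 0:]) (ix_rank \<beta>) = chain_det \<beta>"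
  proof (cases "ix_rank \<beta>")
    case 0
    then have "p = 0" unfolding p_def using below by (auto intro!: sum.neutral)
    moreover have "chain_det \<beta> = 1"
      using index_set_rank_0[OF less.prems 0] chain_det_bottom by simp
    ultimately show ?thesis by (intro exI[of _ 0]) (auto simp: 0)
  next
    case (Suc m)
    have "degree p \<le> m"
      unfolding p_def using finB P(2) below Suc by (intro degree_sum_le) fastforce+
    then obtain q where q: "\<And>x. poly q (x + 1) - poly q x = poly p x" "degree q \<le> Suc m"
      "coeff q (Suc m) = coeff p m / of_nat (Suc m)"
      using antidifference_exists by blast
    have "coeff p m = (\<Sum>\<gamma>\<in>?B. if ix_rank \<gamma> = m then chain_det \<gamma> else 0)"
      unfolding p_def coeff_sum
    proof (intro sum.cong refl)
      fix \<gamma> assume \<gamma>: "\<gamma> \<in> ?B"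
      show "coeff (P \<gamma>) m = (if ix_rank \<gamma> = m then chain_det \<gamma> else 0)"
        using P(2,3)[OF \<gamma>] below[OF \<gamma>] Suc by (auto intro: coeff_eq_0)
    qed
    also have "\<dots> = (\<Sum>\<gamma> | \<gamma> \<in> index_set d n \<and> ix_le \<gamma> \<beta> \<and> ix_rank \<gamma> = m. chain_det \<gamma>)"
      using finB Suc by (subst sum.inter_filter[symmetric]) (auto intro!: sum.cong)
    also have "\<dots> = of_nat (Suc m) * chain_det \<beta>"
      by (rule sum_chain_det_covers[OF less.prems Suc])
    finally have "coeff q (Suc m) = chain_det \<beta>"
      using q(3) by (simp del: of_nat_Suc)
    then show ?thesis using q Suc by (intro exI[of _ q]) auto
  qed
  then obtain q where q: "\<And>x. poly q (x + 1) - poly q x = poly p x" "degree q \<le> ix_rank \<beta>"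
    "coeff (q + [:1 - poly q 0:]) (ix_rank \<beta>) = chain_det \<beta>" by blast
  have "poly (q + [:1 - poly q 0:]) (of_nat k) = of_nat (card (multichains d n k \<beta>))" for k
  proof (induction k)
    case 0
    then show ?case by (simp add: card_multichains_0)
  next
    case (Suc k)
    have "poly q (of_nat (Suc k)) = poly q (of_nat k) + poly p (of_nat k)"
      using q(1)[of "of_nat k"] by (simp add: algebra_simps)
    then show ?case using Suc step[of k] by simp
  qed
  moreover have "degree (q + [:1 - poly q 0:]) \<le> ix_rank \<beta>"
    using q(2) by (intro degree_add_le) auto
  ultimately show ?case using q(3) by blast
qed

section \<open>Monoid algebras\<close>

alias lookup = Poly_Mapping.lookup
alias keys = Poly_Mapping.keys
alias single = Poly_Mapping.single

text \<open>Linear extension from monomials. The step does not ask that \<open>m\<close> be a new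
  exponent, so additive properties can be proved without a case distinction on overlapping
  terms.\<close>

lemma keys_induct [consumes 1, case_names zero add]:
  fixes p :: "'a \<Rightarrow>\<^sub>0 'b::ab_group_add"
  assumes "keys p \<subseteq> S" "P 0"
    and "\<And>m c p. m \<in> S \<Longrightarrow> keys p \<subseteq> S \<Longrightarrow> P p \<Longrightarrow> P (single m c + p)"
  shows "P p"
  using assms(1)
proof (induction "card (keys p)" arbitrary: p)
  case 0
  then have "keys p = {}" by simp
  then have "p = 0" by simp
  then show ?case using assms(2) by simp
next
  case (Suc n)
  then obtain m where m: "m \<in> keys p" by fastforce
  define q where "q = p - single m (lookup p m)"
  have q: "keys q = keys p - {m}"
    by (auto simp: q_def in_keys_iff lookup_minus lookup_single when_def split: if_splits)
  then have "P q" using Suc m by (intro Suc.hyps) auto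
  moreover have "p = single m (lookup p m) + q" by (simp add: q_def)
  ultimately show ?case using assms(3)[of m q "lookup p m"] m q Suc.prems by auto
qed

lemma keys_diff: "keys (p - q) \<subseteq> keys p \<union> keys (q :: 'a \<Rightarrow>\<^sub>0 'b::ab_group_add)"
  by (auto simp: in_keys_iff lookup_minus)

section \<open>Restriction to faces and change of exponents\<close>

definition restr :: "'a set \<Rightarrow> ('a \<Rightarrow>\<^sub>0 'b) \<Rightarrow> 'a \<Rightarrow>\<^sub>0 'b::zero" where
  "restr F p = Poly_Mapping.mapp (\<lambda>k v. v when k \<in> F) p"

lemma lookup_restr: "lookup (restr F p) k = (lookup p k when k \<in> F)"
  by (auto simp: restr_def lookup_mapp when_def in_keys_iff)

lemma keys_restr: "keys (restr F p) = keys p \<inter> F"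
  by (auto simp: in_keys_iff lookup_restr when_def split: if_splits)

lemma restr_0 [simp]: "restr F 0 = 0"
  by (rule poly_mapping_eqI) (simp add: lookup_restr)

lemma restr_add: "restr F (p + q) = restr F p + restr F q"
  by (rule poly_mapping_eqI) (simp add: lookup_restr lookup_add when_def)

lemma restr_single: "restr F (single m c) = (single m c when m \<in> F)"
  by (rule poly_mapping_eqI) (auto simp: lookup_restr lookup_single when_def)

lemma restr_eq_self: "keys p \<subseteq> F \<Longrightarrow> restr F p = p"
  by (rule poly_mapping_eqI) (auto simp: lookup_restr when_def in_keys_iff)

text \<open>The last hypothesis says that \<open>F\<close> is a face of \<open>S\<close>: the terms
  of \<open>S\<close> off \<open>F\<close> then span an ideal complementary to the terms in
  \<open>F\<close>, so the projection is multiplicative. With \<open>F = {0}\<close> it gives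
  constant terms, with larger faces the primes of a chain.\<close>

lemma restr_mult_face:
  fixes p q :: "'a::comm_monoid_add \<Rightarrow>\<^sub>0 'b::comm_ring_1"
  assumes "keys p \<subseteq> S" "keys q \<subseteq> S"
    and "\<And>a b. a \<in> S \<Longrightarrow> b \<in> S \<Longrightarrow> a + b \<in> F \<longleftrightarrow> a \<in> F \<and> b \<in> F"
  shows "restr F (p * q) = restr F p * restr F q"
  using assms(1)
proof (induction rule: keys_induct)
  case zero
  then show ?case by simp
next
  case (add m c p)
  have "restr F (single m c * q) = restr F (single m c) * restr F q"
    using assms(2)
  proof (induction rule: keys_induct)
    case zero
    then show ?case by simp
  next
    case (add m' c' q)
    then show ?case
      using assms(3)[OF \<open>m \<in> S\<close>, of m']
      by (auto simp: distrib_left restr_add mult_single restr_single when_def)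
  qed
  then show ?case using add by (simp add: distrib_right restr_add)
qed

definition push :: "('a \<Rightarrow> 'c) \<Rightarrow> ('a \<Rightarrow>\<^sub>0 'b) \<Rightarrow> 'c \<Rightarrow>\<^sub>0 'b::comm_monoid_add" where
  "push f p = (\<Sum>m\<in>keys p. single (f m) (lookup p m))"

lemma push_0 [simp]: "push f 0 = 0"
  by (simp add: push_def)

lemma push_single [simp]: "push f (single m c) = single (f m) c"
  by (cases "c = 0") (simp_all add: push_def)

lemma push_add: "push f (p + q) = push f p + push f q"
  unfolding push_def by (rule setsum_keys_plus_distrib) (auto simp: single_add)

lemma push_mult:
  fixes p q :: "'a::comm_monoid_add \<Rightarrow>\<^sub>0 'b::comm_ring_1"
  assumes "keys p \<subseteq> S" "keys q \<subseteq> S"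
    and "\<And>a b. a \<in> S \<Longrightarrow> b \<in> S \<Longrightarrow> f (a + b) = f a + f b"
  shows "push f (p * q) = push f p * push f q"
  using assms(1)
proof (induction rule: keys_induct)
  case zero
  then show ?case by simp
next
  case (add m c p)
  have "push f (single m c * q) = single (f m) c * push f q"
    using assms(2)
  proof (induction rule: keys_induct)
    case zero
    then show ?case by simp
  next
    case (add m' c' q)
    then show ?case
      using assms(3)[OF \<open>m \<in> S\<close>, of m']
      by (simp add: distrib_left push_add mult_single)
  qed
  then show ?case using add by (simp add: distrib_right push_add)
qed

lemma keys_push: "keys (push f p) \<subseteq> f ` keys p"
  unfolding push_def using keys_sum[of "\<lambda>m. single (f m) (lookup p m)" "keys p"]
  by (auto split: if_splits)

lemma lookup_push: "lookup (push f p) e = (\<Sum>m | m \<in> keys p \<and> f m = e. lookup p m)"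
proof -
  have "lookup (push f p) e = (\<Sum>m\<in>keys p. if f m = e then lookup p m else 0)"
    unfolding push_def lookup_sum by (intro sum.cong) (auto simp: lookup_single when_def)
  also have "\<dots> = (\<Sum>m\<in>{m \<in> keys p. f m = e}. lookup p m)"
    by (subst sum.inter_filter) auto
  finally show ?thesis .
qed

text \<open>The algebra K[S] inside the ambient ring of all finitely supported functions. It is a
  record because prime ideals, Krull dimension and isomorphisms are formulated for records.\<close>

definition monoid_ring :: "'m set \<Rightarrow> ('m::comm_monoid_add \<Rightarrow>\<^sub>0 'k::comm_ring_1) ring" where
  "monoid_ring S = \<lparr>carrier = {p. keys p \<subseteq> S}, mult = (*), one = 1, zero = 0, add = (+)\<rparr>"

lemma monoid_ring_simps [simp]:
  "carrier (monoid_ring S) = {p. keys p \<subseteq> S}"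
  "p \<otimes>\<^bsub>monoid_ring S\<^esub> q = p * q" "\<one>\<^bsub>monoid_ring S\<^esub> = 1"
  "\<zero>\<^bsub>monoid_ring S\<^esub> = 0" "p \<oplus>\<^bsub>monoid_ring S\<^esub> q = p + q"
  by (simp_all add: monoid_ring_def)

lemma keys_mult_subset:
  assumes "keys p \<subseteq> A" "keys q \<subseteq> B" "\<And>a b. a \<in> A \<Longrightarrow> b \<in> B \<Longrightarrow> a + b \<in> C"
  shows "keys (p * q) \<subseteq> C"
  using keys_mult[of p q] assms by blast

lemma cring_monoid_ring:
  assumes "0 \<in> S" "\<And>a b. a \<in> S \<Longrightarrow> b \<in> S \<Longrightarrow> a + b \<in> S"
  shows "cring (monoid_ring S :: ('m::comm_monoid_add \<Rightarrow>\<^sub>0 'k::comm_ring_1) ring)"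
proof (intro cringI abelian_groupI comm_monoidI)
  fix p q :: "'m \<Rightarrow>\<^sub>0 'k" assume p: "p \<in> carrier (monoid_ring S)"
  show "\<exists>q\<in>carrier (monoid_ring S). q \<oplus>\<^bsub>monoid_ring S\<^esub> p = \<zero>\<^bsub>monoid_ring S\<^esub>"
    using p by (intro bexI[of _ "- p"]) auto
  assume q: "q \<in> carrier (monoid_ring S)"
  show "p \<oplus>\<^bsub>monoid_ring S\<^esub> q \<in> carrier (monoid_ring S)"
    using p q keys_add[of p q] by auto
  show "p \<otimes>\<^bsub>monoid_ring S\<^esub> q \<in> carrier (monoid_ring S)"
    using p q keys_mult_subset[of p S q S S] assms(2) by simp
qed (use assms in \<open>simp_all add: algebra_simps\<close>)

text \<open>An injection into a commutative ring reflects every equational axiom; only negatives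
  need an existence hypothesis. This spares a direct verification for the local ring, whose
  operations are unions of fraction classes.\<close>

lemma cring_of_embedding:
  fixes h :: "'b \<Rightarrow> 'f::comm_ring_1"
  assumes "inj_on h (carrier B)"
    and "\<And>a b. a \<in> carrier B \<Longrightarrow> b \<in> carrier B \<Longrightarrow> a \<oplus>\<^bsub>B\<^esub> b \<in> carrier B \<and> h (a \<oplus>\<^bsub>B\<^esub> b) = h a + h b"
    and "\<And>a b. a \<in> carrier B \<Longrightarrow> b \<in> carrier B \<Longrightarrow> a \<otimes>\<^bsub>B\<^esub> b \<in> carrier B \<and> h (a \<otimes>\<^bsub>B\<^esub> b) = h a * h b"
    and "\<zero>\<^bsub>B\<^esub> \<in> carrier B" "h \<zero>\<^bsub>B\<^esub> = 0" "\<one>\<^bsub>B\<^esub> \<in> carrier B" "h \<one>\<^bsub>B\<^esub> = 1"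
    and "\<And>a. a \<in> carrier B \<Longrightarrow> \<exists>b\<in>carrier B. h b = - h a"
  shows "cring B"
proof -
  note add = assms(2)[THEN conjunct1] assms(2)[THEN conjunct2]
  note mult = assms(3)[THEN conjunct1] assms(3)[THEN conjunct2]
  note closed = add(1) mult(1) assms(4,6)
  note hom = closed add(2) mult(2) assms(5,7)
  show ?thesis
  proof (intro cringI abelian_groupI comm_monoidI)
    fix a assume a: "a \<in> carrier B"
    then obtain b where "b \<in> carrier B" "h b = - h a" using assms(8) by blast
    with a show "\<exists>b\<in>carrier B. b \<oplus>\<^bsub>B\<^esub> a = \<zero>\<^bsub>B\<^esub>"
      by (intro bexI[of _ b] inj_onD[OF assms(1)]) (simp_all add: hom)
  qed (rule closed inj_onD[OF assms(1)]; simp add: hom algebra_simps)+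
qed

section \<open>Graded monoids\<close>

text \<open>The order on \<open>'m\<close> is unrelated to the grading: it makes
  \<open>'m \<Rightarrow>\<^sub>0 'k\<close> an integral domain, so that the type
  \<open>fract\<close> applies. The last condition is generation in degree one.\<close>

locale graded_monoid =
  fixes S :: "'m::{ordered_cancel_comm_monoid_add, linorder} set" and deg :: "'m \<Rightarrow> nat"
  assumes zero_mem: "0 \<in> S"
    and add_mem: "a \<in> S \<Longrightarrow> b \<in> S \<Longrightarrow> a + b \<in> S"
    and deg_add: "a \<in> S \<Longrightarrow> b \<in> S \<Longrightarrow> deg (a + b) = deg a + deg b"
    and deg_eq_0: "a \<in> S \<Longrightarrow> deg a = 0 \<Longrightarrow> a = 0"
    and finite_deg: "finite {a \<in> S. deg a = k}"
    and deg_Suc_split: "a \<in> S \<Longrightarrow> deg a = Suc k \<Longrightarrow> \<exists>b\<in>S. \<exists>c\<in>S. a = b + c \<and> deg b = k \<and> deg c = 1"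
begin

definition deg_ge :: "nat \<Rightarrow> 'm set" where "deg_ge k = {a \<in> S. k \<le> deg a}"
definition deg_at :: "nat \<Rightarrow> 'm set" where "deg_at k = {a \<in> S. deg a = k}"

lemma deg_0 [simp]: "deg 0 = 0"
  using deg_add[OF zero_mem zero_mem] by simp

lemma deg_ge_0: "deg_ge 0 = S"
  by (auto simp: deg_ge_def)

lemma deg_at_0: "deg_at 0 = {0}"
  using zero_mem deg_eq_0 by (auto simp: deg_at_def)

lemma deg_ge_subset: "deg_ge k \<subseteq> S"
  by (auto simp: deg_ge_def)

lemma deg_ge_antimono: "i \<le> j \<Longrightarrow> deg_ge j \<subseteq> deg_ge i"
  by (auto simp: deg_ge_def)

lemma add_eq_0_iff: "a \<in> S \<Longrightarrow> b \<in> S \<Longrightarrow> a + b = 0 \<longleftrightarrow> a = 0 \<and> b = 0"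
  using deg_add[of a b] deg_eq_0 by auto

lemma keys_mult_S: "keys p \<subseteq> S \<Longrightarrow> keys q \<subseteq> S \<Longrightarrow> keys (p * q) \<subseteq> S"
  by (rule keys_mult_subset) (auto intro: add_mem)

lemma keys_mult_deg_ge:
  "keys p \<subseteq> deg_ge i \<Longrightarrow> keys q \<subseteq> deg_ge j \<Longrightarrow> keys (p * q) \<subseteq> deg_ge (i + j)"
  by (rule keys_mult_subset) (auto simp: deg_ge_def add_mem deg_add)

lemma cring_monoid_ring_S: "cring (monoid_ring S :: ('m \<Rightarrow>\<^sub>0 'k::comm_ring_1) ring)"
  by (rule cring_monoid_ring) (auto intro: zero_mem add_mem)

text \<open>By \<open>add_eq_0_iff\<close> the set \<open>{0}\<close> is a face, so taking the
  constant term is a ring homomorphism. It plays the part of evaluation at the vertex, and its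
  nonzero values single out the denominators.\<close>

lemma lookup_mult_0:
  fixes p q :: "'m \<Rightarrow>\<^sub>0 'k::comm_ring_1"
  assumes "keys p \<subseteq> S" "keys q \<subseteq> S"
  shows "lookup (p * q) 0 = lookup p 0 * lookup q 0"
proof -
  have *: "restr {0} r = single 0 (lookup r 0)" for r :: "'m \<Rightarrow>\<^sub>0 'k"
    by (rule poly_mapping_eqI) (auto simp: lookup_restr lookup_single when_def)
  have "restr {0} (p * q) = restr {0} p * restr {0} q"
    by (rule restr_mult_face[OF assms]) (simp add: add_eq_0_iff)
  then have "lookup (restr {0} (p * q)) 0 = lookup (single 0 (lookup p 0 * lookup q 0) :: 'm \<Rightarrow>\<^sub>0 'k) 0"
    by (simp add: * mult_single)
  then show ?thesis by (simp add: lookup_restr)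
qed

section \<open>Homogeneous components\<close>

definition hc :: "nat \<Rightarrow> ('m \<Rightarrow>\<^sub>0 'k) \<Rightarrow> 'm \<Rightarrow>\<^sub>0 'k::comm_ring_1" where
  "hc k p = restr {a. deg a = k} p"

lemma lookup_hc: "lookup (hc k p) a = (lookup p a when deg a = k)"
  by (simp add: hc_def lookup_restr)

lemma keys_hc: "keys p \<subseteq> S \<Longrightarrow> keys (hc k p) \<subseteq> deg_at k"
  by (auto simp: hc_def keys_restr deg_at_def)

lemma hc_0 [simp]: "hc k 0 = 0"
  by (simp add: hc_def)

lemma hc_add: "hc k (p + q) = hc k p + hc k q"
  by (simp add: hc_def restr_add)

lemma hc_diff: "hc k (p - q) = hc k p - hc k q"
  by (rule poly_mapping_eqI) (simp add: lookup_hc lookup_minus when_def)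

lemma hc_1: "hc k 1 = (if k = 0 then 1 else 0 :: 'm \<Rightarrow>\<^sub>0 'k::comm_ring_1)"
  by (rule poly_mapping_eqI) (auto simp: lookup_hc lookup_one when_def)

lemma hc_homogeneous: "keys p \<subseteq> deg_at j \<Longrightarrow> hc k p = (if k = j then p else 0)"
  by (rule poly_mapping_eqI) (auto simp: lookup_hc when_def deg_at_def in_keys_iff)

lemma hc_mult:
  fixes p q :: "'m \<Rightarrow>\<^sub>0 'k::comm_ring_1"
  assumes "keys p \<subseteq> S" "keys q \<subseteq> S"
  shows "hc k (p * q) = (\<Sum>i\<le>k. hc i p * hc (k - i) q)"
  using assms(1)
proof (induction rule: keys_induct)
  case zero
  then show ?case by simp
next
  case (add m c p)
  have "hc k (single m c * q) = (\<Sum>i\<le>k. hc i (single m c) * hc (k - i) q)"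
    using assms(2)
  proof (induction rule: keys_induct)
    case zero
    then show ?case by simp
  next
    case (add m' c' q)
    have "(\<Sum>i\<le>k. hc i (single m c) * hc (k - i) (single m' c'))
        = (\<Sum>i\<le>k. if i = deg m then (single (m + m') (c * c') when deg m' = k - i) else 0)"
      by (intro sum.cong refl) (auto simp: hc_def restr_single when_def mult_single)
    also have "\<dots> = hc k (single m c * single m' c')"
      using deg_add[OF \<open>m \<in> S\<close> \<open>m' \<in> S\<close>]
      by (auto simp: hc_def restr_single when_def mult_single)
    finally show ?case
      using add by (simp add: distrib_left hc_add sum.distrib)
  qed
  then show ?case using add by (simp add: distrib_right hc_add sum.distrib)
qed

text \<open>The lowest homogeneous component of \<open>s * q\<close> is that of \<open>q\<close>, up to the unit \<open>lookup s 0\<close>.\<close>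

lemma deg_ge_cancel:
  fixes s q :: "'m \<Rightarrow>\<^sub>0 'k::idom"
  assumes "keys s \<subseteq> S" "keys q \<subseteq> S" "lookup s 0 \<noteq> 0" "keys (s * q) \<subseteq> deg_ge k"
  shows "keys q \<subseteq> deg_ge k"
proof (rule ccontr)
  assume "\<not> keys q \<subseteq> deg_ge k"
  then obtain a0 where a0: "a0 \<in> keys q" "deg a0 < k"
    using assms(2) by (force simp: deg_ge_def)
  obtain a where a: "a \<in> keys q" and min: "\<And>b. b \<in> keys q \<Longrightarrow> deg a \<le> deg b"
    using ex_has_least_nat[of "\<lambda>a. a \<in> keys q" a0 deg] a0 by blast
  define e where "e = deg a"
  have "e < k" using min[OF a0(1)] a0 by (simp add: e_def)
  have "hc e (s * q) = hc 0 s * hc e q + (\<Sum>i\<in>{1..e}. hc i s * hc (e - i) q)"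
    by (subst hc_mult[OF assms(1,2)], subst sum.remove[of _ 0]) (auto intro!: sum.cong)
  also have "(\<Sum>i\<in>{1..e}. hc i s * hc (e - i) q) = 0"
  proof (intro sum.neutral ballI)
    fix i assume i: "i \<in> {1..e}"
    have "hc (e - i) q = 0"
    proof (rule poly_mapping_eqI)
      fix b
      have "lookup q b = 0" if "deg b = e - i"
        using min[of b] i that by (cases "lookup q b = 0") (auto simp: e_def in_keys_iff)
      then show "lookup (hc (e - i) q) b = lookup 0 b"
        by (simp add: lookup_hc when_def)
    qed
    then show "hc i s * hc (e - i) q = 0" by simp
  qed
  finally have eq: "hc e (s * q) = hc 0 s * hc e q" by simp
  have "hc e (s * q) = 0"
    using assms(4) \<open>e < k\<close>
    by (intro poly_mapping_eqI) (force simp: lookup_hc when_def deg_ge_def in_keys_iff)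
  moreover have "lookup (hc 0 s) 0 \<noteq> 0" using assms(3) by (simp add: lookup_hc)
  then have "hc 0 s \<noteq> 0" by auto
  moreover have "lookup (hc e q) a \<noteq> 0" using a by (simp add: lookup_hc e_def in_keys_iff)
  then have "hc e q \<noteq> 0" by auto
  ultimately show False using eq by simp
qed

text \<open>A filtration inside the fraction field of the ambient domain: \<open>loc 0\<close> is
  K[S] localized at the vertex, and \<open>loc k\<close> turns out to be the k-th power of its
  maximal ideal.\<close>

definition loc :: "nat \<Rightarrow> ('m \<Rightarrow>\<^sub>0 'k::field) fract set" where
  "loc k = {Fract p s | p s. keys p \<subseteq> deg_ge k \<and> keys s \<subseteq> S \<and> lookup s 0 \<noteq> 0}"

lemma locI: "keys p \<subseteq> deg_ge k \<Longrightarrow> keys s \<subseteq> S \<Longrightarrow> lookup s 0 \<noteq> 0 \<Longrightarrow> Fract p s \<in> loc k"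
  by (auto simp: loc_def)

lemma locE:
  assumes "x \<in> loc k"
  obtains p s where "x = Fract p s" "keys p \<subseteq> deg_ge k" "keys s \<subseteq> S" "lookup s 0 \<noteq> 0" "s \<noteq> 0"
proof -
  from assms obtain p s where "x = Fract p s" "keys p \<subseteq> deg_ge k" "keys s \<subseteq> S" "lookup s 0 \<noteq> 0"
    unfolding loc_def by blast
  moreover from this have "s \<noteq> 0" by auto
  ultimately show thesis by (rule that)
qed

lemma loc_antimono: "i \<le> j \<Longrightarrow> loc j \<subseteq> loc i"
  unfolding loc_def using deg_ge_antimono by blast

lemma loc_add:
  assumes "x \<in> loc k" "y \<in> loc k"
  shows "x + y \<in> loc k"
proof -
  obtain p s where x: "x = Fract p s" "keys p \<subseteq> deg_ge k" "keys s \<subseteq> S" "lookup s 0 \<noteq> 0" "s \<noteq> 0"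
    using assms(1) by (rule locE)
  obtain q t where y: "y = Fract q t" "keys q \<subseteq> deg_ge k" "keys t \<subseteq> S" "lookup t 0 \<noteq> 0" "t \<noteq> 0"
    using assms(2) by (rule locE)
  have "keys (p * t) \<subseteq> deg_ge (k + 0)" "keys (q * s) \<subseteq> deg_ge (k + 0)"
    using x y by (intro keys_mult_deg_ge; simp add: deg_ge_0)+
  then have "keys (p * t + q * s) \<subseteq> deg_ge k"
    using keys_add[of "p * t" "q * s"] by auto
  then have "Fract (p * t + q * s) (s * t) \<in> loc k"
    using x y keys_mult_S by (intro locI) (simp_all add: lookup_mult_0)
  then show ?thesis using x y by simp
qed

lemma loc_mult:
  assumes "x \<in> loc i" "y \<in> loc j"
  shows "x * y \<in> loc (i + j)"
proof -
  obtain p s where x: "x = Fract p s" "keys p \<subseteq> deg_ge i" "keys s \<subseteq> S" "lookup s 0 \<noteq> 0" "s \<noteq> 0"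
    using assms(1) by (rule locE)
  obtain q t where y: "y = Fract q t" "keys q \<subseteq> deg_ge j" "keys t \<subseteq> S" "lookup t 0 \<noteq> 0" "t \<noteq> 0"
    using assms(2) by (rule locE)
  have "Fract (p * q) (s * t) \<in> loc (i + j)"
    using x y keys_mult_S keys_mult_deg_ge by (intro locI) (simp_all add: lookup_mult_0)
  then show ?thesis using x y by simp
qed

lemma loc_uminus: "x \<in> loc k \<Longrightarrow> - x \<in> loc k"
  by (elim locE) (simp add: locI)

lemma loc_diff: "x \<in> loc k \<Longrightarrow> y \<in> loc k \<Longrightarrow> x - y \<in> loc k"
  using loc_add[of x k "- y"] loc_uminus[of y k] by simp

text \<open>A denominator with nonzero constant term cannot raise the order
  (\<open>deg_ge_cancel\<close>). Hence the filtration of the local ring induces on K[S] the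
  filtration by order, which later makes \<open>gr_map\<close> injective.\<close>

lemma Fract_1_mem_loc_iff:
  fixes p :: "'m \<Rightarrow>\<^sub>0 'k::field"
  assumes "keys p \<subseteq> S"
  shows "Fract p 1 \<in> loc k \<longleftrightarrow> keys p \<subseteq> deg_ge k"
proof
  assume "Fract p 1 \<in> loc k"
  then obtain q s where q: "Fract p 1 = Fract q s" "keys q \<subseteq> deg_ge k" "keys s \<subseteq> S" "lookup s 0 \<noteq> 0" "s \<noteq> 0"
    by (rule locE)
  then have "s * p = q" by (simp add: eq_fract mult.commute)
  then show "keys p \<subseteq> deg_ge k" using q assms deg_ge_cancel by blast
next
  assume "keys p \<subseteq> deg_ge k"
  then show "Fract p 1 \<in> loc k" using zero_mem by (intro locI) auto
qed

lemma zero_mem_loc: "0 \<in> loc k"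
  using Fract_1_mem_loc_iff[of 0 k] by (simp add: fract_collapse)

lemma one_not_mem_loc: "1 \<notin> loc 1"
  using Fract_1_mem_loc_iff[of 1 1] zero_mem by (simp add: fract_collapse deg_ge_def)

text \<open>A fraction outside \<open>loc 1\<close> has a numerator with nonzero constant term, so
  it may be turned upside down.\<close>

lemma loc_inverse:
  assumes "x \<in> loc 0" "x \<notin> loc 1"
  shows "\<exists>y\<in>loc 0. x * y = 1"
proof -
  obtain p s where x: "x = Fract p s" "keys p \<subseteq> deg_ge 0" "keys s \<subseteq> S" "lookup s 0 \<noteq> 0" "s \<noteq> 0"
    using assms(1) by (rule locE)
  have "lookup p 0 \<noteq> 0"
  proof
    assume "lookup p 0 = 0"
    have "keys p \<subseteq> deg_ge 1"
    proof
      fix a assume "a \<in> keys p"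
      then have "a \<in> S" "a \<noteq> 0" using x \<open>lookup p 0 = 0\<close> by (auto simp: deg_ge_0 in_keys_iff)
      then show "a \<in> deg_ge 1" using deg_eq_0[of a] by (force simp: deg_ge_def)
    qed
    then show False using x assms(2) locI by blast
  qed
  then have "Fract s p \<in> loc 0" "p \<noteq> 0" using x by (auto intro!: locI simp: deg_ge_0)
  then show ?thesis using x by (intro bexI[of _ "Fract s p"]) (auto simp: One_fract_def eq_fract mult.commute)
qed

text \<open>For x = p/s the form is the degree k component of p divided by the constant term of s.
  With this choice p - s * r has no component of degree at most k.\<close>

lemma loc_leading_form:
  assumes "x \<in> loc k"
  shows "\<exists>r. keys r \<subseteq> deg_at k \<and> x - Fract r 1 \<in> loc (Suc k)"
proof -
  obtain p s where x: "x = Fract p s" "keys p \<subseteq> deg_ge k" "keys s \<subseteq> S" "lookup s 0 \<noteq> 0" "s \<noteq> 0"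
    using assms by (rule locE)
  define r where "r = single 0 (inverse (lookup s 0)) * hc k p"
  have pS: "keys p \<subseteq> S" using x deg_ge_subset by blast
  have r: "keys r \<subseteq> deg_at k"
    unfolding r_def by (rule keys_mult_subset[of _ "{0}" _ "deg_at k"]) (use keys_hc[OF pS] in auto)
  then have rS: "keys r \<subseteq> S" by (auto simp: deg_at_def)
  have "hc j (p - s * r) = 0" if "j \<le> k" for j
  proof (cases "j = k")
    case True
    have "hc k (s * r) = (\<Sum>i\<le>k. if i = 0 then hc 0 s * r else 0)"
      unfolding hc_mult[OF x(3) rS] by (intro sum.cong refl) (auto simp: hc_homogeneous[OF r])
    also have "\<dots> = hc 0 s * r" by simp
    also have "hc 0 s = single 0 (lookup s 0)"
      using x(3) deg_eq_0 by (intro poly_mapping_eqI) (force simp: lookup_hc lookup_single when_def in_keys_iff)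
    finally have "hc k (s * r) = hc k p"
      using x(4) by (simp add: r_def mult_single flip: mult.assoc)
    then show ?thesis using True by (simp add: hc_diff)
  next
    case False
    have "hc j (s * r) = 0"
      unfolding hc_mult[OF x(3) rS] using False that
      by (intro sum.neutral ballI) (auto simp: hc_homogeneous[OF r])
    moreover have "hc j p = 0"
      using x(2) that False
      by (intro poly_mapping_eqI) (force simp: lookup_hc when_def deg_ge_def in_keys_iff)
    ultimately show ?thesis by (simp add: hc_diff)
  qed
  moreover have kS: "keys (p - s * r) \<subseteq> S"
    using keys_diff[of p "s * r"] pS keys_mult_S[OF x(3) rS] by blast
  ultimately have "keys (p - s * r) \<subseteq> deg_ge (Suc k)"
  proof (intro subsetI)
    fix a assume a: "a \<in> keys (p - s * r)"
    have "\<not> deg a \<le> k"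
    proof
      assume "deg a \<le> k"
      have "lookup (hc (deg a) (p - s * r)) a = lookup (p - s * r) a" by (simp add: lookup_hc)
      moreover have "hc (deg a) (p - s * r) = 0"
        by (rule \<open>\<And>j. j \<le> k \<Longrightarrow> hc j (p - s * r) = 0\<close>) fact
      ultimately show False using a by (simp add: in_keys_iff)
    qed
    then show "a \<in> deg_ge (Suc k)" using a kS by (auto simp: deg_ge_def)
  qed
  then have "Fract (p - s * r) s \<in> loc (Suc k)" using x by (intro locI)
  moreover have "x - Fract r 1 = Fract (p - s * r) s"
    using x by (simp add: mult.commute)
  ultimately show ?thesis using r by auto
qed

end

section \<open>The local ring at the vertex\<close>

text \<open>All properties of the local ring are read off through \<open>h\<close>, so the rest of
  the argument is independent of how the localization is encoded.\<close>

locale local_model = graded_monoid S deg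
  for S :: "'m::{ordered_cancel_comm_monoid_add, linorder} set" and deg :: "'m \<Rightarrow> nat" +
  fixes B :: "('b, 'x) ring_scheme" and h :: "'b \<Rightarrow> ('m \<Rightarrow>\<^sub>0 'k::field) fract"
  assumes inj_h: "inj_on h (carrier B)"
    and image_h: "h ` carrier B = loc 0"
    and h_add: "a \<in> carrier B \<Longrightarrow> b \<in> carrier B \<Longrightarrow> a \<oplus>\<^bsub>B\<^esub> b \<in> carrier B \<and> h (a \<oplus>\<^bsub>B\<^esub> b) = h a + h b"
    and h_mult: "a \<in> carrier B \<Longrightarrow> b \<in> carrier B \<Longrightarrow> a \<otimes>\<^bsub>B\<^esub> b \<in> carrier B \<and> h (a \<otimes>\<^bsub>B\<^esub> b) = h a * h b"
    and h_zero: "\<zero>\<^bsub>B\<^esub> \<in> carrier B" "h \<zero>\<^bsub>B\<^esub> = 0"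
    and h_one: "\<one>\<^bsub>B\<^esub> \<in> carrier B" "h \<one>\<^bsub>B\<^esub> = 1"
begin

lemma h_mem: "b \<in> carrier B \<Longrightarrow> h b \<in> loc 0"
  using image_h by blast

lemma h_surj: "x \<in> loc 0 \<Longrightarrow> \<exists>b\<in>carrier B. h b = x"
  using image_h by (metis imageE)

lemma cring_B: "cring B"
proof (rule cring_of_embedding[of h])
  fix a assume "a \<in> carrier B"
  then show "\<exists>b\<in>carrier B. h b = - h a" using h_surj loc_uminus h_mem by blast
qed (use inj_h h_add h_mult h_zero h_one in auto)

sublocale B: cring B by (rule cring_B)

lemmas h_simps [simp] = h_add[THEN conjunct2] h_mult[THEN conjunct2] h_zero(2) h_one(2)

lemma h_minus [simp]: "a \<in> carrier B \<Longrightarrow> h (\<ominus>\<^bsub>B\<^esub> a) = - h a"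
  using h_add[of a "\<ominus>\<^bsub>B\<^esub> a"] by (simp add: B.r_neg eq_neg_iff_add_eq_0 add.commute)

lemma h_eqD: "a \<in> carrier B \<Longrightarrow> b \<in> carrier B \<Longrightarrow> h a = h b \<Longrightarrow> a = b"
  using inj_h by (rule inj_onD) auto

definition pre :: "nat \<Rightarrow> 'b set" where
  "pre k = {b \<in> carrier B. h b \<in> loc k}"

lemma pre_surj:
  assumes "x \<in> loc k"
  shows "\<exists>b\<in>pre k. h b = x"
proof -
  have "x \<in> loc 0" using assms loc_antimono[of 0 k] by blast
  then obtain b where "b \<in> carrier B" "h b = x" using h_surj by blast
  then show ?thesis using assms by (intro bexI[of _ b]) (simp_all add: pre_def)
qed

lemma ideal_pre: "ideal (pre k) B"
proof (rule idealI)
  show "subgroup (pre k) (add_monoid B)"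
  proof (rule subgroup.intro)
    fix x assume "x \<in> pre k"
    then show "inv\<^bsub>add_monoid B\<^esub> x \<in> pre k"
      unfolding a_inv_def[symmetric] by (simp add: pre_def loc_uminus)
  qed (auto simp: pre_def loc_add zero_mem_loc)
  fix a x assume "a \<in> pre k" "x \<in> carrier B"
  then show "x \<otimes>\<^bsub>B\<^esub> a \<in> pre k" "a \<otimes>\<^bsub>B\<^esub> x \<in> pre k"
    using loc_mult[OF h_mem, of x "h a" k] by (auto simp: pre_def mult.commute)
qed (rule B.ring_axioms)

lemma pre_0: "pre 0 = carrier B"
  by (auto simp: pre_def h_mem)

lemma ideal_eq_carrier:
  assumes "ideal J B" "x \<in> J" "h x \<notin> loc 1"
  shows "J = carrier B"
proof -
  have x: "x \<in> carrier B" using assms ideal.Icarr by metis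
  obtain y where "y \<in> carrier B" "h x * h y = 1"
    using loc_inverse[OF h_mem[OF x] assms(3)] h_surj by metis
  then have "x \<otimes>\<^bsub>B\<^esub> y = \<one>\<^bsub>B\<^esub>" using x by (intro h_eqD) auto
  moreover have "x \<otimes>\<^bsub>B\<^esub> y \<in> J" using assms \<open>y \<in> carrier B\<close> ideal.I_r_closed by metis
  ultimately show ?thesis using assms(1) ideal.one_imp_carrier by metis
qed

lemma pre_1_neq_carrier: "pre 1 \<noteq> carrier B"
proof
  assume "pre 1 = carrier B"
  then have "\<one>\<^bsub>B\<^esub> \<in> pre 1" by simp
  then show False by (simp only: pre_def mem_Collect_eq h_one one_not_mem_loc simp_thms)
qed

lemma proper_ideal_subset_pre:
  assumes "ideal J B" "J \<noteq> carrier B"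
  shows "J \<subseteq> pre 1"
  using ideal_eq_carrier[OF assms(1)] assms(2) ideal.Icarr[OF assms(1)] by (auto simp: pre_def)

lemma maximalideal_pre: "maximalideal (pre 1) B"
proof (rule maximalidealI[OF ideal_pre])
  show "carrier B \<noteq> pre 1" using pre_1_neq_carrier by simp
  fix J assume "ideal J B" "pre 1 \<subseteq> J" "J \<subseteq> carrier B"
  then show "J = pre 1 \<or> J = carrier B" using proper_ideal_subset_pre by blast
qed

lemma the_maximal_ideal_B: "the_maximal_ideal B = pre 1"
  unfolding the_maximal_ideal_def
proof (rule the_equality[where P = "\<lambda>M. maximalideal M B", OF maximalideal_pre])
  fix M assume "maximalideal M B"
  then interpret M: maximalideal M B .
  have "M \<subseteq> pre 1" using proper_ideal_subset_pre M.is_ideal M.I_notcarr by blast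
  then have "pre 1 = M \<or> pre 1 = carrier B"
    by (intro M.I_maximal ideal_pre) (auto simp: pre_def)
  then show "M = pre 1" using pre_1_neq_carrier by blast
qed

text \<open>The inclusion from right to left is where generation in degree one enters: each monomial
  of degree above k is split as one of degree at least k times one of degree 1, and a numerator is
  treated term by term.\<close>

lemma ideal_prod_pre: "ideal_prod B (pre k) (pre 1) = pre (Suc k)"
proof
  show "ideal_prod B (pre k) (pre 1) \<subseteq> pre (Suc k)"
  proof
    fix x assume "x \<in> ideal_prod B (pre k) (pre 1)"
    then show "x \<in> pre (Suc k)"
    proof (induction rule: ideal_prod.induct)
      case (prod i j)
      then show ?case using loc_mult[of "h i" k "h j" 1] by (simp add: pre_def)
    next
      case (sum s1 s2)
      then show ?case by (simp add: pre_def loc_add)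
    qed
  qed
  show "pre (Suc k) \<subseteq> ideal_prod B (pre k) (pre 1)"
  proof
    fix b assume b: "b \<in> pre (Suc k)"
    then have "b \<in> carrier B" "h b \<in> loc (Suc k)" by (auto simp: pre_def)
    from this(2) obtain p s where
      p: "h b = Fract p s" "keys p \<subseteq> deg_ge (Suc k)" "keys s \<subseteq> S" "lookup s 0 \<noteq> 0" "s \<noteq> 0"
      by (rule locE)
    \<comment> \<open>Stated for every preimage of the fraction, so that the induction may vary
      \<open>p\<close> while \<open>s\<close> stays fixed.\<close>
    have "\<forall>b\<in>carrier B. h b = Fract p s \<longrightarrow> b \<in> ideal_prod B (pre k) (pre 1)"
      using p(2)
    proof (induction rule: keys_induct)
      case zero
      have "\<zero>\<^bsub>B\<^esub> \<otimes>\<^bsub>B\<^esub> \<zero>\<^bsub>B\<^esub> \<in> ideal_prod B (pre k) (pre 1)"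
        by (rule ideal_prod.prod) (auto simp: pre_def zero_mem_loc)
      then show ?case using h_eqD[of _ "\<zero>\<^bsub>B\<^esub>"] p(5) by (auto simp: fract_collapse)
    next
      case (add m c p)
      obtain j where "deg m = Suc j" "k \<le> j" "m \<in> S"
        using add(1) by (cases "deg m") (auto simp: deg_ge_def)
      then obtain m1 m2 where m: "m1 \<in> S" "m2 \<in> S" "m = m1 + m2" "deg m1 = j" "deg m2 = 1"
        using deg_Suc_split by blast
      \<comment> \<open>The denominator and the coefficient go with the first factor; the second is
        a plain monomial of degree 1.\<close>
      have mem: "Fract (single m1 c) s \<in> loc k" "Fract (single m2 1 :: 'm \<Rightarrow>\<^sub>0 'k) 1 \<in> loc 1"
        using m p \<open>k \<le> j\<close> zero_mem by (auto intro!: locI simp: deg_ge_def split: if_splits)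
      obtain b1 where b1: "b1 \<in> pre k" "h b1 = Fract (single m1 c) s"
        using pre_surj[OF mem(1)] by blast
      obtain b2 where b2: "b2 \<in> pre 1" "h b2 = Fract (single m2 1) 1"
        using pre_surj[OF mem(2)] by blast
      note b12 = b1(1) b2(1) b1(2) b2(2)
      have "Fract p s \<in> loc 0" using add p deg_ge_subset[of "Suc k"] by (intro locI) (auto simp: deg_ge_0)
      then obtain b3 where b3: "b3 \<in> carrier B" "h b3 = Fract p s" using h_surj by blast
      then have "b3 \<in> ideal_prod B (pre k) (pre 1)" using add by blast
      then have mem: "(b1 \<otimes>\<^bsub>B\<^esub> b2) \<oplus>\<^bsub>B\<^esub> b3 \<in> ideal_prod B (pre k) (pre 1)"
        using b12 by (intro ideal_prod.sum ideal_prod.prod)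
      show ?case
      proof (intro ballI impI)
        fix b assume b: "b \<in> carrier B" "h b = Fract (single m c + p) s"
        have "b = (b1 \<otimes>\<^bsub>B\<^esub> b2) \<oplus>\<^bsub>B\<^esub> b3"
        proof (rule h_eqD)
          have "h (b1 \<otimes>\<^bsub>B\<^esub> b2 \<oplus>\<^bsub>B\<^esub> b3) = Fract (single m c) s + Fract p s"
            using b12 b3 m by (simp add: pre_def mult_single)
          also have "\<dots> = h b" using b p(5) by (simp add: eq_fract algebra_simps)
          finally show "h b = h (b1 \<otimes>\<^bsub>B\<^esub> b2 \<oplus>\<^bsub>B\<^esub> b3)" by simp
        qed (use b b12 b3 in \<open>auto simp: pre_def\<close>)
        then show "b \<in> ideal_prod B (pre k) (pre 1)" using mem by simp
      qed
    qed
    then show "b \<in> ideal_prod B (pre k) (pre 1)" using p(1) \<open>b \<in> carrier B\<close> by blast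
  qed
qed

lemma ideal_power_pre: "ideal_power B (pre 1) k = pre k"
  by (induction k) (simp_all only: ideal_power.simps pre_0 ideal_prod_pre)

text \<open>For \<open>x\<close> in \<open>loc 0\<close> this is a coset of \<open>pre k\<close>,
  named by the value of \<open>h\<close> on a representative. Computations with cosets thus become
  computations in the fraction field.\<close>

definition cls :: "nat \<Rightarrow> ('m \<Rightarrow>\<^sub>0 'k) fract \<Rightarrow> 'b set" where
  "cls k x = {b \<in> carrier B. h b - x \<in> loc k}"

lemma cls_eq_iff:
  assumes "x \<in> loc 0" "y \<in> loc 0"
  shows "cls k x = cls k y \<longleftrightarrow> x - y \<in> loc k"
proof
  assume "cls k x = cls k y"
  moreover obtain b where "b \<in> carrier B" "h b = x" using h_surj assms by blast
  then have "b \<in> cls k x" by (simp add: cls_def zero_mem_loc)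
  ultimately show "x - y \<in> loc k" using \<open>h b = x\<close> by (simp add: cls_def)
next
  assume xy: "x - y \<in> loc k"
  have "z - x \<in> loc k \<longleftrightarrow> z - y \<in> loc k" for z
    using loc_add[OF _ xy, of "z - x"] loc_diff[OF _ xy, of "z - y"] by auto
  then show "cls k x = cls k y" by (simp add: cls_def)
qed

lemma pre_coset: "a \<in> carrier B \<Longrightarrow> pre k +>\<^bsub>B\<^esub> a = cls k (h a)"
proof
  assume a: "a \<in> carrier B"
  show "pre k +>\<^bsub>B\<^esub> a \<subseteq> cls k (h a)"
    using a by (auto simp: a_r_coset_def' pre_def cls_def)
  show "cls k (h a) \<subseteq> pre k +>\<^bsub>B\<^esub> a"
  proof
    fix b assume b: "b \<in> cls k (h a)"
    then have "b \<ominus>\<^bsub>B\<^esub> a \<in> pre k" using a by (simp add: cls_def pre_def a_minus_def)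
    moreover have "b = (b \<ominus>\<^bsub>B\<^esub> a) \<oplus>\<^bsub>B\<^esub> a"
      using a b by (intro h_eqD) (auto simp: cls_def a_minus_def)
    ultimately show "b \<in> pre k +>\<^bsub>B\<^esub> a" by (auto simp: a_r_coset_def')
  qed
qed

lemma cls_0: "cls k 0 = pre k"
  by (simp add: cls_def pre_def)

lemma cls_add:
  assumes "x \<in> loc 0" "y \<in> loc 0"
  shows "cls k x <+>\<^bsub>B\<^esub> cls k y = cls k (x + y)"
proof -
  obtain a b where ab: "a \<in> carrier B" "h a = x" "b \<in> carrier B" "h b = y"
    using h_surj assms by metis
  have "(pre k +>\<^bsub>B\<^esub> a) <+>\<^bsub>B\<^esub> (pre k +>\<^bsub>B\<^esub> b) = pre k +>\<^bsub>B\<^esub> (a \<oplus>\<^bsub>B\<^esub> b)"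
    using abelian_subgroup.a_rcos_sum[OF abelian_subgroupI3 ab(1,3), of "pre k"]
      ideal.axioms(1)[OF ideal_pre] B.is_abelian_group by blast
  then show ?thesis using ab by (simp add: pre_coset)
qed

text \<open>Every product of representatives gives the same coset, because ab - xy = a(b - y) + (a -
  x)y lies one step deeper than \<open>loc (i + j)\<close>. The union in \<open>rcoset_mult\<close>
  is therefore that coset, both classes being nonempty.\<close>

lemma cls_mult:
  assumes "x \<in> loc i" "y \<in> loc j"
  shows "rcoset_mult B (pre (Suc (i + j))) (cls (Suc i) x) (cls (Suc j) y) = cls (Suc (i + j)) (x * y)"
proof -
  have *: "x \<in> loc 0" "y \<in> loc 0" using assms loc_antimono by blast+
  then obtain a0 b0 where ne: "a0 \<in> cls (Suc i) x" "b0 \<in> cls (Suc j) y"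
    using h_surj by (fastforce simp: cls_def zero_mem_loc)
  have "pre (Suc (i + j)) +>\<^bsub>B\<^esub> (a \<otimes>\<^bsub>B\<^esub> b) = cls (Suc (i + j)) (x * y)"
    if "a \<in> cls (Suc i) x" "b \<in> cls (Suc j) y" for a b
  proof -
    have ab: "a \<in> carrier B" "b \<in> carrier B" "h a - x \<in> loc (Suc i)" "h b - y \<in> loc (Suc j)"
      using that by (auto simp: cls_def)
    have "h a = (h a - x) + x" by simp
    then have "h a \<in> loc i"
      using ab(3) assms(1) loc_antimono[of i "Suc i"] by (metis loc_add le_SucI order_refl subsetD)
    then have "h a * (h b - y) + (h a - x) * y \<in> loc (Suc (i + j))"
      using loc_mult[OF _ ab(4), of "h a" i] loc_mult[OF ab(3) assms(2)] by (intro loc_add) auto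
    moreover have "h a * (h b - y) + (h a - x) * y = h a * h b - x * y" by (simp add: algebra_simps)
    ultimately have "h a * h b - x * y \<in> loc (Suc (i + j))" by simp
    then show ?thesis
      using ab * loc_mult[of "h a" 0 "h b" 0] loc_mult[of x 0 y 0] h_mem
      by (simp add: pre_coset cls_eq_iff)
  qed
  then show ?thesis unfolding rcoset_mult_def using ne by blast
qed

lemma finsum_cls:
  assumes "finite A" "\<And>i. i \<in> A \<Longrightarrow> x i \<in> loc 0"
  shows "finsum (B Quot pre k) (\<lambda>i. cls k (x i)) A = cls k (\<Sum>i\<in>A. x i) \<and> (\<Sum>i\<in>A. x i) \<in> loc 0"
  using assms
proof (induction rule: finite_induct)
  case empty
  interpret Q: ring "B Quot pre k" using ideal.quotient_is_ring[OF ideal_pre] .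
  have "\<zero>\<^bsub>B Quot pre k\<^esub> = cls k 0" by (simp add: FactRing_def cls_0)
  then show ?case by (simp add: zero_mem_loc)
next
  case (insert i A)
  interpret Q: ring "B Quot pre k" using ideal.quotient_is_ring[OF ideal_pre] .
  have carr: "cls k y \<in> carrier (B Quot pre k)" if "y \<in> loc 0" for y
    using h_surj[OF that] pre_coset[of _ k] by (auto simp: FactRing_def A_RCOSETS_def' )
  have "finsum (B Quot pre k) (\<lambda>i. cls k (x i)) (insert i A)
      = cls k (x i) \<oplus>\<^bsub>B Quot pre k\<^esub> finsum (B Quot pre k) (\<lambda>i. cls k (x i)) A"
    using insert carr by (intro Q.finsum_insert) auto
  also have "\<dots> = cls k (x i + (\<Sum>i\<in>A. x i))"
    using insert by (simp add: FactRing_def cls_add)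
  finally show ?case using insert loc_add[of "x i" 0 "\<Sum>i\<in>A. x i"] by simp
qed

end

section \<open>The associated graded ring\<close>

lemma Fract_sum: "Fract (\<Sum>i\<in>A. f i) 1 = (\<Sum>i\<in>A. Fract (f i) 1)"
proof (induction A rule: infinite_finite_induct)
  case (insert x A)
  have "Fract (f x + sum f A) 1 = Fract (f x) 1 + Fract (sum f A) 1" by simp
  then show ?case using insert by simp
qed (simp_all add: fract_collapse)

context local_model
begin

definition gr :: "(nat \<Rightarrow> 'b set) ring" where
  "gr = assoc_graded B (pre 1)"

lemma gr_simps:
  "f \<in> carrier gr \<longleftrightarrow> (\<forall>k. \<exists>a\<in>pre k. f k = cls (Suc k) (h a)) \<and> finite {k. f k \<noteq> cls (Suc k) 0}"
  "(f \<otimes>\<^bsub>gr\<^esub> g) k = finsum (B Quot pre (Suc k)) (\<lambda>i. rcoset_mult B (pre (Suc k)) (f i) (g (k - i))) {..k}"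
  "\<one>\<^bsub>gr\<^esub> k = cls (Suc k) (if k = 0 then 1 else 0)"
  "\<zero>\<^bsub>gr\<^esub> k = cls (Suc k) 0"
  "(f \<oplus>\<^bsub>gr\<^esub> g) k = f k <+>\<^bsub>B\<^esub> g k"
proof -
  have "pre (Suc k) +>\<^bsub>B\<^esub> a = cls (Suc k) (h a)" if "a \<in> pre k" for a k
    using that by (intro pre_coset) (simp add: pre_def)
  then show "f \<in> carrier gr \<longleftrightarrow> (\<forall>k. \<exists>a\<in>pre k. f k = cls (Suc k) (h a)) \<and> finite {k. f k \<noteq> cls (Suc k) 0}"
    unfolding gr_def assoc_graded_def ideal_power_pre cls_0 by (auto cong: bex_cong)
  show "\<one>\<^bsub>gr\<^esub> k = cls (Suc k) (if k = 0 then 1 else 0)"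
    unfolding gr_def assoc_graded_def ideal_power_pre by (simp add: pre_coset cls_0)
qed (simp_all add: gr_def assoc_graded_def ideal_power_pre cls_0 del: One_nat_def ideal_power.simps)

definition gr_map :: "('m \<Rightarrow>\<^sub>0 'k) \<Rightarrow> nat \<Rightarrow> 'b set" where
  "gr_map q = (\<lambda>k. cls (Suc k) (Fract (hc k q) 1))"

lemma Fract_hc_mem_loc: "keys q \<subseteq> S \<Longrightarrow> Fract (hc k q) 1 \<in> loc k"
  using keys_hc[of q k] zero_mem by (intro locI) (auto simp: deg_ge_def deg_at_def)

lemma Fract_hc_mem_loc_0: "keys q \<subseteq> S \<Longrightarrow> Fract (hc k q) 1 \<in> loc 0"
  using Fract_hc_mem_loc loc_antimono[of 0 k] by blast

text \<open>A nonzero form of degree k has order exactly k, hence is not in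
  \<open>loc (Suc k)\<close>. This is the injectivity of \<open>gr_map\<close> in a single
  degree.\<close>

lemma cls_Fract_homogeneous_inj:
  assumes "keys p \<subseteq> deg_at k" "keys q \<subseteq> deg_at k"
    and "cls (Suc k) (Fract p 1) = cls (Suc k) (Fract q 1)"
  shows "p = q"
proof -
  have "Fract p 1 \<in> loc 0" "Fract q 1 \<in> loc 0"
    using assms zero_mem by (auto intro!: locI simp: deg_at_def deg_ge_def)
  then have "Fract (p - q) 1 \<in> loc (Suc k)"
    using assms(3) by (simp add: cls_eq_iff)
  moreover have pq: "keys (p - q) \<subseteq> deg_at k"
    using keys_diff[of p q] assms by blast
  ultimately have "keys (p - q) \<subseteq> deg_ge (Suc k)"
    by (subst (asm) Fract_1_mem_loc_iff) (auto simp: deg_at_def)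
  with pq have "keys (p - q) = {}" by (fastforce simp: deg_at_def deg_ge_def)
  then show ?thesis by simp
qed

lemma gr_map_closed:
  assumes "keys q \<subseteq> S"
  shows "gr_map q \<in> carrier gr"
proof -
  have "\<exists>a\<in>pre k. gr_map q k = cls (Suc k) (h a)" for k
    using pre_surj[OF Fract_hc_mem_loc[OF assms, of k]] unfolding gr_map_def by metis
  moreover have "{k. gr_map q k \<noteq> cls (Suc k) 0} \<subseteq> deg ` keys q"
  proof
    fix k assume "k \<in> {k. gr_map q k \<noteq> cls (Suc k) 0}"
    then have "hc k q \<noteq> 0" by (auto simp: gr_map_def fract_collapse)
    then obtain a where "a \<in> keys (hc k q)" by fastforce
    then show "k \<in> deg ` keys q" by (auto simp: hc_def keys_restr)
  qed
  then have "finite {k. gr_map q k \<noteq> cls (Suc k) 0}" by (rule finite_subset) simp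
  ultimately show ?thesis by (simp add: gr_simps)
qed

lemma gr_map_add:
  assumes "keys p \<subseteq> S" "keys q \<subseteq> S"
  shows "gr_map (p + q) = gr_map p \<oplus>\<^bsub>gr\<^esub> gr_map q"
  by (rule ext) (simp add: gr_simps gr_map_def cls_add Fract_hc_mem_loc_0 assms hc_add)

text \<open>The product of the associated graded ring and the formula \<open>hc_mult\<close> for
  homogeneous components are the same Cauchy product.\<close>

lemma gr_map_mult:
  assumes "keys p \<subseteq> S" "keys q \<subseteq> S"
  shows "gr_map (p * q) = gr_map p \<otimes>\<^bsub>gr\<^esub> gr_map q"
proof (rule ext)
  fix k
  have "(gr_map p \<otimes>\<^bsub>gr\<^esub> gr_map q) k
      = finsum (B Quot pre (Suc k)) (\<lambda>i. cls (Suc k) (Fract (hc i p * hc (k - i) q) 1)) {..k}"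
    unfolding gr_simps
  proof (rule abelian_monoid.finsum_cong')
    show "abelian_monoid (B Quot pre (Suc k))"
      using ideal.quotient_is_ring[OF ideal_pre] ring.is_abelian_group abelian_group.axioms by blast
    show "(\<lambda>i. cls (Suc k) (Fract (hc i p * hc (k - i) q) 1)) \<in> {..k} \<rightarrow> carrier (B Quot pre (Suc k))"
    proof
      fix i assume "i \<in> {..k}"
      have "Fract (hc i p * hc (k - i) q) 1 \<in> loc 0"
        using loc_mult[OF Fract_hc_mem_loc_0[OF assms(1)] Fract_hc_mem_loc_0[OF assms(2)]] by simp
      then obtain b where "b \<in> carrier B" "h b = Fract (hc i p * hc (k - i) q) 1" using h_surj by blast
      then show "cls (Suc k) (Fract (hc i p * hc (k - i) q) 1) \<in> carrier (B Quot pre (Suc k))"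
        using pre_coset[of b "Suc k"] by (auto simp: FactRing_def A_RCOSETS_def')
    qed
    fix i assume "i \<in> {..k}"
    then show "rcoset_mult B (pre (Suc k)) (gr_map p i) (gr_map q (k - i))
        = cls (Suc k) (Fract (hc i p * hc (k - i) q) 1)"
      using cls_mult[OF Fract_hc_mem_loc[OF assms(1), of i] Fract_hc_mem_loc[OF assms(2), of "k - i"]]
      by (simp add: gr_map_def)
  qed simp
  also have "\<dots> = cls (Suc k) (\<Sum>i\<le>k. Fract (hc i p * hc (k - i) q) 1)"
    using loc_mult[OF Fract_hc_mem_loc_0[OF assms(1)] Fract_hc_mem_loc_0[OF assms(2)]]
    by (subst finsum_cls) auto
  also have "\<dots> = gr_map (p * q) k"
    by (simp add: gr_map_def hc_mult[OF assms] Fract_sum)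
  finally show "gr_map (p * q) k = (gr_map p \<otimes>\<^bsub>gr\<^esub> gr_map q) k" ..
qed

lemma gr_map_one: "gr_map 1 = \<one>\<^bsub>gr\<^esub>"
  by (rule ext) (simp add: gr_simps gr_map_def hc_1 fract_collapse)

lemma gr_map_zero: "gr_map 0 = \<zero>\<^bsub>gr\<^esub>"
  by (rule ext) (simp add: gr_simps gr_map_def fract_collapse)

lemma gr_map_inj: "inj_on gr_map {q. keys q \<subseteq> S}"
proof (rule inj_onI)
  fix p q assume *: "p \<in> {q. keys q \<subseteq> S}" "q \<in> {q. keys q \<subseteq> S}" "gr_map p = gr_map q"
  have hc: "hc k p = hc k q" for k
    using fun_cong[OF *(3), of k] * keys_hc[of p k] keys_hc[of q k]
    by (intro cls_Fract_homogeneous_inj[of _ k]) (simp_all add: gr_map_def)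
  show "p = q"
  proof (rule poly_mapping_eqI)
    fix a show "lookup p a = lookup q a"
      using arg_cong[OF hc[of "deg a"], of "\<lambda>r. lookup r a"] by (simp add: lookup_hc)
  qed
qed

text \<open>A leading form is chosen in each degree; the finite support of \<open>f\<close> makes
  the forms add up to an element of K[S].\<close>

lemma gr_map_surj:
  assumes "f \<in> carrier gr"
  shows "\<exists>q. keys q \<subseteq> S \<and> gr_map q = f"
proof -
  have "\<exists>r. keys r \<subseteq> deg_at k \<and> f k = cls (Suc k) (Fract r 1)" for k
  proof -
    obtain a where a: "a \<in> pre k" "f k = cls (Suc k) (h a)" using assms by (auto simp: gr_simps)
    then have "h a \<in> loc k" by (simp add: pre_def)
    then obtain r where r: "keys r \<subseteq> deg_at k" "h a - Fract r 1 \<in> loc (Suc k)"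
      using loc_leading_form by blast
    have "Fract r 1 \<in> loc 0"
      using r(1) zero_mem by (intro locI) (auto simp: deg_at_def deg_ge_def)
    then have "cls (Suc k) (h a) = cls (Suc k) (Fract r 1)"
      using r(2) a by (subst cls_eq_iff) (auto simp: pre_def h_mem)
    then show ?thesis using a r by auto
  qed
  then obtain r where r: "\<And>k. keys (r k) \<subseteq> deg_at k" "\<And>k. f k = cls (Suc k) (Fract (r k) 1)"
    by metis
  define A where "A = {k. f k \<noteq> cls (Suc k) 0}"
  have fin: "finite A" using assms by (simp add: gr_simps A_def)
  \<comment> \<open>Uniqueness of forms makes the chosen form zero wherever the class is zero, so a
    sum over the finite set \<open>A\<close> contains all of them.\<close>
  have r0: "r k = 0" if "k \<notin> A" for k
    using that r by (intro cls_Fract_homogeneous_inj[of _ k]) (auto simp: A_def fract_collapse)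
  define q where "q = (\<Sum>k\<in>A. r k)"
  have "keys q \<subseteq> S"
    unfolding q_def using keys_sum[of r A] r(1) by (fastforce simp: deg_at_def)
  moreover have "hc k q = r k" for k
  proof -
    have "hc k q = (\<Sum>j\<in>A. hc k (r j))"
      unfolding q_def by (induction A rule: infinite_finite_induct) (simp_all add: hc_add)
    also have "\<dots> = (\<Sum>j\<in>A. if k = j then r j else 0)"
      by (intro sum.cong refl) (simp add: hc_homogeneous[OF r(1)])
    also have "\<dots> = r k" using fin r0 by simp
    finally show ?thesis .
  qed
  then have "gr_map q = f" by (auto simp: gr_map_def r(2))
  ultimately show ?thesis by blast
qed

lemma gr_map_iso: "gr_map \<in> ring_iso (monoid_ring S) gr"
  unfolding ring_iso_def
proof (intro CollectI conjI)
  show "gr_map \<in> ring_hom (monoid_ring S) gr"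
    by (rule ring_hom_memI)
       (simp_all add: gr_map_closed gr_map_mult gr_map_add gr_map_one)
  show "bij_betw gr_map (carrier (monoid_ring S)) (carrier gr)"
    unfolding bij_betw_def
  proof (intro conjI equalityI subsetI)
    fix f assume "f \<in> carrier gr"
    then show "f \<in> gr_map ` carrier (monoid_ring S)" using gr_map_surj by fastforce
  qed (auto simp: gr_map_inj gr_map_closed)
qed

lemma cring_gr: "cring gr"
  using cring.ring_iso_imp_img_cring[OF cring_monoid_ring_S gr_map_iso] by (simp add: gr_map_zero)

lemma gr_map_ring_hom_ring: "ring_hom_ring (monoid_ring S) gr gr_map"
  using gr_map_iso cring_gr cring_monoid_ring_S
  by (intro ring_hom_ringI2) (auto simp: ring_iso_def cring_def)

lemma homogeneous_part_gr:
  "homogeneous_part gr k = gr_map ` {q. keys q \<subseteq> deg_at k}"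
proof (intro equalityI subsetI)
  fix f assume f: "f \<in> homogeneous_part gr k"
  then obtain q where q: "keys q \<subseteq> S" "gr_map q = f"
    using gr_map_surj unfolding homogeneous_part_def by blast
  have "hc j q = 0" if "j \<noteq> k" for j
  proof (rule cls_Fract_homogeneous_inj[of _ j])
    show "cls (Suc j) (Fract (hc j q) 1) = cls (Suc j) (Fract 0 1)"
      using f q that by (auto simp: homogeneous_part_def gr_map_def gr_simps fract_collapse)
  qed (use keys_hc[OF q(1)] in auto)
  have "keys q \<subseteq> deg_at k"
  proof
    fix a assume a: "a \<in> keys q"
    then have "lookup (hc (deg a) q) a \<noteq> 0" by (simp add: lookup_hc in_keys_iff)
    then have "hc (deg a) q \<noteq> 0" by auto
    then have "deg a = k" using \<open>\<And>j. j \<noteq> k \<Longrightarrow> hc j q = 0\<close> by blast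
    then show "a \<in> deg_at k" using a q by (auto simp: deg_at_def)
  qed
  then show "f \<in> gr_map ` {q. keys q \<subseteq> deg_at k}" using q by auto
next
  fix f assume "f \<in> gr_map ` {q. keys q \<subseteq> deg_at k}"
  then obtain q where q: "keys q \<subseteq> deg_at k" "f = gr_map q" by auto
  then have "keys q \<subseteq> S" by (auto simp: deg_at_def)
  then show "f \<in> homogeneous_part gr k"
    using q by (simp add: homogeneous_part_def gr_map_closed)
      (simp add: gr_map_def hc_homogeneous[OF q(1)] gr_simps fract_collapse)
qed

lemma constants_eq: "{q :: 'm \<Rightarrow>\<^sub>0 'a::zero. keys q \<subseteq> deg_at 0} = range (single 0)"
proof (intro equalityI subsetI)
  fix q :: "'m \<Rightarrow>\<^sub>0 'a" assume "q \<in> {q. keys q \<subseteq> deg_at 0}"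
  then have "q = single 0 (lookup q 0)"
    by (intro poly_mapping_eqI) (auto simp: deg_at_0 lookup_single when_def in_keys_iff)
  then show "q \<in> range (single 0)" by blast
qed (auto simp: deg_at_0 split: if_splits)

text \<open>The constants of K[S] form a field, and \<open>gr_map\<close> carries it to the
  degree-zero part. This is what gives the dimension in \<open>hilbert_function\<close> its
  meaning.\<close>

lemma subfield_homogeneous_part_0: "subfield (homogeneous_part gr 0) gr"
proof -
  interpret R: cring "monoid_ring S :: ('m \<Rightarrow>\<^sub>0 'k) ring" by (rule cring_monoid_ring_S)
  let ?K = "{q :: 'm \<Rightarrow>\<^sub>0 'k. keys q \<subseteq> deg_at 0}"
  have K: "?K = range (single 0)" by (rule constants_eq)
  have "subring ?K (monoid_ring S)"
  proof (rule R.subringI)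
    fix p assume p: "p \<in> ?K"
    then have "keys p \<subseteq> S" by (auto simp: deg_at_def)
    then have "\<ominus>\<^bsub>monoid_ring S\<^esub> p = - p" by (intro R.minus_equality) auto
    then show "\<ominus>\<^bsub>monoid_ring S\<^esub> p \<in> ?K" using p by simp
  qed (auto simp: K zero_mem mult_single split: if_splits intro: range_eqI[of _ _ 1] simp flip: single_add)
  then have "subcring ?K (monoid_ring S)"
    by (rule R.subcringI') 
  moreover have "Units (monoid_ring S\<lparr>carrier := ?K\<rparr>) = ?K - {\<zero>\<^bsub>monoid_ring S\<^esub>}"
  proof (intro equalityI subsetI)
    fix q assume q: "q \<in> ?K - {\<zero>\<^bsub>monoid_ring S\<^esub>}"
    then obtain c where c: "q = single 0 c" unfolding K by blast
    with q have "c \<noteq> 0" by auto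
    with c have "q * single 0 (inverse c) = 1" "single 0 (inverse c) * q = 1" by (simp_all add: mult_single)
    then show "q \<in> Units (monoid_ring S\<lparr>carrier := ?K\<rparr>)"
      using q unfolding Units_def K by auto
  qed (auto simp: Units_def)
  ultimately have "subfield ?K (monoid_ring S)" by (rule R.subfieldI)
  moreover have "\<one>\<^bsub>gr\<^esub> \<noteq> \<zero>\<^bsub>gr\<^esub>"
    using inj_onD[OF gr_map_inj, of 1 0] zero_mem by (auto simp flip: gr_map_one gr_map_zero)
  ultimately show ?thesis
    unfolding homogeneous_part_gr
    using ring_hom_ring.img_is_subfield(2)[OF gr_map_ring_hom_ring] by blast
qed

text \<open>The monomials of degree k are a basis. Span and independence are proved by induction on
  an arbitrary list of distinct monomials, each new one enlarging the span by a line
  extension.\<close>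

lemma hilbert_function_gr: "hilbert_function gr k = card (deg_at k)"
proof -
  interpret G: cring gr by (rule cring_gr)
  let ?K = "homogeneous_part gr 0"
  have K: "?K = gr_map ` range (single 0)"
    by (simp only: homogeneous_part_gr constants_eq)
  have fin: "finite (deg_at k)" unfolding deg_at_def by (rule finite_deg)
  obtain xs where xs: "set xs = deg_at k" "distinct xs" using finite_distinct_list[OF fin] by blast
  have "G.Span ?K (map (\<lambda>a. gr_map (single a 1)) ys) = gr_map ` {q. keys q \<subseteq> set ys}
      \<and> G.independent ?K (map (\<lambda>a. gr_map (single a 1)) ys)"
    if "set ys \<subseteq> S" "distinct ys" for ys
    using that
  proof (induction ys)
    case Nil
    then show ?case by (simp add: gr_map_zero)
  next
    case (Cons a ys)
    then have IH: "G.Span ?K (map (\<lambda>a. gr_map (single a 1)) ys) = gr_map ` {q. keys q \<subseteq> set ys}"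
      "G.independent ?K (map (\<lambda>a. gr_map (single a 1)) ys)" and a: "a \<in> S" "a \<notin> set ys" "set ys \<subseteq> S"
      by auto
    have lin: "gr_map (single 0 c) \<otimes>\<^bsub>gr\<^esub> gr_map (single a 1) \<oplus>\<^bsub>gr\<^esub> gr_map q = gr_map (single a c + q)"
      if "keys q \<subseteq> set ys" for c q
      using that a zero_mem gr_map_mult[of "single 0 c" "single a 1"] gr_map_add[of "single a c" q]
      by (auto simp: mult_single)
    have "G.line_extension ?K (gr_map (single a 1)) (gr_map ` {q. keys q \<subseteq> set ys})
        = gr_map ` {q. keys q \<subseteq> set (a # ys)}"
    proof (intro equalityI subsetI)
      fix u assume "u \<in> G.line_extension ?K (gr_map (single a 1)) (gr_map ` {q. keys q \<subseteq> set ys})"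
      then obtain c q where q: "keys q \<subseteq> set ys" "u = gr_map (single a c + q)"
        unfolding G.line_extension_mem_iff K using lin by auto
      have "keys (single a c + q) \<subseteq> set (a # ys)"
        using keys_add[of "single a c" q] q(1) by (auto split: if_splits)
      then show "u \<in> gr_map ` {q. keys q \<subseteq> set (a # ys)}" using q by blast
    next
      fix u assume "u \<in> gr_map ` {q. keys q \<subseteq> set (a # ys)}"
      then obtain p where p: "keys p \<subseteq> set (a # ys)" "u = gr_map p" by auto
      define q where "q = p - single a (lookup p a)"
      have q: "keys q \<subseteq> set ys"
        using p(1) by (auto simp: q_def in_keys_iff lookup_minus lookup_single when_def split: if_splits)
      have "u = gr_map (single a (lookup p a) + q)" by (simp add: p q_def)
      then show "u \<in> G.line_extension ?K (gr_map (single a 1)) (gr_map ` {q. keys q \<subseteq> set ys})"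
        unfolding G.line_extension_mem_iff K
        by (intro bexI[of _ "gr_map (single 0 (lookup p a))"] bexI[of _ "gr_map q"])
           (use lin[OF q, of "lookup p a"] q in auto)
    qed
    moreover have "gr_map (single a 1) \<notin> gr_map ` {q. keys q \<subseteq> set ys}"
    proof
      assume "gr_map (single a 1) \<in> gr_map ` {q. keys q \<subseteq> set ys}"
      then obtain q where q: "keys q \<subseteq> set ys" "gr_map (single a 1) = gr_map q" by auto
      then have "single a 1 = q" using a by (intro inj_onD[OF gr_map_inj]) auto
      then show False using q a by auto
    qed
    ultimately show ?case
      using IH a gr_map_closed[of "single a 1"] by (auto intro!: G.li_Cons)
  qed
  from this[of xs] have "G.dimension (length xs) ?K (homogeneous_part gr k)"
    using xs G.dimensionI[OF subfield_homogeneous_part_0, of "map (\<lambda>a. gr_map (single a 1)) xs"]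
    by (auto simp: homogeneous_part_gr deg_at_def)
  then have "G.dim ?K (homogeneous_part gr k) = length xs"
    using G.dimI[OF subfield_homogeneous_part_0] by (simp add: over_def)
  then show ?thesis
    using xs distinct_card[of xs] by (simp add: hilbert_function_def)
qed

end

section \<open>Krull dimension\<close>

lemma krull_dim_geI:
  assumes "\<And>i. i \<le> m \<Longrightarrow> primeideal (P i) R" "\<And>i. i < m \<Longrightarrow> P i \<subset> P (Suc i)"
  shows "enat m \<le> krull_dim R"
  unfolding krull_dim_def by (rule Sup_upper) (use assms in blast)

lemma krull_dim_leI:
  assumes "\<And>m P. (\<And>i. i \<le> m \<Longrightarrow> primeideal (P i) R) \<Longrightarrow> (\<And>i. i < m \<Longrightarrow> P i \<subset> P (Suc i)) \<Longrightarrow> enat m \<le> D"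
  shows "krull_dim R \<le> D"
  unfolding krull_dim_def by (rule Sup_least) (use assms in blast)

lemma krull_dim_le_surj:
  assumes "cring R" "ring_hom_ring R T f" "f ` carrier R = carrier T"
  shows "krull_dim T \<le> krull_dim R"
proof (rule krull_dim_leI)
  fix m P
  assume P: "\<And>i. i \<le> m \<Longrightarrow> primeideal (P i) T" "\<And>i. i < m \<Longrightarrow> P i \<subset> P (Suc i)"
  show "enat m \<le> krull_dim R"
  proof (rule krull_dim_geI)
    show "primeideal {r \<in> carrier R. f r \<in> P i} R" if "i \<le> m" for i
      by (rule ring_hom_ring.primeideal_vimage[OF assms(2,1) P(1)[OF that]])
    fix i assume i: "i < m"
    obtain s where s: "s \<in> P (Suc i)" "s \<notin> P i" using P(2)[OF i] by blast
    have "primeideal (P (Suc i)) T" using P(1) i by simp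
    then have "s \<in> carrier T"
      using s ideal.Icarr[of "P (Suc i)" T s] by (simp add: primeideal_def)
    then obtain r where "r \<in> carrier R" "s = f r" using assms(3) by blast
    then show "{r \<in> carrier R. f r \<in> P i} \<subset> {r \<in> carrier R. f r \<in> P (Suc i)}"
      using s P(2)[OF i] by blast
  qed
qed

lemma krull_dim_ring_iso:
  assumes "cring R" "cring T" "f \<in> ring_iso R T"
  shows "krull_dim T = krull_dim R"
proof (rule antisym)
  have "ring R" "ring T" using assms by (auto simp: cring_def)
  have f: "f \<in> ring_hom R T" "f ` carrier R = carrier T"
    using assms(3) by (auto simp: ring_iso_def bij_betw_def)
  show "krull_dim T \<le> krull_dim R"
    by (rule krull_dim_le_surj[OF assms(1) ring_hom_ringI2[OF \<open>ring R\<close> \<open>ring T\<close> f(1)] f(2)])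
  let ?g = "inv_into (carrier R) f"
  have g: "?g \<in> ring_hom T R" "?g ` carrier T = carrier R"
    using ring_iso_set_sym[OF \<open>ring R\<close> assms(3)] by (auto simp: ring_iso_def bij_betw_def)
  show "krull_dim R \<le> krull_dim T"
    by (rule krull_dim_le_surj[OF assms(2) ring_hom_ringI2[OF \<open>ring T\<close> \<open>ring R\<close> g(1)] g(2)])
qed

text \<open>There are more vectors than monomials that span them. Linear dependence of vector spaces
  concerns sets, not families, so a repeated vector is treated separately, by the coefficients 1 and
  -1.\<close>

lemma linear_relation_exists:
  fixes b :: "nat \<Rightarrow> 'a::comm_monoid_add \<Rightarrow>\<^sub>0 'k::field"
  assumes "finite A" "card A < N" "\<And>j. j < N \<Longrightarrow> keys (b j) \<subseteq> A"
  shows "\<exists>c. (\<Sum>j<N. single 0 (c j) * b j) = 0 \<and> (\<exists>j<N. c j \<noteq> 0)"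
proof (cases "inj_on b {..<N}")
  case False
  then obtain i j where ij: "i < N" "j < N" "i \<noteq> j" "b i = b j" by (auto simp: inj_on_def)
  let ?c = "\<lambda>l. if l = i then 1 else if l = j then - 1 else 0 :: 'k"
  have "(\<Sum>l<N. single 0 (?c l) * b l) = (\<Sum>l<N. (if l = i then b i else 0) - (if l = j then b j else 0))"
    using ij by (intro sum.cong) (auto simp: single_uminus)
  also have "\<dots> = 0" unfolding sum_subtractf using ij by simp
  finally show ?thesis using ij by (intro exI[of _ ?c]) auto
next
  case True
  interpret vs: vector_space "\<lambda>c p. single 0 c * (p :: 'a \<Rightarrow>\<^sub>0 'k)"
    by unfold_locales (simp_all add: algebra_simps single_add mult_single flip: mult.assoc)
  have "b ` {..<N} \<subseteq> vs.span ((\<lambda>a. single a 1) ` A)"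
  proof safe
    fix j assume "j < N"
    then have "keys (b j) \<subseteq> A" by (rule assms(3))
    then show "b j \<in> vs.span ((\<lambda>a. single a 1) ` A)"
    proof (induction rule: keys_induct)
      case (add m c p)
      have "single 0 c * single m 1 \<in> vs.span ((\<lambda>a. single a 1) ` A)"
        using add by (intro vs.span_scale vs.span_base) auto
      then show ?case using add by (auto simp: mult_single intro: vs.span_add)
    qed (rule vs.span_zero)
  qed
  moreover have "card (b ` {..<N}) > card ((\<lambda>a. single a (1::'k)) ` A)"
    using card_image_le[OF assms(1), of "\<lambda>a. single a (1::'k)"] assms(2) True by (simp add: card_image)
  ultimately have "vs.dependent (b ` {..<N})"
    using vs.independent_span_bound[of "(\<lambda>a. single a 1) ` A" "b ` {..<N}"] assms(1) by auto
  then obtain t u v where t: "finite t" "t \<subseteq> b ` {..<N}" "(\<Sum>v\<in>t. single 0 (u v) * v) = 0" "v \<in> t" "u v \<noteq> 0"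
    unfolding vs.dependent_explicit by blast
  let ?c = "\<lambda>j. if b j \<in> t then u (b j) else 0"
  have "(\<Sum>j<N. single 0 (?c j) * b j) = (\<Sum>v\<in>b ` {..<N}. if v \<in> t then single 0 (u v) * v else 0)"
    unfolding sum.reindex[OF True] by (intro sum.cong) auto
  also have "\<dots> = (\<Sum>v\<in>t. single 0 (u v) * v)"
    using t(2) by (subst sum.inter_restrict[symmetric]) (auto simp: Int_absorb1)
  finally have "(\<Sum>j<N. single 0 (?c j) * b j) = 0" using t by simp
  moreover have "\<exists>j<N. ?c j \<noteq> 0" using t by auto
  ultimately show ?thesis by (intro exI[of _ ?c] conjI)
qed

context graded_monoid
begin

text \<open>Translates primality into the type-class operations, in which the sums and powers of the
  dimension arguments are computed.\<close>

lemma primeideal_monoid_ring_iff: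
  "primeideal Q (monoid_ring S :: ('m \<Rightarrow>\<^sub>0 'k::comm_ring_1) ring) \<longleftrightarrow>
     Q \<subseteq> {p. keys p \<subseteq> S} \<and> 0 \<in> Q \<and> 1 \<notin> Q \<and> (\<forall>p\<in>Q. \<forall>q\<in>Q. p + q \<in> Q)
     \<and> (\<forall>p\<in>Q. \<forall>r. keys r \<subseteq> S \<longrightarrow> r * p \<in> Q)
     \<and> (\<forall>p q. keys p \<subseteq> S \<longrightarrow> keys q \<subseteq> S \<longrightarrow> p * q \<in> Q \<longrightarrow> p \<in> Q \<or> q \<in> Q)"
    (is "?l \<longleftrightarrow> ?r")
proof
  assume ?l
  then interpret Q: primeideal Q "monoid_ring S" .
  show ?r
  proof (intro conjI ballI allI impI)
    show "Q \<subseteq> {p. keys p \<subseteq> S}" using Q.Icarr by auto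
    show "0 \<in> Q" using additive_subgroup.zero_closed[OF Q.additive_subgroup_axioms] by simp
    show "1 \<notin> Q" using Q.one_imp_carrier Q.I_notcarr by auto
    show "p + q \<in> Q" if "p \<in> Q" "q \<in> Q" for p q
      using additive_subgroup.a_closed[OF Q.additive_subgroup_axioms that] by simp
    show "r * p \<in> Q" if "p \<in> Q" "keys r \<subseteq> S" for p r
      using Q.I_l_closed[OF that(1), of r] that by simp
    show "p \<in> Q \<or> q \<in> Q" if "keys p \<subseteq> S" "keys q \<subseteq> S" "p * q \<in> Q" for p q
      using Q.I_prime[of p q] that by simp
  qed
next
  assume r: ?r
  interpret R: cring "monoid_ring S :: ('m \<Rightarrow>\<^sub>0 'k) ring" by (rule cring_monoid_ring_S)
  show ?l
  proof (rule primeidealI)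
    show "ideal Q (monoid_ring S)"
    proof (rule idealI)
      show "subgroup Q (add_monoid (monoid_ring S))"
      proof (rule subgroup.intro)
        fix p assume p: "p \<in> Q"
        have "keys (- 1 :: 'm \<Rightarrow>\<^sub>0 'k) \<subseteq> S" using zero_mem by simp
        then have "(- 1) * p \<in> Q" using r p by blast
        moreover have "\<ominus>\<^bsub>monoid_ring S\<^esub> p = - p"
          using p r by (intro R.minus_equality) auto
        ultimately show "inv\<^bsub>add_monoid (monoid_ring S)\<^esub> p \<in> Q"
          unfolding a_inv_def[symmetric] by simp
      qed (use r in auto)
    qed (use r R.ring_axioms in \<open>auto simp: mult.commute\<close>)
    show "carrier (monoid_ring S) \<noteq> Q" using r zero_mem by force
  qed (use r R.cring_axioms in auto)
qed

text \<open>A descending chain of faces gives an ascending chain of kernels of the projections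
  \<open>restr (F i)\<close>. They are prime because the projections are multiplicative with values
  in a domain, and a monomial in \<open>F i\<close> outside \<open>F (Suc i)\<close> makes the
  inclusion strict.\<close>

lemma krull_dim_monoid_ring_ge:
  assumes faces: "\<And>i a b. i \<le> m \<Longrightarrow> a \<in> S \<Longrightarrow> b \<in> S \<Longrightarrow> a + b \<in> F i \<longleftrightarrow> a \<in> F i \<and> b \<in> F i"
    and zero: "\<And>i. i \<le> m \<Longrightarrow> 0 \<in> F i"
    and strict: "\<And>i. i < m \<Longrightarrow> F (Suc i) \<subset> F i" and "F 0 \<subseteq> S"
  shows "enat m \<le> krull_dim (monoid_ring S :: ('m \<Rightarrow>\<^sub>0 'k::field) ring)"
proof -
  let ?P = "\<lambda>i. {p :: 'm \<Rightarrow>\<^sub>0 'k. keys p \<subseteq> S \<and> restr (F i) p = 0}"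
  have "primeideal (?P i) (monoid_ring S)" if i: "i \<le> m" for i
  proof -
    have mult: "restr (F i) (p * q) = restr (F i) p * restr (F i) q"
      if "keys p \<subseteq> S" "keys q \<subseteq> S" for p q :: "'m \<Rightarrow>\<^sub>0 'k"
      using that faces[OF i] by (rule restr_mult_face)
    have "restr (F i) 1 = (1 :: 'm \<Rightarrow>\<^sub>0 'k)" using zero[OF i] by (intro restr_eq_self) simp
    show ?thesis
      unfolding primeideal_monoid_ring_iff
    proof (intro conjI ballI allI impI)
      fix p q assume "p \<in> ?P i" "q \<in> ?P i"
      then show "p + q \<in> ?P i" using keys_add[of p q] by (auto simp: restr_add)
    next
      fix p r :: "'m \<Rightarrow>\<^sub>0 'k" assume "p \<in> ?P i" "keys r \<subseteq> S"
      then show "r * p \<in> ?P i" using keys_mult_S[of r p] by (simp add: mult)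
    next
      fix p q :: "'m \<Rightarrow>\<^sub>0 'k"
      assume "keys p \<subseteq> S" "keys q \<subseteq> S" "p * q \<in> ?P i"
      then show "p \<in> ?P i \<or> q \<in> ?P i" by (simp add: mult)
    qed (use \<open>restr (F i) 1 = 1\<close> in auto)
  qed
  moreover have "?P i \<subset> ?P (Suc i)" if "i < m" for i
  proof
    have "F (Suc i) \<subseteq> F i" using strict that by blast
    show "?P i \<subseteq> ?P (Suc i)"
    proof
      fix p assume p: "p \<in> ?P i"
      have "restr (F (Suc i)) p = restr (F (Suc i)) (restr (F i) p)"
        using \<open>F (Suc i) \<subseteq> F i\<close> by (intro poly_mapping_eqI) (auto simp: lookup_restr when_def)
      also have "\<dots> = 0" using p by simp
      finally show "p \<in> ?P (Suc i)" using p by simp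
    qed
    obtain a where a: "a \<in> F i" "a \<notin> F (Suc i)" using strict \<open>i < m\<close> by blast
    have sub0: "F i \<subseteq> F 0" if "i \<le> m" for i
      using that
    proof (induction i)
      case (Suc i)
      then show ?case using strict[of i] by auto
    qed simp
    have "a \<in> S" using a sub0[of i] \<open>i < m\<close> assms(4) by auto
    have "single a (1::'k) \<noteq> 0"
      by (metis lookup_single_eq lookup_zero one_neq_zero)
    then have "single a 1 \<in> ?P (Suc i)" "single a 1 \<notin> ?P i"
      using a \<open>a \<in> S\<close> by (simp_all add: restr_single)
    then show "?P i \<noteq> ?P (Suc i)" by blast
  qed
  ultimately show ?thesis by (rule krull_dim_geI)
qed

section \<open>Growth of the quotients by prime ideals\<close>

definition deg_le :: "nat \<Rightarrow> 'm set" where "deg_le k = {a \<in> S. deg a \<le> k}"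

definition independent_mod ::
    "('m \<Rightarrow>\<^sub>0 'k::field) set \<Rightarrow> nat \<Rightarrow> (nat \<Rightarrow> 'm \<Rightarrow>\<^sub>0 'k) \<Rightarrow> bool" where
  "independent_mod Q N b \<longleftrightarrow> (\<forall>c. (\<Sum>j<N. single 0 (c j) * b j) \<in> Q \<longrightarrow> (\<forall>j<N. c j = 0))"

text \<open>Bounds the dimension of the image of the degree \<le> k part in K[S]/Q. Independent
  families stand in for that dimension, so no quotient space is formed.\<close>

definition growth_le :: "('m \<Rightarrow>\<^sub>0 'k::field) set \<Rightarrow> nat \<Rightarrow> nat \<Rightarrow> bool" where
  "growth_le Q C D \<longleftrightarrow> (\<forall>k N b. (\<forall>j<N. keys (b j) \<subseteq> deg_le k) \<longrightarrow> independent_mod Q N b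
      \<longrightarrow> N \<le> C * (k + 1) ^ D)"

lemma finite_deg_le: "finite (deg_le k)"
proof -
  have "deg_le k = (\<Union>i\<le>k. {a \<in> S. deg a = i})" by (auto simp: deg_le_def)
  then show ?thesis using finite_deg by simp
qed

lemma growth_le_if_card_le:
  assumes "0 \<in> Q" "\<And>k. card (deg_le k) \<le> C * (k + 1) ^ D"
  shows "growth_le (Q :: ('m \<Rightarrow>\<^sub>0 'k::field) set) C D"
  unfolding growth_le_def
proof (intro allI impI)
  fix k N and b :: "nat \<Rightarrow> 'm \<Rightarrow>\<^sub>0 'k"
  assume b: "\<forall>j<N. keys (b j) \<subseteq> deg_le k" "independent_mod Q N b"
  have "N \<le> card (deg_le k)"
  proof (rule ccontr)
    assume "\<not> N \<le> card (deg_le k)"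
    then have "\<exists>c. (\<Sum>j<N. single 0 (c j) * b j) = 0 \<and> (\<exists>j<N. c j \<noteq> 0)"
      using b(1) by (intro linear_relation_exists[OF finite_deg_le[of k]]) simp_all
    then obtain c where c: "(\<Sum>j<N. single 0 (c j) * b j) = 0" "\<exists>j<N. c j \<noteq> 0" by blast
    have "(\<Sum>j<N. single 0 (c j) * b j) \<in> Q" unfolding c(1) by (rule assms(1))
    then show False using b(2) c(2) unfolding independent_mod_def by blast
  qed
  then show "N \<le> C * (k + 1) ^ D" using assms(2)[of k] by linarith
qed

text \<open>If \<open>f\<close> lies in \<open>Q'\<close> but not in \<open>Q\<close>, then the powers of \<open>f\<close> are independent over any family
  that is independent modulo \<open>Q'\<close>; so the growth drops by one power of \<open>k\<close>.\<close>

lemma powers_independent: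
  fixes Q Q' :: "('m \<Rightarrow>\<^sub>0 'k::field) set"
  assumes Q: "primeideal Q (monoid_ring S)" and Q': "primeideal Q' (monoid_ring S)"
    and sub: "Q \<subseteq> Q'" and f: "f \<in> Q'" "f \<notin> Q"
    and b: "\<And>j. j < N \<Longrightarrow> keys (b j) \<subseteq> S" "independent_mod Q' N b"
    and rel: "(\<Sum>i<n. f ^ i * (\<Sum>j<N. single 0 (c i j) * b j)) \<in> Q"
  shows "\<forall>i<n. \<forall>j<N. c i j = 0"
  using rel
proof (induction n arbitrary: c)
  case (Suc n)
  note Qr = Q[unfolded primeideal_monoid_ring_iff]
  note Qr' = Q'[unfolded primeideal_monoid_ring_iff]
  have add: "p + q \<in> Q'" if "p \<in> Q'" "q \<in> Q'" for p q using Qr' that by blast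
  have mult: "r * p \<in> Q'" if "p \<in> Q'" "keys r \<subseteq> S" for p r using Qr' that by blast
  have prime: "q \<in> Q" if "p * q \<in> Q" "keys p \<subseteq> S" "keys q \<subseteq> S" "p \<notin> Q" for p q
    using Qr that by blast
  let ?g = "\<lambda>i. \<Sum>j<N. single 0 (c i j) * b j"
  let ?r = "\<Sum>i<n. f ^ i * ?g (Suc i)"
  have keys_sumS: "keys (\<Sum>i\<in>I. p i) \<subseteq> S" if "\<And>i. i \<in> I \<Longrightarrow> keys (p i) \<subseteq> S"
    for p :: "nat \<Rightarrow> 'm \<Rightarrow>\<^sub>0 'k" and I
    using keys_sum[of p I] that by blast
  have gS: "keys (?g i) \<subseteq> S" for i
    using b(1) zero_mem by (intro keys_sumS keys_mult_S) auto
  have fS: "keys f \<subseteq> S" using Qr' f by blast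
  have fpS: "keys (f ^ i) \<subseteq> S" for i
    by (induction i) (simp_all add: fS zero_mem keys_mult_S)
  have rS: "keys ?r \<subseteq> S" by (intro keys_sumS keys_mult_S fpS gS)
  \<comment> \<open>Modulo Q' only the term without f survives, so the independence of
    \<open>b\<close> kills \<open>c 0\<close>. What remains is a multiple of f, and primality of Q
    divides out f.\<close>
  have sum: "(\<Sum>i<Suc n. f ^ i * ?g i) = ?g 0 + f * ?r"
    unfolding sum.lessThan_Suc_shift by (simp add: sum_distrib_left mult.assoc)
  then have "?g 0 + f * ?r \<in> Q'" using Suc.prems sub by auto
  moreover have "(- ?r) * f \<in> Q'" using rS by (intro mult f(1)) simp
  ultimately have "(?g 0 + f * ?r) + (- ?r) * f \<in> Q'" by (rule add)
  then have "?g 0 \<in> Q'" by (simp add: mult.commute)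
  then have c0: "\<forall>j<N. c 0 j = 0" using b(2) unfolding independent_mod_def by blast
  then have "f * ?r \<in> Q" using Suc.prems sum by simp
  then have "?r \<in> Q" using fS rS f(2) by (rule prime)
  from Suc.IH[OF this] show ?case using c0 by (auto simp: less_Suc_eq_0_disj)
qed simp

text \<open>If f has degree at most e, the products f^i * b_j with i \<le> k have degree at most ke
  + k. Their number (k + 1) * N is then bounded by a constant times (k + 1)^D, and cancelling k + 1
  lowers the exponent.\<close>

lemma growth_le_step:
  fixes Q Q' :: "('m \<Rightarrow>\<^sub>0 'k::field) set"
  assumes Q: "primeideal Q (monoid_ring S)" and Q': "primeideal Q' (monoid_ring S)"
    and sub: "Q \<subset> Q'" and growth: "growth_le Q C D"
  shows "0 < D \<and> (\<exists>C'. growth_le Q' C' (D - 1))"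
proof -
  obtain f where f: "f \<in> Q'" "f \<notin> Q" using sub by blast
  have fS: "keys f \<subseteq> S" using Q' f unfolding primeideal_monoid_ring_iff by blast
  obtain e where e: "keys f \<subseteq> deg_le e"
  proof
    show "keys f \<subseteq> deg_le (\<Sum>a\<in>keys f. deg a)"
      using fS by (auto simp: deg_le_def intro: member_le_sum)
  qed
  have mult_le: "keys (p * q) \<subseteq> deg_le (i + j)"
    if "keys p \<subseteq> deg_le i" "keys q \<subseteq> deg_le j" for p q :: "'m \<Rightarrow>\<^sub>0 'k" and i j
    using that by (rule keys_mult_subset) (auto simp: deg_le_def add_mem deg_add)
  have pow: "keys (f ^ i) \<subseteq> deg_le (i * e)" for i
    by (induction i) (use mult_le[OF e] zero_mem in \<open>auto simp: deg_le_def\<close>)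
  have main: "(k + 1) * N \<le> C * (e + 1) ^ D * (k + 1) ^ D"
    if b: "\<And>j. j < N \<Longrightarrow> keys (b j) \<subseteq> deg_le k" "independent_mod Q' N b" for k N b
  proof -
    \<comment> \<open>The double family f^i * b_j with i \<le> k and j < N, listed as l = i * N +
      j.\<close>
    let ?b = "\<lambda>l. f ^ (l div N) * b (l mod N)"
    have "keys (?b l) \<subseteq> deg_le (k * e + k)" if "l < (k + 1) * N" for l
    proof -
      have "N > 0" using that by (cases N) auto
      then have "l div N \<le> k" "l mod N < N"
        using that by (auto simp: less_mult_imp_div_less less_Suc_eq_le[symmetric])
      have "keys (?b l) \<subseteq> deg_le (l div N * e + k)"
        using mult_le[OF pow b(1)] \<open>l mod N < N\<close> by blast
      also have "\<dots> \<subseteq> deg_le (k * e + k)"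
        using \<open>l div N \<le> k\<close> by (auto simp: deg_le_def intro: order_trans)
      finally show ?thesis .
    qed
    moreover have "independent_mod Q ((k + 1) * N) ?b"
      unfolding independent_mod_def
    proof (intro allI impI)
      fix c l assume rel: "(\<Sum>l<(k + 1) * N. single 0 (c l) * ?b l) \<in> Q" and l: "l < (k + 1) * N"
      then have "N > 0" by (cases N) auto
      have "(\<Sum>l<(k + 1) * N. single 0 (c l) * ?b l)
          = (\<Sum>i<k + 1. \<Sum>l = i * N..<i * N + N. single 0 (c l) * ?b l)"
        by (rule sum.nat_group[symmetric])
      also have "\<dots> = (\<Sum>i<k + 1. f ^ i * (\<Sum>j<N. single 0 (c (i * N + j)) * b j))"
      proof (intro sum.cong refl)
        fix i
        have "(\<Sum>l = i * N..<i * N + N. single 0 (c l) * ?b l)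
            = (\<Sum>j<N. single 0 (c (i * N + j)) * ?b (i * N + j))"
          using sum.shift_bounds_nat_ivl[of "\<lambda>l. single 0 (c l) * ?b l" 0 "i * N" N]
          by (simp add: atLeast0LessThan add.commute)
        also have "\<dots> = (\<Sum>j<N. f ^ i * (single 0 (c (i * N + j)) * b j))"
          using \<open>N > 0\<close> by (intro sum.cong refl) (simp add: mult.left_commute)
        finally show "(\<Sum>l = i * N..<i * N + N. single 0 (c l) * ?b l)
            = f ^ i * (\<Sum>j<N. single 0 (c (i * N + j)) * b j)"
          by (simp add: sum_distrib_left)
      qed
      finally have "(\<Sum>i<k + 1. f ^ i * (\<Sum>j<N. single 0 (c (i * N + j)) * b j)) \<in> Q"
        using rel by simp
      then have "\<forall>i<k + 1. \<forall>j<N. c (i * N + j) = 0"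
        using b by (intro powers_independent[OF Q Q' _ f]) (use sub in \<open>auto simp: deg_le_def\<close>)
      moreover have "l div N < k + 1" "l mod N < N" "l = l div N * N + l mod N"
        using l \<open>N > 0\<close> by (simp_all add: less_mult_imp_div_less)
      ultimately show "c l = 0" by metis
    qed
    ultimately have "(k + 1) * N \<le> C * (k * e + k + 1) ^ D"
      using growth[unfolded growth_le_def, rule_format, of "(k + 1) * N" ?b "k * e + k"] by blast
    also have "\<dots> \<le> C * ((e + 1) * (k + 1)) ^ D"
      by (intro mult_left_mono power_mono) (auto simp: algebra_simps)
    finally show ?thesis by (simp only: power_mult_distrib mult.assoc)
  qed
  have "D \<noteq> 0"
  proof
    assume "D = 0"
    have "independent_mod Q' 1 (\<lambda>_. 1)"
      unfolding independent_mod_def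
    proof (intro allI impI)
      fix c :: "nat \<Rightarrow> 'k" and j :: nat
      assume c: "(\<Sum>j<1. single 0 (c j) * 1) \<in> Q'" and "j < 1"
      show "c j = 0"
      proof (rule ccontr)
        assume "c j \<noteq> 0"
        then have "single 0 (inverse (c 0)) * single 0 (c 0) = (1 :: 'm \<Rightarrow>\<^sub>0 'k)"
          using \<open>j < 1\<close> by (simp add: mult_single)
        moreover have "single 0 (c 0) \<in> Q'" using c by simp
        then have "single 0 (inverse (c 0)) * single 0 (c 0) \<in> Q'"
          using Q'[unfolded primeideal_monoid_ring_iff] zero_mem by auto
        ultimately show False using Q'[unfolded primeideal_monoid_ring_iff] by auto
      qed
    qed
    \<comment> \<open>For D = 0 the family consisting of 1 alone, taken with k = C, would give C + 1
      \<le> C.\<close>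
    from main[OF _ this, of C] \<open>D = 0\<close> show False using zero_mem by (auto simp: deg_le_def)
  qed
  moreover have "growth_le Q' (C * (e + 1) ^ D) (D - 1)"
    unfolding growth_le_def
  proof (intro allI impI)
    fix k N and b :: "nat \<Rightarrow> 'm \<Rightarrow>\<^sub>0 'k"
    assume "\<forall>j<N. keys (b j) \<subseteq> deg_le k" "independent_mod Q' N b"
    then have "(k + 1) * N \<le> C * (e + 1) ^ D * (k + 1) ^ D" using main by blast
    also have "\<dots> = (k + 1) * (C * (e + 1) ^ D * (k + 1) ^ (D - 1))"
      using \<open>D \<noteq> 0\<close> by (cases D) (simp_all add: algebra_simps)
    finally show "N \<le> C * (e + 1) ^ D * (k + 1) ^ (D - 1)" by (subst (asm) mult_le_cancel1) simp
  qed
  ultimately show ?thesis by blast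
qed

lemma krull_dim_monoid_ring_le:
  assumes "\<And>k. card (deg_le k) \<le> C * (k + 1) ^ D"
  shows "krull_dim (monoid_ring S :: ('m \<Rightarrow>\<^sub>0 'k::field) ring) \<le> enat D"
proof (rule krull_dim_leI)
  fix m and P :: "nat \<Rightarrow> ('m \<Rightarrow>\<^sub>0 'k) set"
  assume P: "\<And>i. i \<le> m \<Longrightarrow> primeideal (P i) (monoid_ring S)" "\<And>i. i < m \<Longrightarrow> P i \<subset> P (Suc i)"
  have "i \<le> D \<and> (\<exists>C. growth_le (P i) C (D - i))" if "i \<le> m" for i
    using that
  proof (induction i)
    case 0
    have "0 \<in> P 0" using P(1)[of 0] unfolding primeideal_monoid_ring_iff by blast
    then show ?case using growth_le_if_card_le[OF _ assms] by auto
  next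
    case (Suc i)
    then obtain C where "i \<le> D" "growth_le (P i) C (D - i)" by auto
    moreover have "primeideal (P i) (monoid_ring S)" "primeideal (P (Suc i)) (monoid_ring S)" "P i \<subset> P (Suc i)"
      using P Suc.prems by auto
    ultimately have "0 < D - i" "\<exists>C'. growth_le (P (Suc i)) C' (D - i - 1)"
      using growth_le_step by blast+
    then show ?case by simp
  qed
  then show "enat m \<le> enat D" by simp
qed

end

section \<open>Localization of a domain\<close>

text \<open>Since \<theta> embeds the record \<open>R\<close> into a typed domain and sends
  \<open>U\<close> to nonzero elements, the classes that make up \<open>localization R U\<close> can
  be replaced by honest elements of the type \<open>fract\<close>.\<close>

locale localized_domain =
  fixes R :: "('a, 'x) ring_scheme" and U :: "'a set" and \<theta> :: "'a \<Rightarrow> 'd::idom"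
  assumes cring_R: "cring R"
    and inj_\<theta>: "inj_on \<theta> (carrier R)"
    and \<theta>_add: "a \<in> carrier R \<Longrightarrow> b \<in> carrier R \<Longrightarrow> \<theta> (a \<oplus>\<^bsub>R\<^esub> b) = \<theta> a + \<theta> b"
    and \<theta>_mult: "a \<in> carrier R \<Longrightarrow> b \<in> carrier R \<Longrightarrow> \<theta> (a \<otimes>\<^bsub>R\<^esub> b) = \<theta> a * \<theta> b"
    and \<theta>_zero: "\<theta> \<zero>\<^bsub>R\<^esub> = 0" and \<theta>_one: "\<theta> \<one>\<^bsub>R\<^esub> = 1"
    and U_subset: "U \<subseteq> carrier R" and one_U: "\<one>\<^bsub>R\<^esub> \<in> U"
    and mult_U: "s \<in> U \<Longrightarrow> t \<in> U \<Longrightarrow> s \<otimes>\<^bsub>R\<^esub> t \<in> U"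
    and \<theta>_U: "s \<in> U \<Longrightarrow> \<theta> s \<noteq> 0"
begin

sublocale R: cring R by (rule cring_R)

definition pairs :: "'d fract \<Rightarrow> ('a \<times> 'a) set" where
  "pairs x = {(b, t). b \<in> carrier R \<and> t \<in> U \<and> Fract (\<theta> b) (\<theta> t) = x}"

text \<open>All pairs in a class have the same quotient, so the image is a singleton.\<close>

definition fract_of :: "('a \<times> 'a) set \<Rightarrow> 'd fract" where
  "fract_of X = the_elem ((\<lambda>(a, s). Fract (\<theta> a) (\<theta> s)) ` X)"

lemma U_carrier: "s \<in> U \<Longrightarrow> s \<in> carrier R"
  using U_subset by blast

text \<open>In a domain the multiplier \<open>u\<close> of \<open>fraction\<close> cancels, so the
  classes are the fibres of the map taking (b, t) to b/t.\<close>

lemma fraction_eq_pairs: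
  assumes "a \<in> carrier R" "s \<in> U"
  shows "fraction R U a s = pairs (Fract (\<theta> a) (\<theta> s))"
proof -
  have "(\<exists>u\<in>U. u \<otimes>\<^bsub>R\<^esub> (t \<otimes>\<^bsub>R\<^esub> a) = u \<otimes>\<^bsub>R\<^esub> (s \<otimes>\<^bsub>R\<^esub> b)) \<longleftrightarrow> Fract (\<theta> b) (\<theta> t) = Fract (\<theta> a) (\<theta> s)"
    if bt: "b \<in> carrier R" "t \<in> U" for b t
  proof -
    have carr: "t \<in> carrier R" "s \<in> carrier R" using U_carrier assms bt by auto
    have eq: "Fract (\<theta> b) (\<theta> t) = Fract (\<theta> a) (\<theta> s) \<longleftrightarrow> \<theta> (t \<otimes>\<^bsub>R\<^esub> a) = \<theta> (s \<otimes>\<^bsub>R\<^esub> b)"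
      using assms bt carr by (auto simp: eq_fract \<theta>_U \<theta>_mult mult.commute)
    have "u \<otimes>\<^bsub>R\<^esub> (t \<otimes>\<^bsub>R\<^esub> a) = u \<otimes>\<^bsub>R\<^esub> (s \<otimes>\<^bsub>R\<^esub> b) \<longleftrightarrow> \<theta> (t \<otimes>\<^bsub>R\<^esub> a) = \<theta> (s \<otimes>\<^bsub>R\<^esub> b)" if u: "u \<in> U" for u
    proof -
      have "u \<otimes>\<^bsub>R\<^esub> (t \<otimes>\<^bsub>R\<^esub> a) = u \<otimes>\<^bsub>R\<^esub> (s \<otimes>\<^bsub>R\<^esub> b)
          \<longleftrightarrow> \<theta> (u \<otimes>\<^bsub>R\<^esub> (t \<otimes>\<^bsub>R\<^esub> a)) = \<theta> (u \<otimes>\<^bsub>R\<^esub> (s \<otimes>\<^bsub>R\<^esub> b))"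
        using inj_on_eq_iff[OF inj_\<theta>] assms bt carr U_carrier[OF u] by simp
      also have "\<dots> \<longleftrightarrow> \<theta> (t \<otimes>\<^bsub>R\<^esub> a) = \<theta> (s \<otimes>\<^bsub>R\<^esub> b)"
        using assms bt carr U_carrier[OF u] \<theta>_U[OF u] by (simp add: \<theta>_mult[of u])
      finally show ?thesis .
    qed
    then show ?thesis using eq one_U by blast
  qed
  then show ?thesis unfolding fraction_def pairs_def by blast
qed

definition fracs :: "'d fract set" where
  "fracs = {Fract (\<theta> a) (\<theta> s) | a s. a \<in> carrier R \<and> s \<in> U}"

lemma fracsE:
  assumes "x \<in> fracs"
  obtains a s where "a \<in> carrier R" "s \<in> U" "x = Fract (\<theta> a) (\<theta> s)"
  using assms unfolding fracs_def by blast

lemma fract_of_pairs: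
  assumes "x \<in> fracs"
  shows "fract_of (pairs x) = x"
proof -
  have "(\<lambda>(a, s). Fract (\<theta> a) (\<theta> s)) ` pairs x = {x}"
    using assms by (force simp: pairs_def elim: fracsE)
  then show ?thesis by (simp add: fract_of_def)
qed

lemma carrier_localization: "carrier (localization R U) = pairs ` fracs"
proof -
  have "carrier (localization R U) = {fraction R U a s | a s. a \<in> carrier R \<and> s \<in> U}"
    by (simp add: localization_def)
  also have "\<dots> = (\<lambda>(a, s). fraction R U a s) ` (carrier R \<times> U)" by auto
  also have "\<dots> = (\<lambda>(a, s). pairs (Fract (\<theta> a) (\<theta> s))) ` (carrier R \<times> U)"
    by (rule image_cong) (auto simp: fraction_eq_pairs)
  also have "\<dots> = pairs ` (\<lambda>(a, s). Fract (\<theta> a) (\<theta> s)) ` (carrier R \<times> U)"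
    by (simp add: image_image case_prod_unfold)
  also have "(\<lambda>(a, s). Fract (\<theta> a) (\<theta> s)) ` (carrier R \<times> U) = fracs"
    by (auto simp: fracs_def)
  finally show ?thesis .
qed

lemma inj_fract_of: "inj_on fract_of (carrier (localization R U))"
  unfolding carrier_localization by (rule inj_onI) (auto simp: fract_of_pairs)

lemma image_fract_of: "fract_of ` carrier (localization R U) = fracs"
  unfolding carrier_localization image_image by (simp add: fract_of_pairs)

lemma add_pairs:
  assumes "x \<in> fracs" "y \<in> fracs"
  shows "x + y \<in> fracs" "pairs x \<oplus>\<^bsub>localization R U\<^esub> pairs y = pairs (x + y)"
proof -
  have add: "fraction R U (t \<otimes>\<^bsub>R\<^esub> a \<oplus>\<^bsub>R\<^esub> s \<otimes>\<^bsub>R\<^esub> b) (s \<otimes>\<^bsub>R\<^esub> t) = pairs (x + y) \<and> x + y \<in> fracs"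
    if "(a, s) \<in> pairs x" "(b, t) \<in> pairs y" for a s b t
  proof -
    have ab: "a \<in> carrier R" "s \<in> U" "b \<in> carrier R" "t \<in> U"
      "x = Fract (\<theta> a) (\<theta> s)" "y = Fract (\<theta> b) (\<theta> t)"
      using that by (auto simp: pairs_def)
    then have "x + y = Fract (\<theta> (t \<otimes>\<^bsub>R\<^esub> a \<oplus>\<^bsub>R\<^esub> s \<otimes>\<^bsub>R\<^esub> b)) (\<theta> (s \<otimes>\<^bsub>R\<^esub> t))"
      using U_carrier by (simp add: \<theta>_U \<theta>_add \<theta>_mult mult.commute)
    moreover have "t \<otimes>\<^bsub>R\<^esub> a \<oplus>\<^bsub>R\<^esub> s \<otimes>\<^bsub>R\<^esub> b \<in> carrier R" "s \<otimes>\<^bsub>R\<^esub> t \<in> U"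
      using ab U_carrier mult_U by auto
    ultimately show ?thesis
      unfolding fracs_def by (auto simp: fraction_eq_pairs)
  qed
  \<comment> \<open>All terms of the double union agree, but the union equals their common value
    only over nonempty classes; hence these witnesses.\<close>
  obtain a s where as: "(a, s) \<in> pairs x" using assms(1) by (auto simp: pairs_def elim: fracsE)
  obtain b t where bt: "(b, t) \<in> pairs y" using assms(2) by (auto simp: pairs_def elim: fracsE)
  show "x + y \<in> fracs" using add[OF as bt] by blast
  have "pairs x \<oplus>\<^bsub>localization R U\<^esub> pairs y = (\<Union>(a, s)\<in>pairs x. \<Union>(b, t)\<in>pairs y.
      fraction R U (t \<otimes>\<^bsub>R\<^esub> a \<oplus>\<^bsub>R\<^esub> s \<otimes>\<^bsub>R\<^esub> b) (s \<otimes>\<^bsub>R\<^esub> t))"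
    by (simp add: localization_def)
  also have "\<dots> = pairs (x + y)"
  proof (rule SUP_eq_const)
    fix as assume "as \<in> pairs x"
    then show "(case as of (a, s) \<Rightarrow> \<Union>(b, t)\<in>pairs y. fraction R U (t \<otimes>\<^bsub>R\<^esub> a \<oplus>\<^bsub>R\<^esub> s \<otimes>\<^bsub>R\<^esub> b) (s \<otimes>\<^bsub>R\<^esub> t)) = pairs (x + y)"
      using add bt by (cases as) (auto intro!: SUP_eq_const)
  qed (use as in blast)
  finally show "pairs x \<oplus>\<^bsub>localization R U\<^esub> pairs y = pairs (x + y)" .
qed

lemma mult_pairs:
  assumes "x \<in> fracs" "y \<in> fracs"
  shows "x * y \<in> fracs" "pairs x \<otimes>\<^bsub>localization R U\<^esub> pairs y = pairs (x * y)"
proof -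
  have mult: "fraction R U (a \<otimes>\<^bsub>R\<^esub> b) (s \<otimes>\<^bsub>R\<^esub> t) = pairs (x * y) \<and> x * y \<in> fracs"
    if "(a, s) \<in> pairs x" "(b, t) \<in> pairs y" for a s b t
  proof -
    have ab: "a \<in> carrier R" "s \<in> U" "b \<in> carrier R" "t \<in> U"
      "x = Fract (\<theta> a) (\<theta> s)" "y = Fract (\<theta> b) (\<theta> t)"
      using that by (auto simp: pairs_def)
    then have "x * y = Fract (\<theta> (a \<otimes>\<^bsub>R\<^esub> b)) (\<theta> (s \<otimes>\<^bsub>R\<^esub> t))"
      using U_carrier by (simp add: \<theta>_mult)
    moreover have "a \<otimes>\<^bsub>R\<^esub> b \<in> carrier R" "s \<otimes>\<^bsub>R\<^esub> t \<in> U"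
      using ab mult_U by auto
    ultimately show ?thesis
      unfolding fracs_def by (auto simp: fraction_eq_pairs)
  qed
  obtain a s where as: "(a, s) \<in> pairs x" using assms(1) by (auto simp: pairs_def elim: fracsE)
  obtain b t where bt: "(b, t) \<in> pairs y" using assms(2) by (auto simp: pairs_def elim: fracsE)
  show "x * y \<in> fracs" using mult[OF as bt] by blast
  have "pairs x \<otimes>\<^bsub>localization R U\<^esub> pairs y = (\<Union>(a, s)\<in>pairs x. \<Union>(b, t)\<in>pairs y.
      fraction R U (a \<otimes>\<^bsub>R\<^esub> b) (s \<otimes>\<^bsub>R\<^esub> t))"
    by (simp add: localization_def)
  also have "\<dots> = pairs (x * y)"
  proof (rule SUP_eq_const)
    fix as assume "as \<in> pairs x"
    then show "(case as of (a, s) \<Rightarrow> \<Union>(b, t)\<in>pairs y. fraction R U (a \<otimes>\<^bsub>R\<^esub> b) (s \<otimes>\<^bsub>R\<^esub> t)) = pairs (x * y)"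
      using mult bt by (cases as) (auto intro!: SUP_eq_const)
  qed (use as in blast)
  finally show "pairs x \<otimes>\<^bsub>localization R U\<^esub> pairs y = pairs (x * y)" .
qed

lemma zero_pairs: "0 \<in> fracs" "\<zero>\<^bsub>localization R U\<^esub> = pairs 0"
proof -
  have "Fract (\<theta> \<zero>\<^bsub>R\<^esub>) (\<theta> \<one>\<^bsub>R\<^esub>) = 0" by (simp add: \<theta>_zero \<theta>_one fract_collapse)
  then show "0 \<in> fracs" "\<zero>\<^bsub>localization R U\<^esub> = pairs 0"
    using one_U fraction_eq_pairs[of "\<zero>\<^bsub>R\<^esub>" "\<one>\<^bsub>R\<^esub>"] R.zero_closed
    by (auto simp: fracs_def localization_def; metis)+
qed

lemma one_pairs: "1 \<in> fracs" "\<one>\<^bsub>localization R U\<^esub> = pairs 1"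
proof -
  have "Fract (\<theta> \<one>\<^bsub>R\<^esub>) (\<theta> \<one>\<^bsub>R\<^esub>) = 1" by (simp add: \<theta>_one fract_collapse)
  then show "1 \<in> fracs" "\<one>\<^bsub>localization R U\<^esub> = pairs 1"
    using one_U fraction_eq_pairs[of "\<one>\<^bsub>R\<^esub>" "\<one>\<^bsub>R\<^esub>"] R.one_closed
    by (auto simp: fracs_def localization_def; metis)+
qed

lemma fract_of_add:
  assumes "X \<in> carrier (localization R U)" "Y \<in> carrier (localization R U)"
  shows "X \<oplus>\<^bsub>localization R U\<^esub> Y \<in> carrier (localization R U)
    \<and> fract_of (X \<oplus>\<^bsub>localization R U\<^esub> Y) = fract_of X + fract_of Y"
  using assms unfolding carrier_localization by (auto simp: add_pairs fract_of_pairs)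

lemma fract_of_mult:
  assumes "X \<in> carrier (localization R U)" "Y \<in> carrier (localization R U)"
  shows "X \<otimes>\<^bsub>localization R U\<^esub> Y \<in> carrier (localization R U)
    \<and> fract_of (X \<otimes>\<^bsub>localization R U\<^esub> Y) = fract_of X * fract_of Y"
  using assms unfolding carrier_localization by (auto simp: mult_pairs fract_of_pairs)

lemma fract_of_constants:
  "\<zero>\<^bsub>localization R U\<^esub> \<in> carrier (localization R U)" "fract_of \<zero>\<^bsub>localization R U\<^esub> = 0"
  "\<one>\<^bsub>localization R U\<^esub> \<in> carrier (localization R U)" "fract_of \<one>\<^bsub>localization R U\<^esub> = 1"
  by (simp_all add: carrier_localization zero_pairs one_pairs fract_of_pairs)

end

section \<open>The toric monoid\<close>

text \<open>The exponent of \<Prod>_j y_(j, \<alpha>_j). The pair is encoded as one natural number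
  so that the variables are linearly ordered, which gives the exponents the order required by
  \<open>graded_monoid\<close>.\<close>

definition ix_expo :: "nat list \<Rightarrow> nat \<Rightarrow>\<^sub>0 nat" where
  "ix_expo \<alpha> = (\<Sum>j<length \<alpha>. single (prod_encode (j, \<alpha> ! j)) 1)"

definition toric_expo :: "nat list list \<Rightarrow> nat \<Rightarrow>\<^sub>0 nat" where
  "toric_expo xs = (\<Sum>\<alpha>\<leftarrow>xs. ix_expo \<alpha>)"

lemma toric_expo_simps [simp]:
  "toric_expo [] = 0" "toric_expo (\<alpha> # xs) = ix_expo \<alpha> + toric_expo xs"
  "toric_expo (xs @ ys) = toric_expo xs + toric_expo ys"
  by (simp_all add: toric_expo_def)

lemma lookup_ix_expo:
  "lookup (ix_expo \<alpha>) (prod_encode (j, i)) = (if j < length \<alpha> \<and> \<alpha> ! j = i then 1 else 0)"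
proof -
  have "lookup (ix_expo \<alpha>) (prod_encode (j, i)) = (\<Sum>j'<length \<alpha>. if j' = j then (if \<alpha> ! j = i then 1 else 0) else 0)"
    unfolding ix_expo_def lookup_sum
    by (intro sum.cong refl) (auto simp: lookup_single when_def)
  then show ?thesis by simp
qed

lemma lookup_toric_expo:
  assumes "\<And>\<alpha>. \<alpha> \<in> set xs \<Longrightarrow> length \<alpha> = d" "j < d"
  shows "lookup (toric_expo xs) (prod_encode (j, i)) = count_list (map (\<lambda>\<alpha>. \<alpha> ! j) xs) i"
  using assms by (induction xs) (auto simp: lookup_add lookup_ix_expo)

lemma sum_lookup_add:
  fixes e e' :: "'a \<Rightarrow>\<^sub>0 nat"
  shows "(\<Sum>v\<in>keys (e + e'). lookup (e + e') v) = (\<Sum>v\<in>keys e. lookup e v) + (\<Sum>v\<in>keys e'. lookup e' v)"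
  using setsum_keys_plus_distrib[of "\<lambda>_ v. v" e e'] by (simp add: lookup_add)

text \<open>Each \<open>ix_expo \<alpha>\<close> with \<alpha> of length d has total degree d, so
  the quotient counts the factors.\<close>

definition toric_deg :: "nat \<Rightarrow> (nat \<Rightarrow>\<^sub>0 nat) \<Rightarrow> nat" where
  "toric_deg d e = (\<Sum>v\<in>keys e. lookup e v) div d"

lemma toric_deg_expo:
  assumes "\<And>\<alpha>. \<alpha> \<in> set xs \<Longrightarrow> length \<alpha> = d" "1 \<le> d"
  shows "toric_deg d (toric_expo xs) = length xs"
proof -
  have sum: "(\<Sum>v\<in>keys (\<Sum>j<k. single (f j) (1::nat)). lookup (\<Sum>j<k. single (f j) 1) v) = k"
    for k and f :: "nat \<Rightarrow> nat"
    by (induction k) (simp_all add: sum_lookup_add)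
  have "(\<Sum>v\<in>keys (toric_expo xs). lookup (toric_expo xs) v) = length xs * d"
    using assms(1) by (induction xs) (auto simp: sum_lookup_add ix_expo_def sum[unfolded One_nat_def])
  then show ?thesis using assms(2) by (simp add: toric_deg_def)
qed

section \<open>Straightening to multichains\<close>

lemma length_join_meet [simp]:
  "length (join_ix \<alpha> \<beta>) = min (length \<alpha>) (length \<beta>)" "length (meet_ix \<alpha> \<beta>) = min (length \<alpha>) (length \<beta>)"
  by (simp_all add: join_ix_def meet_ix_def)

lemma nth_join_meet [simp]:
  assumes "i < length \<alpha>" "i < length \<beta>"
  shows "join_ix \<alpha> \<beta> ! i = max (\<alpha> ! i) (\<beta> ! i)" "meet_ix \<alpha> \<beta> ! i = min (\<alpha> ! i) (\<beta> ! i)"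
  using assms by (simp_all add: join_ix_def meet_ix_def)

lemma join_meet_mem:
  assumes "\<alpha> \<in> index_set d n" "\<beta> \<in> index_set d n"
  shows "join_ix \<alpha> \<beta> \<in> index_set d n" "meet_ix \<alpha> \<beta> \<in> index_set d n"
proof -
  have lt: "\<alpha> ! i < \<alpha> ! j" "\<beta> ! i < \<beta> ! j" if "i < j" "j < d" for i j
    using assms that by (auto simp: index_set_iff)
  have bd: "1 \<le> \<alpha> ! i" "\<alpha> ! i \<le> n" "1 \<le> \<beta> ! i" "\<beta> ! i \<le> n" if "i < d" for i
    using assms that by (auto simp: index_set_iff)
  have len: "length \<alpha> = d" "length \<beta> = d" using assms by (auto simp: index_set_iff)
  have "max (\<alpha> ! i) (\<beta> ! i) < max (\<alpha> ! j) (\<beta> ! j)" "min (\<alpha> ! i) (\<beta> ! i) < min (\<alpha> ! j) (\<beta> ! j)"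
    if "i < j" "j < d" for i j
    using lt[OF that] by linarith+
  then show "join_ix \<alpha> \<beta> \<in> index_set d n" "meet_ix \<alpha> \<beta> \<in> index_set d n"
    unfolding index_set_iff using len bd by (auto simp: le_max_iff_disj min_le_iff_disj)
qed

lemma ix_expo_join_meet:
  assumes "length \<alpha> = length \<beta>"
  shows "ix_expo (join_ix \<alpha> \<beta>) + ix_expo (meet_ix \<alpha> \<beta>) = ix_expo \<alpha> + ix_expo \<beta>"
proof -
  have "ix_expo (join_ix \<alpha> \<beta>) + ix_expo (meet_ix \<alpha> \<beta>)
      = (\<Sum>j<length \<beta>. single (prod_encode (j, max (\<alpha> ! j) (\<beta> ! j))) 1 + single (prod_encode (j, min (\<alpha> ! j) (\<beta> ! j))) 1)"
    using assms by (simp add: ix_expo_def sum.distrib)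
  also have "\<dots> = (\<Sum>j<length \<beta>. single (prod_encode (j, \<alpha> ! j)) 1 + single (prod_encode (j, \<beta> ! j)) 1)"
    by (intro sum.cong refl) (auto simp: max_def min_def add.commute)
  finally show ?thesis using assms by (simp add: ix_expo_def sum.distrib)
qed

text \<open>Insertion sort in all coordinates at once; each step replaces two indices by their join and
  meet, which is exactly an application of one of the binomials.\<close>

fun chain_insert :: "nat list \<Rightarrow> nat list list \<Rightarrow> nat list list" where
  "chain_insert \<alpha> [] = [\<alpha>]"
| "chain_insert \<alpha> (\<gamma> # xs) = join_ix \<alpha> \<gamma> # chain_insert (meet_ix \<alpha> \<gamma>) xs"

definition straighten :: "nat list list \<Rightarrow> nat list list" where
  "straighten xs = foldr chain_insert xs []"

abbreviation descending :: "nat list list \<Rightarrow> bool" where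
  "descending \<equiv> sorted_wrt (\<lambda>x y. ix_le y x)"

lemma chain_insert_props:
  assumes "\<alpha> \<in> index_set d n" "set xs \<subseteq> index_set d n"
  shows "set (chain_insert \<alpha> xs) \<subseteq> index_set d n" "length (chain_insert \<alpha> xs) = Suc (length xs)"
    "toric_expo (chain_insert \<alpha> xs) = ix_expo \<alpha> + toric_expo xs"
proof -
  have "set (chain_insert \<alpha> xs) \<subseteq> index_set d n \<and> length (chain_insert \<alpha> xs) = Suc (length xs)
      \<and> toric_expo (chain_insert \<alpha> xs) = ix_expo \<alpha> + toric_expo xs"
    using assms
  proof (induction xs arbitrary: \<alpha>)
    case (Cons \<gamma> xs)
    then have "length \<alpha> = length \<gamma>" by (auto simp: index_set_iff)
    then show ?case
      using Cons.IH[of "meet_ix \<alpha> \<gamma>"] Cons.prems join_meet_mem[of \<alpha> d n \<gamma>]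
      by (simp add: ix_expo_join_meet flip: add.assoc)
  qed simp
  then show "set (chain_insert \<alpha> xs) \<subseteq> index_set d n" "length (chain_insert \<alpha> xs) = Suc (length xs)"
    "toric_expo (chain_insert \<alpha> xs) = ix_expo \<alpha> + toric_expo xs" by auto
qed

text \<open>Taking the join with the head preserves any common upper bound. Applied to the tail,
  this shows that the new head dominates everything behind it.\<close>

lemma chain_insert_le:
  assumes "\<alpha> \<in> index_set d n" "set xs \<subseteq> index_set d n" "ix_le \<alpha> \<beta>" "\<And>\<gamma>. \<gamma> \<in> set xs \<Longrightarrow> ix_le \<gamma> \<beta>"
  shows "\<forall>\<gamma>\<in>set (chain_insert \<alpha> xs). ix_le \<gamma> \<beta>"
  using assms
proof (induction xs arbitrary: \<alpha>)
  case (Cons \<gamma> xs)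
  have "ix_le (join_ix \<alpha> \<gamma>) \<beta>" "ix_le (meet_ix \<alpha> \<gamma>) \<beta>"
    using Cons.prems by (auto simp: list_all2_conv_all_nth min_le_iff_disj)
  then show ?case using Cons.IH[of "meet_ix \<alpha> \<gamma>"] Cons.prems join_meet_mem[of \<alpha> d n \<gamma>] by auto
qed simp

lemma descending_chain_insert:
  assumes "\<alpha> \<in> index_set d n" "set xs \<subseteq> index_set d n" "descending xs"
  shows "descending (chain_insert \<alpha> xs)"
  using assms
proof (induction xs arbitrary: \<alpha>)
  case (Cons \<gamma> xs)
  have mem: "meet_ix \<alpha> \<gamma> \<in> index_set d n" using Cons.prems join_meet_mem by auto
  have len: "length \<alpha> = d" "length \<gamma> = d" using Cons.prems by (auto simp: index_set_iff)
  have "ix_le (meet_ix \<alpha> \<gamma>) (join_ix \<alpha> \<gamma>)" "ix_le \<gamma> (join_ix \<alpha> \<gamma>)"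
    using len by (auto simp: list_all2_conv_all_nth)
  then have "\<forall>\<delta>\<in>set (chain_insert (meet_ix \<alpha> \<gamma>) xs). ix_le \<delta> (join_ix \<alpha> \<gamma>)"
    using Cons.prems mem by (intro chain_insert_le) (auto intro: ix_le_trans)
  then show ?case using Cons mem by simp
qed simp

lemma straighten_props:
  assumes "set xs \<subseteq> index_set d n"
  shows "set (straighten xs) \<subseteq> index_set d n" "length (straighten xs) = length xs"
    "toric_expo (straighten xs) = toric_expo xs" "descending (straighten xs)"
proof -
  have "set (straighten xs) \<subseteq> index_set d n \<and> length (straighten xs) = length xs
    \<and> toric_expo (straighten xs) = toric_expo xs \<and> descending (straighten xs)"
    using assms
  proof (induction xs)
    case (Cons \<alpha> xs)
    then show ?case
      using chain_insert_props[of \<alpha> d n "straighten xs"] descending_chain_insert[of \<alpha> d n "straighten xs"]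
      by (simp add: straighten_def)
  qed (simp add: straighten_def)
  then show "set (straighten xs) \<subseteq> index_set d n" "length (straighten xs) = length xs"
    "toric_expo (straighten xs) = toric_expo xs" "descending (straighten xs)" by auto
qed

text \<open>The exponent records, for every position j, the multiset of j-th entries. In a
  descending list these entries are sorted, and a sorted list is determined by its multiset;
  position 0 also fixes the length.\<close>

lemma toric_expo_inj_descending:
  assumes "1 \<le> d" "set xs \<subseteq> index_set d n" "set ys \<subseteq> index_set d n" "descending xs" "descending ys"
    and eq: "toric_expo xs = toric_expo ys"
  shows "xs = ys"
proof -
  have len: "length \<alpha> = d" if "\<alpha> \<in> set xs \<union> set ys" for \<alpha>
    using assms(2,3) that by (auto simp: index_set_iff)
  have col: "map (\<lambda>\<alpha>. \<alpha> ! j) xs = map (\<lambda>\<alpha>. \<alpha> ! j) ys" if "j < d" for j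
  proof -
    have sorted: "sorted (rev (map (\<lambda>\<alpha>. \<alpha> ! j) zs))"
      if "descending zs" "\<And>\<alpha>. \<alpha> \<in> set zs \<Longrightarrow> length \<alpha> = d" for zs
    proof -
      have "sorted_wrt (\<lambda>x y. y ! j \<le> x ! j) zs"
        by (rule sorted_wrt_mono_rel[OF _ that(1)])
           (use that(2) \<open>j < d\<close> in \<open>auto simp: list_all2_conv_all_nth\<close>)
      then show ?thesis by (simp add: sorted_wrt_map sorted_wrt_rev)
    qed
    have "count_list (map (\<lambda>\<alpha>. \<alpha> ! j) xs) i = count_list (map (\<lambda>\<alpha>. \<alpha> ! j) ys) i" for i
      using lookup_toric_expo[of xs d j i] lookup_toric_expo[of ys d j i] len eq that by simp
    then have "mset (rev (map (\<lambda>\<alpha>. \<alpha> ! j) xs)) = mset (rev (map (\<lambda>\<alpha>. \<alpha> ! j) ys))"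
      by (intro multiset_eqI) (simp only: mset_rev count_mset)
    then have "rev (map (\<lambda>\<alpha>. \<alpha> ! j) xs) = rev (map (\<lambda>\<alpha>. \<alpha> ! j) ys)"
      using sorted[OF assms(4)] sorted[OF assms(5)] len by (metis UnCI properties_for_sort)
    then show ?thesis by simp
  qed
  have lens: "length xs = length ys" using map_eq_imp_length_eq[OF col[of 0]] assms(1) by simp
  show ?thesis
  proof (rule nth_equalityI[OF lens])
    fix i assume i: "i < length xs"
    show "xs ! i = ys ! i"
    proof (rule nth_equalityI)
      show "length (xs ! i) = length (ys ! i)" using i lens len by (metis UnCI nth_mem)
      fix j assume "j < length (xs ! i)"
      then have "j < d" using i len by (metis UnCI nth_mem)
      then have "map (\<lambda>\<alpha>. \<alpha> ! j) xs ! i = map (\<lambda>\<alpha>. \<alpha> ! j) ys ! i" using col by simp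
      then show "xs ! i ! j = ys ! i ! j" using i lens by simp
    qed
  qed
qed

definition toric_monoid :: "nat \<Rightarrow> nat \<Rightarrow> (nat \<Rightarrow>\<^sub>0 nat) set" where
  "toric_monoid d n = toric_expo ` {xs. set xs \<subseteq> index_set d n}"

lemma toric_monoidE:
  assumes "e \<in> toric_monoid d n"
  obtains xs where "e = toric_expo xs" "set xs \<subseteq> index_set d n"
  using assms by (auto simp: toric_monoid_def)

lemma toric_deg_expo':
  assumes "1 \<le> d" "set xs \<subseteq> index_set d n"
  shows "toric_deg d (toric_expo xs) = length xs"
  using assms by (intro toric_deg_expo) (auto simp: index_set_iff)

lemma toric_monoid_deg_eq:
  assumes "1 \<le> d"
  shows "{e \<in> toric_monoid d n. toric_deg d e = k}
       = toric_expo ` {xs. set xs \<subseteq> index_set d n \<and> length xs = k \<and> descending xs}"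
proof (intro equalityI subsetI)
  fix e assume "e \<in> {e \<in> toric_monoid d n. toric_deg d e = k}"
  then obtain xs where "e = toric_expo xs" "set xs \<subseteq> index_set d n" "length xs = k"
    using toric_deg_expo'[OF assms] by (auto elim: toric_monoidE)
  then show "e \<in> toric_expo ` {xs. set xs \<subseteq> index_set d n \<and> length xs = k \<and> descending xs}"
    using straighten_props[of xs d n] by (intro image_eqI[of _ _ "straighten xs"]) auto
qed (use toric_deg_expo'[OF assms] in \<open>auto simp: toric_monoid_def\<close>)

lemma graded_monoid_toric:
  assumes "1 \<le> d"
  shows "graded_monoid (toric_monoid d n) (toric_deg d)"
proof
  show "0 \<in> toric_monoid d n" unfolding toric_monoid_def by (rule image_eqI[of _ _ "[]"]) auto
  fix a b assume a: "a \<in> toric_monoid d n" and "b \<in> toric_monoid d n"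
  then obtain xs ys where *: "a = toric_expo xs" "set xs \<subseteq> index_set d n"
    "b = toric_expo ys" "set ys \<subseteq> index_set d n" by (meson toric_monoidE)
  then have "a + b = toric_expo (xs @ ys)" "set (xs @ ys) \<subseteq> index_set d n" by auto
  then show "a + b \<in> toric_monoid d n" unfolding toric_monoid_def by blast
  show "toric_deg d (a + b) = toric_deg d a + toric_deg d b"
    using toric_deg_expo'[OF assms, of "xs @ ys" n] * toric_deg_expo'[OF assms] by simp
next
  fix a assume "a \<in> toric_monoid d n" "toric_deg d a = 0"
  then show "a = 0" using toric_deg_expo'[OF assms] by (auto elim!: toric_monoidE)
next
  fix k
  have "finite {xs. set xs \<subseteq> index_set d n \<and> length xs = k}"
    by (rule finite_lists_length_eq[OF finite_index_set])
  then show "finite {a \<in> toric_monoid d n. toric_deg d a = k}"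
    unfolding toric_monoid_deg_eq[OF assms] by (intro finite_imageI) (rule rev_finite_subset, auto)
next
  fix a k assume "a \<in> toric_monoid d n" "toric_deg d a = Suc k"
  then obtain \<alpha> xs where "a = toric_expo (\<alpha> # xs)" "set (\<alpha> # xs) \<subseteq> index_set d n" "length xs = k"
    using toric_deg_expo'[OF assms] by (auto elim!: toric_monoidE simp: length_Suc_conv)
  then have "a = toric_expo xs + toric_expo [\<alpha>]" "set xs \<subseteq> index_set d n" "set [\<alpha>] \<subseteq> index_set d n"
    "length xs = k" by (auto simp: add.commute)
  then show "\<exists>b\<in>toric_monoid d n. \<exists>c\<in>toric_monoid d n. a = b + c \<and> toric_deg d b = k \<and> toric_deg d c = 1"
    using toric_deg_expo'[OF assms, of xs n] toric_deg_expo'[OF assms, of "[\<alpha>]" n]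
    unfolding toric_monoid_def
    by (intro bexI[of _ "toric_expo xs"] bexI[of _ "toric_expo [\<alpha>]"] conjI imageI CollectI) simp_all
qed

section \<open>The top index and a maximal chain\<close>

definition top_ix :: "nat \<Rightarrow> nat \<Rightarrow> nat list" where
  "top_ix d n = map (\<lambda>i. n - d + i + 1) [0..<d]"

lemma top_ix_mem: "d \<le> n \<Longrightarrow> top_ix d n \<in> index_set d n"
  by (auto simp: top_ix_def index_set_iff)

lemma ix_le_top:
  assumes "\<alpha> \<in> index_set d n"
  shows "ix_le \<alpha> (top_ix d n)"
proof -
  have len: "length \<alpha> = d" using assms by (auto simp: index_set_iff)
  have "\<alpha> ! i \<le> n - d + i + 1" if "i < d" for i
    using that
  proof (induction "d - i" arbitrary: i)
    case (Suc k)
    show ?case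
    proof (cases "Suc i < d")
      case True
      then have "\<alpha> ! Suc i \<le> n - d + Suc i + 1" using Suc by (intro Suc.hyps) auto
      moreover have "\<alpha> ! i < \<alpha> ! Suc i" using assms True by (auto simp: index_set_iff)
      ultimately show ?thesis by linarith
    next
      case False
      then show ?thesis using assms Suc.prems by (auto simp: index_set_iff)
    qed
  qed simp
  then show ?thesis using len by (auto simp: list_all2_conv_all_nth top_ix_def)
qed

lemma ix_rank_top: "ix_rank (top_ix d n) = d * (n - d)"
  by (simp add: ix_rank_def top_ix_def)

text \<open>Every element of degree k has exactly one multichain of length k as its normal form.
  Being bounded by \<open>top_ix\<close> is automatic for its members.\<close>

lemma card_toric_deg:
  assumes "1 \<le> d"
  shows "card {e \<in> toric_monoid d n. toric_deg d e = k} = card (multichains d n k (top_ix d n))"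
proof -
  have "{xs. set xs \<subseteq> index_set d n \<and> length xs = k \<and> descending xs} = multichains d n k (top_ix d n)"
    using ix_le_top by (auto simp: multichains_def)
  moreover have "inj_on toric_expo {xs. set xs \<subseteq> index_set d n \<and> length xs = k \<and> descending xs}"
    using toric_expo_inj_descending[OF assms] by (auto intro!: inj_onI)
  ultimately show ?thesis
    unfolding toric_monoid_deg_eq[OF assms] by (simp add: card_image)
qed

text \<open>A maximal chain in closed form, from the bottom index at t = 0 to the top index at t =
  d(n - d). Passing from t to t + 1 raises one entry by 1, with the positions taken cyclically from
  the last to the first.\<close>

definition max_chain :: "nat \<Rightarrow> nat \<Rightarrow> nat list" where
  "max_chain d t = map (\<lambda>j. j + 1 + (t + j) div d) [0..<d]"

lemma max_chain_mem:
  assumes "d \<le> n" "t \<le> d * (n - d)"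
  shows "max_chain d t \<in> index_set d n"
proof -
  have "i + 1 + (t + i) div d \<le> n" if "i < d" for i
  proof -
    have "t + i < d * (n - d + 1)" using assms that by simp
    then have "(t + i) div d < n - d + 1" using that by (simp add: less_mult_imp_div_less mult.commute)
    then show ?thesis using assms that by simp
  qed
  moreover have "i + (t + i) div d < j + (t + j) div d" if "i < j" for i j
    using that div_le_mono[of "t + i" "t + j" d] by linarith
  ultimately show ?thesis by (auto simp: max_chain_def index_set_iff)
qed

lemma max_chain_mono: "t \<le> t' \<Longrightarrow> j < d \<Longrightarrow> max_chain d t ! j \<le> max_chain d t' ! j"
  by (simp add: max_chain_def div_le_mono)

lemma max_chain_strict:
  assumes "1 \<le> d"
  shows "\<exists>j<d. max_chain d t ! j < max_chain d (Suc t) ! j"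
proof -
  \<comment> \<open>The position at which t + j is congruent to d - 1 modulo d, so that the quotient
    jumps at the next t.\<close>
  define j where "j = (d - 1) - t mod d"
  have "t mod d < d" using assms by simp
  have tq: "t = d * (t div d) + t mod d" by simp
  have "t + j = d * (t div d) + (d - 1)" unfolding j_def using \<open>t mod d < d\<close> by (subst (1) tq) linarith
  moreover from this have "Suc t + j = d * (t div d + 1)" using assms by simp
  moreover have "(d * (t div d) + (d - 1)) div d = t div d"
    using assms by (intro div_nat_eqI) simp_all
  moreover have "(d * (t div d + 1)) div d = t div d + 1" using assms by (subst nonzero_mult_div_cancel_left) auto
  ultimately have "(t + j) div d < (Suc t + j) div d" by (simp only:)
  moreover have "j < d" using assms by (simp add: j_def)
  ultimately show ?thesis by (intro exI[of _ j]) (simp add: max_chain_def)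
qed

section \<open>The coordinate ring\<close>

definition power_product :: "('v \<Rightarrow> 'k::comm_ring_1) \<Rightarrow> ('v \<Rightarrow>\<^sub>0 nat) \<Rightarrow> 'k" where
  "power_product x m = (\<Prod>v\<in>keys m. x v ^ lookup m v)"

lemma power_product_superset:
  assumes "finite A" "keys m \<subseteq> A"
  shows "power_product x m = (\<Prod>v\<in>A. x v ^ lookup m v)"
  unfolding power_product_def using assms
  by (intro prod.mono_neutral_left) (auto simp: in_keys_iff)

lemma power_product_0 [simp]: "power_product x 0 = 1"
  by (simp add: power_product_def)

lemma power_product_add: "power_product x (m + m') = power_product x m * power_product x m'"
proof -
  let ?A = "keys m \<union> keys m'"
  have "power_product x (m + m') = (\<Prod>v\<in>?A. x v ^ lookup (m + m') v)"
    by (rule power_product_superset) (simp_all add: keys_add)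
  also have "\<dots> = (\<Prod>v\<in>?A. x v ^ lookup m v) * (\<Prod>v\<in>?A. x v ^ lookup m' v)"
    by (simp add: lookup_add power_add prod.distrib)
  also have "\<dots> = power_product x m * power_product x m'"
    by (simp add: power_product_superset[of ?A])
  finally show ?thesis .
qed

lemma power_product_single: "power_product x (single v k) = x v ^ k"
  by (simp add: power_product_def)

lemma power_product_mult: "power_product (\<lambda>v. x v * y v) m = power_product x m * power_product y m"
  by (simp add: power_product_def power_mult_distrib prod.distrib)

lemma eval_at_power_product: "eval_at x p = (\<Sum>m\<in>keys p. lookup p m * power_product x m)"
  by (simp add: eval_at_def power_product_def)

lemma eval_at_add: "eval_at x (p + q) = eval_at x p + eval_at x q"
  unfolding eval_at_power_product by (rule setsum_keys_plus_distrib) (auto simp: distrib_right)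

lemma eval_at_single: "eval_at x (single m c) = c * power_product x m"
  by (cases "c = 0") (simp_all add: eval_at_power_product)

lemma eval_at_diff: "eval_at x (p - q) = eval_at x p - eval_at x q"
  using eval_at_add[of x "p - q" q] by simp

text \<open>The weight \<open>g\<close> is arbitrary because it serves twice: for evaluation at a
  point of the torus coordinates, and for a weight obtained by choice.\<close>

lemma sum_push:
  fixes p :: "'a \<Rightarrow>\<^sub>0 'k::comm_ring_1"
  shows "(\<Sum>e\<in>keys (push f p). lookup (push f p) e * g e) = (\<Sum>m\<in>keys p. lookup p m * g (f m))"
proof -
  have "keys p \<subseteq> UNIV" by simp
  then show ?thesis
  proof (induction rule: keys_induct)
    case (add m c p)
    have *: "(\<Sum>e\<in>keys (q + r). lookup (q + r) e * k e)
        = (\<Sum>e\<in>keys q. lookup q e * k e) + (\<Sum>e\<in>keys r. lookup r e * k e)"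
      for q r :: "'z \<Rightarrow>\<^sub>0 'k" and k
      by (rule setsum_keys_plus_distrib) (auto simp: distrib_right)
    show ?case
      unfolding push_add push_single by (subst setsum_keys_plus_distrib, simp, simp add: distrib_right,
         subst setsum_keys_plus_distrib, simp, simp add: distrib_right, simp add: add.IH)
  qed simp
qed

text \<open>Dedekind's argument: comparing the relation at \<open>z * y\<close> with \<open>\<chi> e\<^sub>0 z\<close> times the relation at
  \<open>y\<close> eliminates \<open>\<chi> e\<^sub>0\<close>.\<close>

lemma characters_independent:
  fixes \<chi> :: "'e \<Rightarrow> 'y \<Rightarrow> 'k::field"
  assumes "finite E" and mult: "\<And>e y z. \<chi> e (op y z) = \<chi> e y * \<chi> e z"
    and one: "\<And>e. \<chi> e u = 1"
    and distinct: "\<And>e e'. e \<in> E \<Longrightarrow> e' \<in> E \<Longrightarrow> e \<noteq> e' \<Longrightarrow> \<exists>z. \<chi> e z \<noteq> \<chi> e' z"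
    and rel: "\<And>y. (\<Sum>e\<in>E. c e * \<chi> e y) = 0"
  shows "\<forall>e\<in>E. c e = 0"
  using assms(1) distinct rel
proof (induction E arbitrary: c rule: finite_induct)
  case (insert e0 E)
  have "c e * (\<chi> e z - \<chi> e0 z) = 0" if "e \<in> E" for e z
  proof -
    have "(\<Sum>e\<in>E. c e * (\<chi> e z - \<chi> e0 z) * \<chi> e y) = 0" for y
    proof -
      have 1: "c e0 * \<chi> e0 (op z y) + (\<Sum>e\<in>E. c e * \<chi> e (op z y)) = 0"
        using insert.prems(2)[of "op z y"] insert.hyps by simp
      have 2: "c e0 * \<chi> e0 y + (\<Sum>e\<in>E. c e * \<chi> e y) = 0"
        using insert.prems(2)[of y] insert.hyps by simp
      have "(\<Sum>e\<in>E. c e * (\<chi> e z - \<chi> e0 z) * \<chi> e y)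
          = (\<Sum>e\<in>E. c e * \<chi> e (op z y)) - \<chi> e0 z * (\<Sum>e\<in>E. c e * \<chi> e y)"
        by (simp add: mult sum_distrib_left sum_subtractf algebra_simps)
      also have "\<dots> = - (c e0 * \<chi> e0 (op z y)) - \<chi> e0 z * (- (c e0 * \<chi> e0 y))"
        using 1 2 by (simp only: add_eq_0_iff)
      also have "\<dots> = 0" by (simp add: mult algebra_simps)
      finally show ?thesis .
    qed
    then have "\<forall>e\<in>E. c e * (\<chi> e z - \<chi> e0 z) = 0"
      using insert.prems(1) by (intro insert.IH) auto
    then show ?thesis using that by blast
  qed
  then have cE: "\<forall>e\<in>E. c e = 0"
    using insert.prems(1)[of _ e0] insert.hyps by (metis insertCI mult_eq_0_iff right_minus_eq)
  then have "c e0 * \<chi> e0 u = 0" using insert.prems(2)[of u] insert.hyps by simp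
  then show ?case using cE one by simp
qed simp

text \<open>Algebraic closedness enters here: over an infinite field distinct monomials are distinct
  functions, in every characteristic.\<close>

lemma infinite_alg_closed: "infinite (UNIV :: 'k::alg_closed_field set)"
proof
  assume fin: "finite (UNIV :: 'k set)"
  let ?p = "(\<Prod>a\<in>UNIV. [:- a, 1:]) + 1 :: 'k poly"
  have "poly ?p x = 1" for x
    using fin by (simp add: poly_prod)
  moreover have "Polynomial.degree ?p > 0"
  proof -
    have "Polynomial.degree (\<Prod>a\<in>UNIV. [:- a, 1:] :: 'k poly) = card (UNIV :: 'k set)"
      by (subst degree_prod_eq_sum_degree) auto
    moreover have "card (UNIV :: 'k set) > 0" using fin by (simp add: card_gt_0_iff)
    ultimately show ?thesis by (subst degree_add_eq_left) auto
  qed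
  ultimately show False using alg_closed_imp_poly_has_root[of ?p] by auto
qed

lemma powers_distinct:
  assumes "a \<noteq> b"
  shows "\<exists>t::'k::alg_closed_field. t ^ a \<noteq> t ^ b"
proof (rule ccontr)
  assume "\<not> ?thesis"
  then have eq: "t ^ a = t ^ b" for t :: 'k by blast
  define q :: "'k poly" where "q = Polynomial.monom 1 a - Polynomial.monom 1 b"
  have "Polynomial.coeff q a \<noteq> 0" using assms by (simp add: q_def)
  then have "q \<noteq> 0" by auto
  moreover have "{x. poly q x = 0} = UNIV" using eq by (simp add: q_def poly_monom)
  ultimately show False using poly_roots_finite[of q] infinite_alg_closed[where 'k='k] by simp
qed

text \<open>Monomials are characters of the multiplicative monoid of all points. Two different
  exponents are separated by a point with a suitable value t in one coordinate and 1 in all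
  others.\<close>

lemma eval_at_eq_0_imp_eq_0:
  fixes q :: "('v, 'k::alg_closed_field) mpoly"
  assumes "\<And>y. eval_at y q = 0"
  shows "q = 0"
proof -
  have "\<forall>e\<in>keys q. lookup q e = 0"
  proof (rule characters_independent[where \<chi> = "\<lambda>e y. power_product y e" and op = "\<lambda>y z v. y v * z v" and u = "\<lambda>_. 1"])
    fix e e' :: "'v \<Rightarrow>\<^sub>0 nat" assume "e \<noteq> e'"
    then obtain v where v: "lookup e v \<noteq> lookup e' v" by (meson poly_mapping_eqI)
    then obtain t :: 'k where t: "t ^ lookup e v \<noteq> t ^ lookup e' v" using powers_distinct by blast
    have "power_product (\<lambda>w. if w = v then t else 1) m = t ^ lookup m v" for m
    proof -
      have "power_product (\<lambda>w. if w = v then t else 1) m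
          = (\<Prod>w\<in>insert v (keys m). if w = v then t ^ lookup m v else 1)"
        by (rule trans[OF power_product_superset[of "insert v (keys m)"] prod.cong]) auto
      then show ?thesis by (simp add: prod.delta)
    qed
    then show "\<exists>z::'v \<Rightarrow> 'k. power_product z e \<noteq> power_product z e'"
      using t by (intro exI[of _ "\<lambda>w. if w = v then t else 1"]) simp
  next
    show "(\<Sum>e\<in>keys q. lookup q e * power_product y e) = 0" for y
      using assms[of y] by (simp only: eval_at_power_product)
    show "power_product (\<lambda>_. 1) e = (1 :: 'k)" for e :: "'v \<Rightarrow>\<^sub>0 nat"
      by (simp add: power_product_def)
  qed (simp_all add: power_product_mult)
  then show ?thesis by (intro poly_mapping_eqI) (auto simp: in_keys_iff)
qed

section \<open>The toric parametrization on exponents\<close>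

definition toric_map :: "(nat list \<Rightarrow>\<^sub>0 nat) \<Rightarrow> nat \<Rightarrow>\<^sub>0 nat" where
  "toric_map m = (\<Sum>\<alpha>\<in>keys m. \<Sum>_<lookup m \<alpha>. ix_expo \<alpha>)"

lemma toric_map_0 [simp]: "toric_map 0 = 0"
  by (simp add: toric_map_def)

lemma toric_map_add: "toric_map (m + m') = toric_map m + toric_map m'"
proof -
  have "(\<Sum>_<a + b. c) = (\<Sum>_<a. c) + (\<Sum>_<b. c)" for a b :: nat and c :: "nat \<Rightarrow>\<^sub>0 nat"
    by (induction b) (simp_all only: add_0_right add_Suc_right sum.lessThan_Suc lessThan_0 sum.empty add.assoc)
  then show ?thesis
    unfolding toric_map_def by (intro setsum_keys_plus_distrib) simp_all
qed

lemma toric_map_single: "toric_map (single \<alpha> 1) = ix_expo \<alpha>"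
  by (simp add: toric_map_def)

text \<open>Monomials as lists of variables, the form to which \<open>straighten\<close>
  applies.\<close>

definition list_monom :: "'v list \<Rightarrow> 'v \<Rightarrow>\<^sub>0 nat" where
  "list_monom xs = (\<Sum>v\<leftarrow>xs. single v 1)"

lemma list_monom_simps [simp]: "list_monom [] = 0" "list_monom (v # xs) = single v 1 + list_monom xs"
  by (simp_all add: list_monom_def)

lemma toric_map_list_monom: "toric_map (list_monom xs) = toric_expo xs"
  by (induction xs) (simp_all add: toric_map_add toric_map_single[unfolded One_nat_def])

lemma power_product_list_monom: "power_product x (list_monom xs) = (\<Prod>v\<leftarrow>xs. x v)"
  by (induction xs) (simp_all add: power_product_add power_product_single[of _ _ "Suc 0"])

lemma keys_list_monom: "keys (list_monom xs) = set xs"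
proof (induction xs)
  case (Cons v xs)
  show ?case by (auto simp: in_keys_iff lookup_add lookup_single when_def simp flip: Cons split: if_splits)
qed simp

lemma ex_list_monom:
  assumes "keys m \<subseteq> L"
  shows "\<exists>xs. set xs \<subseteq> L \<and> m = list_monom xs"
proof -
  have "\<exists>xs. m = list_monom xs"
  proof (induction "\<Sum>v\<in>keys m. lookup m v" arbitrary: m)
    case 0
    then have "\<forall>v\<in>keys m. lookup m v = 0" by simp
    then have "m = 0" by (intro poly_mapping_eqI) (auto simp: in_keys_iff)
    then have "m = list_monom []" by simp
    then show ?case by blast
  next
    case (Suc k)
    then obtain v where v: "v \<in> keys m" by (metis all_not_in_conv old.nat.distinct(2) sum.empty)
    define m' where "m' = m - single v 1"
    have m: "m = single v 1 + m'"
      using v by (intro poly_mapping_eqI) (auto simp: m'_def lookup_add lookup_minus lookup_single when_def in_keys_iff)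
    have "Suc k = 1 + (\<Sum>v\<in>keys m'. lookup m' v)"
      using Suc(2) sum_lookup_add[of "single v 1" m'] m by simp
    then obtain xs where "m' = list_monom xs" using Suc(1)[of m'] by auto
    then have "m = list_monom (v # xs)" using m by simp
    then show ?case by blast
  qed
  then show ?thesis using assms keys_list_monom by metis
qed

lemma poly_ring_eq_monoid_ring: "poly_ring I = monoid_ring {m. keys m \<subseteq> I}"
  by (auto simp: poly_ring_def monoid_ring_def)

lemma hibi_variety_iff:
  "x \<in> hibi_variety d n \<longleftrightarrow> x \<in> index_set d n \<rightarrow>\<^sub>E UNIV \<and>
    (\<forall>\<alpha>\<in>index_set d n. \<forall>\<beta>\<in>index_set d n. x \<alpha> * x \<beta> = x (join_ix \<alpha> \<beta>) * x (meet_ix \<alpha> \<beta>))"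
proof -
  have "eval_at x (var \<alpha> * var \<beta> - var (join_ix \<alpha> \<beta>) * var (meet_ix \<alpha> \<beta>))
      = x \<alpha> * x \<beta> - x (join_ix \<alpha> \<beta>) * x (meet_ix \<alpha> \<beta>)" for \<alpha> \<beta>
    by (simp add: var_def mult_single eval_at_diff eval_at_single power_product_add power_product_single[of _ _ "Suc 0"])
  then show ?thesis
    unfolding hibi_variety_def zero_locus_def affine_space_def hibi_binomials_def
    by (auto simp del: eval_at_diff) (metis eq_iff_diff_eq_0)
qed

text \<open>Each insertion step replaces two coordinates of the point by those of the join and the
  meet, whose product is the same on the variety.\<close>

lemma prod_straighten:
  fixes x :: "nat list \<Rightarrow> 'k::comm_ring_1"
  assumes "x \<in> hibi_variety d n" "set xs \<subseteq> index_set d n"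
  shows "(\<Prod>\<alpha>\<leftarrow>straighten xs. x \<alpha>) = (\<Prod>\<alpha>\<leftarrow>xs. x \<alpha>)"
proof -
  have ins: "(\<Prod>\<alpha>\<leftarrow>chain_insert \<alpha> xs. x \<alpha>) = x \<alpha> * (\<Prod>\<alpha>\<leftarrow>xs. x \<alpha>)"
    if "\<alpha> \<in> index_set d n" "set xs \<subseteq> index_set d n" for \<alpha> xs
    using that
  proof (induction xs arbitrary: \<alpha>)
    case (Cons \<gamma> xs)
    then have "(\<Prod>\<alpha>\<leftarrow>chain_insert \<alpha> (\<gamma> # xs). x \<alpha>)
        = x (join_ix \<alpha> \<gamma>) * x (meet_ix \<alpha> \<gamma>) * (\<Prod>\<alpha>\<leftarrow>xs. x \<alpha>)"
      using join_meet_mem[of \<alpha> d n \<gamma>] by (simp add: mult.assoc)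
    also have "x (join_ix \<alpha> \<gamma>) * x (meet_ix \<alpha> \<gamma>) = x \<alpha> * x \<gamma>"
      using assms(1) Cons.prems unfolding hibi_variety_iff by auto
    finally show ?case by (simp add: mult.assoc)
  qed simp
  show ?thesis using assms(2)
  proof (induction xs)
    case (Cons \<alpha> xs)
    then show ?case using ins[of \<alpha> "straighten xs"] straighten_props(1)[of xs d n] by (simp add: straighten_def)
  qed (simp add: straighten_def)
qed

text \<open>For one inclusion, every y parametrizes a point of the variety, so the substituted
  polynomial vanishes identically and is zero. For the other, the value of a monomial at any point
  of the variety depends only on its image under \<open>toric_map\<close>, by straightening and
  uniqueness of multichains; so evaluation factors through the substitution.\<close>

lemma vanishing_ideal_hibi:
  assumes "1 \<le> d"
  shows "vanishing_ideal (index_set d n) (hibi_variety d n :: (nat list \<Rightarrow> 'k::alg_closed_field) set)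
       = {p \<in> carrier (poly_ring (index_set d n)). push toric_map p = 0}"
proof (intro equalityI subsetI)
  let ?L = "index_set d n"
  fix p :: "(nat list, 'k) mpoly"
  assume "p \<in> vanishing_ideal ?L (hibi_variety d n)"
  then have p: "p \<in> carrier (poly_ring ?L)" "\<And>x. x \<in> hibi_variety d n \<Longrightarrow> eval_at x p = 0"
    by (auto simp: vanishing_ideal_def)
  have "eval_at y (push toric_map p) = 0" for y
  proof -
    define x where "x = (\<lambda>\<alpha>\<in>?L. power_product y (ix_expo \<alpha>))"
    have "x \<in> hibi_variety d n"
      unfolding hibi_variety_iff
    proof (intro conjI ballI)
      fix \<alpha> \<beta> assume \<alpha>\<beta>: "\<alpha> \<in> ?L" "\<beta> \<in> ?L"
      then have "length \<alpha> = length \<beta>" by (auto simp: index_set_iff)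
      then show "x \<alpha> * x \<beta> = x (join_ix \<alpha> \<beta>) * x (meet_ix \<alpha> \<beta>)"
        using \<alpha>\<beta> join_meet_mem[of \<alpha> d n \<beta>]
        by (simp add: x_def ix_expo_join_meet flip: power_product_add)
    qed (simp add: x_def)
    then have "0 = eval_at x p" using p by simp
    also have "\<dots> = (\<Sum>m\<in>keys p. lookup p m * power_product y (toric_map m))"
      unfolding eval_at_power_product
    proof (intro sum.cong refl arg_cong[of _ _ "\<lambda>z. _ * z"])
      fix m assume "m \<in> keys p"
      then have "keys m \<subseteq> ?L" using p(1) by (auto simp: poly_ring_def)
      then obtain xs where xs: "set xs \<subseteq> ?L" "m = list_monom xs" using ex_list_monom by blast
      have "(\<Prod>\<alpha>\<leftarrow>xs. x \<alpha>) = power_product y (toric_expo xs)"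
        using xs(1) by (induction xs) (auto simp: power_product_add x_def)
      then show "power_product x m = power_product y (toric_map m)"
        by (simp add: xs power_product_list_monom toric_map_list_monom)
    qed
    also have "\<dots> = eval_at y (push toric_map p)"
      unfolding eval_at_power_product by (rule sum_push[symmetric])
    finally show ?thesis by simp
  qed
  then show "p \<in> {p \<in> carrier (poly_ring ?L). push toric_map p = 0}"
    using p(1) eval_at_eq_0_imp_eq_0 by blast
next
  let ?L = "index_set d n"
  fix p :: "(nat list, 'k) mpoly"
  assume "p \<in> {p \<in> carrier (poly_ring ?L). push toric_map p = 0}"
  then have p: "p \<in> carrier (poly_ring ?L)" "push toric_map p = 0" by auto
  have "eval_at x p = 0" if x: "x \<in> hibi_variety d n" for x
  proof -
    \<comment> \<open>The common value at x of all monomials with image e. By \<open>indep\<close>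
      the choice of the monomial does not matter.\<close>
    define g where "g = (\<lambda>e. power_product x (SOME m. keys m \<subseteq> ?L \<and> toric_map m = e))"
    have indep: "power_product x m = power_product x m'"
      if m: "keys m \<subseteq> ?L" "keys m' \<subseteq> ?L" "toric_map m = toric_map m'" for m m'
    proof -
      obtain xs ys where *: "set xs \<subseteq> ?L" "m = list_monom xs" "set ys \<subseteq> ?L" "m' = list_monom ys"
        using ex_list_monom m by metis
      then have "toric_expo (straighten xs) = toric_expo (straighten ys)"
        using m by (simp add: toric_map_list_monom straighten_props)
      then have "straighten xs = straighten ys"
        using straighten_props[OF *(1)] straighten_props[OF *(3)]
        by (intro toric_expo_inj_descending[OF assms, of _ n]) simp_all
      then show ?thesis
        using prod_straighten[OF x] * by (simp add: power_product_list_monom) metis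
    qed
    have "eval_at x p = (\<Sum>m\<in>keys p. lookup p m * g (toric_map m))"
      unfolding eval_at_power_product
    proof (intro sum.cong refl arg_cong[of _ _ "\<lambda>z. _ * z"])
      fix m assume "m \<in> keys p"
      then have m: "keys m \<subseteq> ?L" using p(1) by (auto simp: poly_ring_def)
      then have "keys (SOME m'. keys m' \<subseteq> ?L \<and> toric_map m' = toric_map m) \<subseteq> ?L
          \<and> toric_map (SOME m'. keys m' \<subseteq> ?L \<and> toric_map m' = toric_map m) = toric_map m"
        by (intro someI[of "\<lambda>m'. keys m' \<subseteq> ?L \<and> toric_map m' = toric_map m" m]) simp
      then show "power_product x m = g (toric_map m)"
        unfolding g_def using m by (intro indep) auto
    qed
    also have "\<dots> = 0" using sum_push[of toric_map p g] p(2) by simp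
    finally show ?thesis .
  qed
  then show "p \<in> vanishing_ideal ?L (hibi_variety d n)"
    using p(1) by (simp add: vanishing_ideal_def)
qed

section \<open>The multiplicity\<close>

text \<open>The definite description needs uniqueness: two Hilbert polynomials agree at infinitely
  many integers and hence coincide, and the dimension fixes r.\<close>

lemma graded_degree_eqI:
  assumes dim: "krull_dim G = enat (r + 1)"
    and H: "\<And>k. poly H (of_nat k) = of_nat (hilbert_function G k)"
    and e: "lead_coeff H = e / fact r"
  shows "graded_degree G = e"
  unfolding graded_degree_def
proof (rule the_equality)
  have "is_hilbert_polynomial G H" unfolding is_hilbert_polynomial_def using H by blast
  then show "\<exists>r H. krull_dim G = enat (r + 1) \<and> is_hilbert_polynomial G H \<and> lead_coeff H = e / fact r"
    using dim e by blast
  fix e' assume "\<exists>r H. krull_dim G = enat (r + 1) \<and> is_hilbert_polynomial G H \<and> lead_coeff H = e' / fact r"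
  then obtain r' H' N where *: "krull_dim G = enat (r' + 1)" "lead_coeff H' = e' / fact r'"
    "\<And>k. k \<ge> N \<Longrightarrow> poly H' (of_nat k) = of_nat (hilbert_function G k)"
    unfolding is_hilbert_polynomial_def by blast
  have "r' = r" using dim * by simp
  have "infinite ((of_nat :: nat \<Rightarrow> rat) ` {N..})"
    using infinite_Ici[of N] by (subst finite_image_iff) (auto intro: inj_on_subset[OF inj_of_nat])
  moreover have "of_nat ` {N..} \<subseteq> {x. poly (H' - H) x = 0}" using H *(3) by auto
  ultimately have "H' - H = 0" using poly_roots_finite finite_subset by blast
  then have "e / fact r = e' / fact r" using e *(2) \<open>r' = r\<close> by simp
  then show "e' = e" by simp
qed

lemma krull_dim_toric:
  assumes "1 \<le> d" "d \<le> n"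
  shows "krull_dim (monoid_ring (toric_monoid d n) :: ((nat \<Rightarrow>\<^sub>0 nat) \<Rightarrow>\<^sub>0 'k::field) ring)
       = enat (d * (n - d) + 1)"
proof (rule antisym)
  interpret graded_monoid "toric_monoid d n" "toric_deg d" by (rule graded_monoid_toric[OF assms(1)])
  let ?r = "d * (n - d)"
  obtain p :: "rat poly" where p: "\<And>k. poly p (of_nat k) = of_nat (card (multichains d n k (top_ix d n)))" "Polynomial.degree p \<le> ?r"
    using multichain_polynomial[OF top_ix_mem[OF assms(2)]] unfolding ix_rank_top by blast
  obtain C where C: "\<And>k. poly p (of_nat k) \<le> of_nat (C * (k + 1) ^ ?r)"
    using poly_le_power[OF p(2)] by blast
  have "card {e \<in> toric_monoid d n. toric_deg d e = k} \<le> C * (k + 1) ^ ?r" for k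
    using C[of k] unfolding p card_toric_deg[OF assms(1)] of_nat_le_iff .
  note level = this
  \<comment> \<open>Adding up the degrees from 0 to k raises the exponent from the rank of the top
    index to that rank plus 1.\<close>
  have "card (deg_le k) \<le> C * (k + 1) ^ (?r + 1)" for k
  proof -
    have "deg_le k = (\<Union>i\<le>k. {e \<in> toric_monoid d n. toric_deg d e = i})" by (auto simp: deg_le_def)
    then have "card (deg_le k) \<le> (\<Sum>i\<le>k. card {e \<in> toric_monoid d n. toric_deg d e = i})"
      by (simp add: card_UN_le)
    also have "\<dots> \<le> (\<Sum>i\<le>k. C * (k + 1) ^ ?r)"
      by (intro sum_mono order_trans[OF level] mult_left_mono power_mono) auto
    finally show ?thesis by (simp add: mult_ac)
  qed
  then show "krull_dim (monoid_ring (toric_monoid d n) :: ((nat \<Rightarrow>\<^sub>0 nat) \<Rightarrow>\<^sub>0 'k) ring) \<le> enat (?r + 1)"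
    by (rule krull_dim_monoid_ring_le)
  \<comment> \<open>The elements whose variables stay below \<open>max_chain d t\<close> in every
    position. They form a face, because a sum of natural exponents is zero only if both are.\<close>
  define below where "below t = {e \<in> toric_monoid d n. \<forall>j<d. \<forall>v. v > max_chain d t ! j \<longrightarrow> lookup e (prod_encode (j, v)) = 0}" for t
  \<comment> \<open>The faces \<open>below ?r\<close>, ..., \<open>below 0\<close> account for
    \<open>?r\<close> inclusions. The last one comes from \<open>{0}\<close>, as
    \<open>below 0\<close> still contains the exponent of the bottom index.\<close>
  define F where "F i = (if i \<le> ?r then below (?r - i) else {0})" for i
  show "enat (?r + 1) \<le> krull_dim (monoid_ring (toric_monoid d n) :: ((nat \<Rightarrow>\<^sub>0 nat) \<Rightarrow>\<^sub>0 'k) ring)"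
  proof (rule krull_dim_monoid_ring_ge[where F = F])
    show "a + b \<in> F i \<longleftrightarrow> a \<in> F i \<and> b \<in> F i"
      if "a \<in> toric_monoid d n" "b \<in> toric_monoid d n" for i a b
      using that add_mem[OF that] by (auto simp: F_def below_def lookup_add add_eq_0_iff)
    show "0 \<in> F i" for i using zero_mem by (simp add: F_def below_def)
    show "F 0 \<subseteq> toric_monoid d n" by (auto simp: F_def below_def)
    \<comment> \<open>The exponent of \<open>max_chain d t\<close> witnesses strictness at each
      step; being nonzero, it does so at the final step to \<open>{0}\<close> as well.\<close>
    have chain: "toric_expo [max_chain d t] \<in> below t"
      "\<And>t'. t' < t \<Longrightarrow> toric_expo [max_chain d t] \<notin> below t'" "toric_expo [max_chain d t] \<noteq> 0"
      if t: "t \<le> ?r" for t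
    proof -
      have mem: "set [max_chain d t] \<subseteq> index_set d n" using max_chain_mem[OF assms(2) t] by simp
      have lk: "lookup (toric_expo [max_chain d t]) (prod_encode (j, v)) = (if v = max_chain d t ! j then 1 else 0)"
        if "j < d" for j v
        using that by (auto simp: lookup_ix_expo max_chain_def)
      show "toric_expo [max_chain d t] \<in> below t"
        using mem unfolding below_def toric_monoid_def by (auto simp: lk simp del: toric_expo_simps)
      have "toric_deg d (toric_expo [max_chain d t]) = 1"
        using toric_deg_expo'[OF assms(1) mem] by simp
      then show "toric_expo [max_chain d t] \<noteq> 0" by (metis deg_0 zero_neq_one)
      fix t' assume "t' < t"
      obtain j where j: "j < d" "max_chain d t' ! j < max_chain d (Suc t') ! j"
        using max_chain_strict[OF assms(1)] by blast
      moreover have "max_chain d (Suc t') ! j \<le> max_chain d t ! j"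
        using \<open>t' < t\<close> j by (intro max_chain_mono) auto
      ultimately have lt: "max_chain d t' ! j < max_chain d t ! j" by linarith
      have ne: "lookup (toric_expo [max_chain d t]) (prod_encode (j, max_chain d t ! j)) \<noteq> 0"
        unfolding lk[OF j(1)] by simp
      show "toric_expo [max_chain d t] \<notin> below t'"
      proof
        assume "toric_expo [max_chain d t] \<in> below t'"
        then have "\<forall>j<d. \<forall>v. v > max_chain d t' ! j \<longrightarrow> lookup (toric_expo [max_chain d t]) (prod_encode (j, v)) = 0"
          unfolding below_def mem_Collect_eq by (rule conjunct2)
        then show False using j(1) lt ne by metis
      qed
    qed
    fix i assume "i < ?r + 1"
    have "toric_expo [max_chain d (?r - i)] \<in> F i"
      using chain(1)[of "?r - i"] \<open>i < ?r + 1\<close> by (simp add: F_def del: toric_expo_simps)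
    moreover have "toric_expo [max_chain d (?r - i)] \<notin> F (Suc i)"
      using chain(2)[of "?r - i" "?r - Suc i"] chain(3)[of "?r - i"] \<open>i < ?r + 1\<close>
      by (auto simp: F_def simp del: toric_expo_simps)
    moreover have "below t' \<subseteq> below t" if "t' \<le> t" for t t'
      using max_chain_mono[OF that] unfolding below_def by (auto; meson le_less_trans)
    then have "F (Suc i) \<subseteq> F i"
      using \<open>i < ?r + 1\<close> zero_mem by (auto simp: F_def below_def)
    ultimately show "F (Suc i) \<subset> F i" by blast
  qed
qed

lemma cring_poly_ring: "cring (poly_ring I :: ('v, 'k::comm_ring_1) mpoly ring)"
  unfolding poly_ring_eq_monoid_ring
proof (rule cring_monoid_ring)
  fix a b :: "'v \<Rightarrow>\<^sub>0 nat" assume "a \<in> {m. keys m \<subseteq> I}" "b \<in> {m. keys m \<subseteq> I}"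
  then show "a + b \<in> {m. keys m \<subseteq> I}" using keys_add[of a b] by auto
qed simp

lemma push_toric_map_ring_hom:
  assumes "1 \<le> d"
  shows "ring_hom_ring (poly_ring (index_set d n)) (monoid_ring (toric_monoid d n))
           (push toric_map :: (nat list, 'k::comm_ring_1) mpoly \<Rightarrow> _)"
    and "(push toric_map :: (nat list, 'k) mpoly \<Rightarrow> _) ` carrier (poly_ring (index_set d n))
           = carrier (monoid_ring (toric_monoid d n))"
proof -
  interpret graded_monoid "toric_monoid d n" "toric_deg d" by (rule graded_monoid_toric[OF assms])
  let ?M = "{m :: nat list \<Rightarrow>\<^sub>0 nat. keys m \<subseteq> index_set d n}"
  have cring: "cring (monoid_ring ?M :: (nat list, 'k) mpoly ring)"
    using cring_poly_ring[of "index_set d n"] by (simp only: poly_ring_eq_monoid_ring)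
  have M: "toric_map m \<in> toric_monoid d n" if "m \<in> ?M" for m
    using ex_list_monom[of m "index_set d n"] that by (auto simp: toric_map_list_monom toric_monoid_def)
  have closed: "keys (push toric_map p) \<subseteq> toric_monoid d n" if "keys p \<subseteq> ?M" for p :: "(nat list, 'k) mpoly"
    using keys_push[of toric_map p] M that by blast
  have "push toric_map \<in> ring_hom (monoid_ring ?M) (monoid_ring (toric_monoid d n) :: (_ \<Rightarrow>\<^sub>0 'k) ring)"
  proof (rule ring_hom_memI)
    have "push toric_map 1 = push toric_map (single 0 (1::'k))" by simp
    then show "push toric_map \<one>\<^bsub>monoid_ring ?M\<^esub> = (\<one>\<^bsub>monoid_ring (toric_monoid d n)\<^esub> :: _ \<Rightarrow>\<^sub>0 'k)"
      unfolding push_single by simp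
  qed (use closed in \<open>simp_all add: push_add push_mult[of _ UNIV] toric_map_add\<close>)
  then show "ring_hom_ring (poly_ring (index_set d n)) (monoid_ring (toric_monoid d n))
           (push toric_map :: (nat list, 'k) mpoly \<Rightarrow> _)"
    unfolding poly_ring_eq_monoid_ring
    using cring cring_monoid_ring_S by (intro ring_hom_ringI2) (auto simp: cring_def)
  have surj: "\<exists>p. keys p \<subseteq> ?M \<and> push toric_map p = q" if "keys q \<subseteq> toric_monoid d n" for q :: "_ \<Rightarrow>\<^sub>0 'k"
    using that
  proof (induction rule: keys_induct)
    case zero
    then show ?case by (intro exI[of _ 0]) simp
  next
    case (add e c q)
    then obtain p where p: "keys p \<subseteq> ?M" "push toric_map p = q" by blast
    obtain xs where xs: "e = toric_expo xs" "set xs \<subseteq> index_set d n" using add(1) by (rule toric_monoidE)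
    have "keys (single (list_monom xs) c + p) \<subseteq> ?M"
    proof -
      have "list_monom xs \<in> ?M" using xs(2) by (simp add: keys_list_monom)
      then have "keys (single (list_monom xs) c) \<subseteq> ?M" by simp
      then show ?thesis using keys_add[of "single (list_monom xs) c" p] p(1) by blast
    qed
    moreover have "push toric_map (single (list_monom xs) c + p) = single e c + q"
      by (simp add: push_add p xs toric_map_list_monom)
    ultimately show ?case by blast
  qed
  then show "(push toric_map :: (nat list, 'k) mpoly \<Rightarrow> _) ` carrier (poly_ring (index_set d n))
           = carrier (monoid_ring (toric_monoid d n))"
    unfolding poly_ring_eq_monoid_ring monoid_ring_simps
  proof (intro equalityI subsetI)
    fix q :: "_ \<Rightarrow>\<^sub>0 'k" assume "q \<in> push toric_map ` {p. keys p \<subseteq> ?M}"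
    then show "q \<in> {q. keys q \<subseteq> toric_monoid d n}" using closed by blast
  next
    fix q :: "_ \<Rightarrow>\<^sub>0 'k" assume "q \<in> {q. keys q \<subseteq> toric_monoid d n}"
    then obtain p where "keys p \<subseteq> ?M" "push toric_map p = q" using surj by blast
    then show "q \<in> push toric_map ` {p. keys p \<subseteq> ?M}" by blast
  qed
qed

lemma eval_at_origin:
  fixes p :: "('v, 'k::comm_ring_1) mpoly"
  assumes "p \<in> carrier (poly_ring I)"
  shows "eval_at (origin I) p = lookup p 0"
proof -
  have "eval_at (origin I) p = (\<Sum>m\<in>keys p. if m = 0 then lookup p 0 else 0)"
    unfolding eval_at_power_product
  proof (intro sum.cong refl)
    fix m assume m: "m \<in> keys p"
    show "lookup p m * power_product (origin I) m = (if m = 0 then lookup p 0 else 0)"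
    proof (cases "m = 0")
      case False
      then obtain v where v: "v \<in> keys m" by fastforce
      then have "v \<in> I" using m assms by (auto simp: poly_ring_def)
      then have "origin I v ^ lookup m v = (0 :: 'k)" using v by (simp add: origin_def in_keys_iff zero_power)
      then have "power_product (origin I) m = (0 :: 'k)"
        unfolding power_product_def using v by (intro prod_zero) auto
      then show ?thesis using False by simp
    qed simp
  qed
  also have "\<dots> = lookup p 0" by (simp add: in_keys_iff)
  finally show ?thesis .
qed

text \<open>The grading shows that only the exponent 0 is mapped to 0. With
  \<open>eval_at_origin\<close>, vanishing at the origin can thus be read off in K[S].\<close>

lemma lookup_push_toric_map_0:
  assumes "1 \<le> d" "p \<in> carrier (poly_ring (index_set d n))"
  shows "lookup (push toric_map p) 0 = lookup p 0"
proof -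
  have "m = 0" if m: "m \<in> keys p" "toric_map m = 0" for m
  proof -
    have "keys m \<subseteq> index_set d n" using m assms(2) by (auto simp: poly_ring_def)
    then obtain xs where xs: "set xs \<subseteq> index_set d n" "m = list_monom xs" using ex_list_monom by blast
    have "toric_deg d (toric_expo xs) = length xs" using assms(1) xs(1) by (rule toric_deg_expo')
    then have "xs = []" using m(2) xs(2) by (simp add: toric_map_list_monom toric_deg_def)
    then show ?thesis using xs by simp
  qed
  then have "{m. m \<in> keys p \<and> toric_map m = 0} = keys p \<inter> {0}" by auto
  moreover have "(\<Sum>m\<in>keys p \<inter> {0}. lookup p m) = lookup p 0"
    by (cases "0 \<in> keys p") (simp_all add: in_keys_iff)
  ultimately show ?thesis unfolding lookup_push by simp
qed

text \<open>The isomorphism theorem identifies the coordinate ring with K[S]. The complement of the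
  point ideal becomes the set of elements with nonzero constant term, which are exactly the
  denominators of \<open>loc 0\<close>.\<close>

lemma local_model_hibi:
  assumes "1 \<le> d"
  shows "\<exists>h :: _ \<Rightarrow> ((nat \<Rightarrow>\<^sub>0 nat) \<Rightarrow>\<^sub>0 'k) fract. local_model (toric_monoid d n) (toric_deg d)
     (local_ring_at (index_set d n) (hibi_variety d n :: (nat list \<Rightarrow> 'k::alg_closed_field) set) (origin (index_set d n))) h"
proof -
  interpret graded_monoid "toric_monoid d n" "toric_deg d" by (rule graded_monoid_toric[OF assms])
  let ?R = "poly_ring (index_set d n) :: (nat list, 'k) mpoly ring"
  let ?T = "monoid_ring (toric_monoid d n) :: ((nat \<Rightarrow>\<^sub>0 nat) \<Rightarrow>\<^sub>0 'k) ring"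
  let ?V = "hibi_variety d n :: (nat list \<Rightarrow> 'k) set"
  let ?A = "coordinate_ring (index_set d n) ?V"
  interpret P: ring_hom_ring ?R ?T "push toric_map" by (rule push_toric_map_ring_hom(1)[OF assms])
  define \<theta> where "\<theta> X = the_elem (push toric_map ` X)" for X :: "(nat list, 'k) mpoly set"
  have A: "?A = ?R Quot a_kernel ?R ?T (push toric_map)"
    unfolding coordinate_ring_def vanishing_ideal_hibi[OF assms] a_kernel_def' by simp
  have iso: "\<theta> \<in> ring_iso ?A ?T"
    unfolding A \<theta>_def by (rule P.FactRing_iso_set[OF push_toric_map_ring_hom(2)[OF assms]])
  have "cring ?R" by (rule cring_poly_ring)
  have "cring ?A"
    unfolding A by (rule ideal.quotient_is_cring[OF P.kernel_is_ideal \<open>cring ?R\<close>])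
  have \<theta>: "\<theta> ` carrier ?A = carrier ?T" "inj_on \<theta> (carrier ?A)" "\<theta> \<in> ring_hom ?A ?T"
    using iso by (auto simp: ring_iso_def bij_betw_def)
  have carrier_A: "\<exists>q\<in>carrier ?R. X = a_kernel ?R ?T (push toric_map) +>\<^bsub>?R\<^esub> q" if "X \<in> carrier ?A" for X
  proof -
    have "X \<in> a_rcosets\<^bsub>?R\<^esub> (a_kernel ?R ?T (push toric_map))"
      using that unfolding A by (simp add: FactRing_def)
    then show ?thesis unfolding A_RCOSETS_def' by blast
  qed
  have coset: "push toric_map p = \<theta> X \<and> p \<in> carrier ?R" if X: "X \<in> carrier ?A" and p: "p \<in> X" for X p
  proof -
    obtain q where q: "q \<in> carrier ?R" "X = a_kernel ?R ?T (push toric_map) +>\<^bsub>?R\<^esub> q"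
      using carrier_A[OF X] by blast
    then obtain r where r: "r \<in> carrier ?R" "push toric_map r = 0" "p = r \<oplus>\<^bsub>?R\<^esub> q"
      using p unfolding q(2) a_r_coset_def' a_kernel_def' by auto
    have "\<theta> X = push toric_map q" unfolding \<theta>_def q(2) by (rule P.the_elem_simp[OF q(1)])
    then show ?thesis using r q P.hom_add[OF r(1) q(1)] P.R.a_closed[OF r(1) q(1)] by simp
  qed
  \<comment> \<open>The universal quantifier in \<open>point_ideal\<close> would hold vacuously on
    an empty coset.\<close>
  have nonempty: "X \<noteq> {}" if X: "X \<in> carrier ?A" for X
  proof -
    obtain q where "q \<in> carrier ?R" "X = a_kernel ?R ?T (push toric_map) +>\<^bsub>?R\<^esub> q"
      using carrier_A[OF X] by blast
    moreover have "\<zero>\<^bsub>?R\<^esub> \<in> a_kernel ?R ?T (push toric_map)"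
      unfolding a_kernel_def' using P.R.zero_closed P.hom_zero by blast
    ultimately show ?thesis unfolding a_r_coset_def' by blast
  qed
  let ?U = "carrier ?A - point_ideal (index_set d n) ?V (origin (index_set d n))"
  have U: "?U = {X \<in> carrier ?A. lookup (\<theta> X) 0 \<noteq> 0}"
  proof -
    have "(\<forall>p\<in>X. eval_at (origin (index_set d n)) p = 0) \<longleftrightarrow> lookup (\<theta> X) 0 = 0" if X: "X \<in> carrier ?A" for X
    proof -
      have "eval_at (origin (index_set d n)) p = lookup (\<theta> X) 0" if "p \<in> X" for p
        using coset[OF X that] eval_at_origin lookup_push_toric_map_0[OF assms] by metis
      then show ?thesis using nonempty[OF X] by auto
    qed
    then show ?thesis unfolding point_ideal_def by auto
  qed
  have keys\<theta>: "keys (\<theta> X) \<subseteq> toric_monoid d n" if "X \<in> carrier ?A" for X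
    using \<theta>(1) that by auto
  have \<theta>0: "\<theta> \<zero>\<^bsub>?A\<^esub> = 0"
    using ring_hom_zero[OF \<theta>(3)] \<open>cring ?A\<close> cring_monoid_ring_S by (auto simp: cring_def)
  interpret loc: localized_domain ?A ?U \<theta>
  proof (rule localized_domain.intro)
    show "cring ?A" by fact
    show "\<one>\<^bsub>?A\<^esub> \<in> ?U"
      unfolding U using ring_hom_one[OF \<theta>(3)] cring.cring_simprules(6)[OF \<open>cring ?A\<close>] by simp
    fix X Y assume XY: "X \<in> ?U" "Y \<in> ?U"
    then show "X \<otimes>\<^bsub>?A\<^esub> Y \<in> ?U"
      unfolding U using ring_hom_mult[OF \<theta>(3), of X Y] cring.cring_simprules(5)[OF \<open>cring ?A\<close>, of X Y] keys\<theta>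
      by (simp add: lookup_mult_0)
    show "\<theta> X \<noteq> 0" using XY unfolding U by auto
  qed (use \<theta> \<theta>0 ring_hom_add[OF \<theta>(3)] ring_hom_mult[OF \<theta>(3)] ring_hom_one[OF \<theta>(3)] in auto)
  have "loc.fracs = loc 0"
  proof -
    have surj: "\<exists>X\<in>carrier ?A. \<theta> X = p" if "keys p \<subseteq> toric_monoid d n" for p
    proof -
      have "p \<in> \<theta> ` carrier ?A" using that unfolding \<theta>(1) by simp
      then show ?thesis by blast
    qed
    show ?thesis
    proof (intro equalityI subsetI)
      fix x assume "x \<in> loc.fracs"
      then obtain X Y where XY: "X \<in> carrier ?A" "Y \<in> ?U" "x = Fract (\<theta> X) (\<theta> Y)"
        by (rule loc.fracsE)
      then have "Y \<in> carrier ?A" "lookup (\<theta> Y) 0 \<noteq> 0" unfolding U by auto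
      then show "x \<in> loc 0"
        unfolding XY(3) using keys\<theta> XY(1) by (intro locI) (simp_all add: deg_ge_0)
    next
      fix x :: "((nat \<Rightarrow>\<^sub>0 nat) \<Rightarrow>\<^sub>0 'k) fract" assume "x \<in> loc 0"
      then obtain p s where ps: "x = Fract p s" "keys p \<subseteq> deg_ge 0" "keys s \<subseteq> toric_monoid d n"
        "lookup s 0 \<noteq> 0" by (rule locE)
      obtain X where X: "X \<in> carrier ?A" "\<theta> X = p" using surj ps(2) unfolding deg_ge_0 by blast
      obtain Y where Y: "Y \<in> carrier ?A" "\<theta> Y = s" using surj ps(3) by blast
      have "Y \<in> ?U" unfolding U using Y ps(4) by simp
      then show "x \<in> loc.fracs" unfolding loc.fracs_def using X Y ps(1) by blast
    qed
  qed
  then have "local_model (toric_monoid d n) (toric_deg d) (localization ?A ?U) loc.fract_of"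
    using loc.inj_fract_of loc.image_fract_of loc.fract_of_add loc.fract_of_mult loc.fract_of_constants
    by (intro local_model.intro local_model_axioms.intro graded_monoid_axioms) auto
  then show ?thesis unfolding local_ring_at_def by (rule exI[of _ loc.fract_of])
qed

theorem theorem8p3:
  fixes d n :: nat
  assumes "1 \<le> d" and "d \<le> n - d"
  shows "mult_at (index_set d n)
           (hibi_variety d n :: (nat list \<Rightarrow> 'k::alg_closed_field) set)
           (origin (index_set d n))
         = fact (d * (n - d)) / (\<Prod>h = 1..n - 1. of_nat h ^ min h (min d (n - h)))"
proof -
  let ?S = "toric_monoid d n" and ?r = "d * (n - d)"
  have "d \<le> n" using assms by simp
  let ?B = "local_ring_at (index_set d n) (hibi_variety d n :: (nat list \<Rightarrow> 'k) set) (origin (index_set d n))"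
  obtain h :: "_ \<Rightarrow> ((nat \<Rightarrow>\<^sub>0 nat) \<Rightarrow>\<^sub>0 'k) fract" where "local_model ?S (toric_deg d) ?B h" using local_model_hibi[OF assms(1)] by blast
  then interpret local_model ?S "toric_deg d" ?B h .
  obtain H :: "rat poly" where H: "\<And>k. poly H (of_nat k) = of_nat (card (multichains d n k (top_ix d n)))"
    "Polynomial.degree H \<le> ?r" "Polynomial.coeff H ?r = chain_det (top_ix d n)"
    using multichain_polynomial[OF top_ix_mem[OF \<open>d \<le> n\<close>]] unfolding ix_rank_top by blast
  have det: "chain_det (top_ix d n) = 1 / (\<Prod>h = 1..n - 1. of_nat h ^ min h (min d (n - h)))"
  proof -
    have "chain_det (top_ix d n) = (\<Prod>i<d. fact i / fact (n - d + i))"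
      unfolding top_ix_def by (rule chain_det_rectangle)
    also have "\<dots> = 1 / (\<Prod>i<d. fact (n - d + i) / fact i)"
      by (simp add: prod_dividef)
    also have "(\<Prod>i<d. fact (n - d + i) / fact i :: rat) = (\<Prod>h = 1..n - 1. of_nat h ^ min h (min d (n - h)))"
      using hook_product_rectangle[OF assms(2)] \<open>d \<le> n\<close> by simp
    finally show ?thesis .
  qed
  \<comment> \<open>So far the degree of \<open>H\<close> is only bounded by \<open>?r\<close>; the
    nonzero determinant makes its coefficient at \<open>?r\<close> the leading one.\<close>
  have "Polynomial.coeff H ?r \<noteq> 0" unfolding H(3) det by auto
  then have "Polynomial.degree H = ?r" using H(2) le_degree by (metis le_antisym)
  have "graded_degree gr = fact ?r * chain_det (top_ix d n)"
  proof (rule graded_degree_eqI)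
    show "krull_dim gr = enat (?r + 1)"
      using krull_dim_ring_iso[OF cring_monoid_ring_S cring_gr gr_map_iso]
        krull_dim_toric[OF assms(1) \<open>d \<le> n\<close>] by metis
    show "poly H (of_nat k) = of_nat (hilbert_function gr k)" for k
      unfolding hilbert_function_gr deg_at_def card_toric_deg[OF assms(1)] by (rule H(1))
    show "lead_coeff H = fact ?r * chain_det (top_ix d n) / fact ?r"
      using H(3) \<open>Polynomial.degree H = ?r\<close> by simp
  qed
  then show ?thesis
    unfolding mult_at_def Let_def the_maximal_ideal_B gr_def[symmetric] det by simp
qed

end
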